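(* Let $\alpha>0$, $\kappa>1$ and $C_*<\infty$. There exist a double sequence of real numbers $q(k,N)$, $k,N\in\mathbb{N}$, $0\le k\le N$, and a constant $\varepsilon<1$, both depending only on $\alpha,\kappa,C_*$, with $\lim_{N\to\infty}q(k,N)=1$ for every $k\in\mathbb{N}$, such that the following holds. Let $\xi>0$ and let $(x_i,r_i)_{i\in I}$ be a particle configuration satisfying $d_i/2>\kappa r_i$ and $r_i\le\alpha\xi$ for all $i\in I$, and such that $\mu_0:=\sup_{i\in I}r_id_i^{-3}$ satisfies $\mu_0\le C_*\xi^{-2}$. For all $f\in H^{-1}(\mathbb{R}^3)$, with $(\Phi_k)_{k\ge0}$ the terms produced by the Method of Reflections for the operator $-\Delta+\xi^{-2}$, the sequence $$\Psi_N=\sum_{k=0}^N q(k,N)\,\Phi_k$$ converges in $H^1(\mathbb{R}^3\setminus K)$ as $N\to\infty$ to the unique solution $u$ of $$-\Delta u+\xi^{-2}u=f\ \text{ in }\mathbb{R}^3\setminus K,\qquad u=0\ \text{ in }K.$$ Moreover, $$\|\Psi_N-u\|_{H^1(\mathbb{R}^3\setminus K)}\le C\,\varepsilon^N\,\|f\|_{H^{-1}(\mathbb{R}^3)},$$ where $C$ depends only on $\xi$.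
   Context: Particle configuration: $I$ is a finite or countable index set; $x_i\in\mathbb{R}^3$ are centers, $r_i>0$ radii, $B_i:=B_{r_i}(x_i)$, $K:=\bigcup_{i\in I}\overline{B_i}$, and $d_i:=\inf_{j\ne i}|x_i-x_j|$. Solution: $u\in H^1(\mathbb{R}^3)$ with $u=0$ in $K$ and $\int\nabla u\cdot\nabla v+\xi^{-2}\int uv=\langle f,v\rangle$ for all $v\in H^1(\mathbb{R}^3)$ with $v=0$ in $K$. For $w\in H^1(\mathbb{R}^3)$ let $Q_iw\in H^1(\mathbb{R}^3)$ be the unique function with $Q_iw=w$ in $\overline{B_i}$ and $-\Delta Q_iw+\xi^{-2}Q_iw=0$ in $\mathbb{R}^3\setminus\overline{B_i}$. Method of Reflections: $\Phi_0\in H^1(\mathbb{R}^3)$ solves $-\Delta\Phi_0+\xi^{-2}\Phi_0=f$ in $\mathbb{R}^3$. For each $i\in I$, $\Phi_{1,i}:=-Q_i\Phi_0$, and for $k\ge2$, $\Phi_{k,i}:=-Q_i\big(\sum_{j\ne i}\Phi_{k-1,j}\big)$. Finally $\Phi_k:=\sum_{i\in I}\Phi_{k,i}$ for $k\ge1$ (series in $H^1(\mathbb{R}^3)$). *)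

theory Defs
  imports "HOL-Analysis.Analysis"
begin

section \<open>The Sobolev space \<open>H\<^sup>1(\<real>\<^sup>3)\<close>\<close>

definition partial_deriv :: "3 \<Rightarrow> (real^3 \<Rightarrow> real) \<Rightarrow> real^3 \<Rightarrow> real" where
  "partial_deriv i \<phi> x = frechet_derivative \<phi> (at x) (axis i 1)"

primrec Ck :: "nat \<Rightarrow> (real^3 \<Rightarrow> real) \<Rightarrow> bool" where
  "Ck 0 \<phi> \<longleftrightarrow> continuous_on UNIV \<phi>"
| "Ck (Suc k) \<phi> \<longleftrightarrow> (\<forall>x. \<phi> differentiable (at x)) \<and> (\<forall>i. Ck k (partial_deriv i \<phi>))"

definition test_function :: "(real^3 \<Rightarrow> real) \<Rightarrow> bool" where
  "test_function \<phi> \<longleftrightarrow> (\<forall>k. Ck k \<phi>) \<and> compact (closure {x. \<phi> x \<noteq> 0})"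

definition square_integrable :: "(real^3 \<Rightarrow> 'b::euclidean_space) \<Rightarrow> bool" where
  "square_integrable g \<longleftrightarrow>
     g \<in> borel_measurable lborel \<and> integrable lborel (\<lambda>x. (norm (g x))\<^sup>2)"

definition is_weak_gradient :: "(real^3 \<Rightarrow> real) \<Rightarrow> (real^3 \<Rightarrow> real^3) \<Rightarrow> bool" where
  "is_weak_gradient u g \<longleftrightarrow> square_integrable g \<and>
     (\<forall>\<phi> i. test_function \<phi> \<longrightarrow>
        (LINT x|lborel. u x * partial_deriv i \<phi> x) = - (LINT x|lborel. g x $ i * \<phi> x))"

definition weak_gradient :: "(real^3 \<Rightarrow> real) \<Rightarrow> real^3 \<Rightarrow> real^3" where
  "weak_gradient u = (SOME g. is_weak_gradient u g)"

definition H1_function :: "(real^3 \<Rightarrow> real) \<Rightarrow> bool" where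
  "H1_function u \<longleftrightarrow> square_integrable u \<and> (\<exists>g. is_weak_gradient u g)"

subsection \<open>Test functions approximating the indicator of a box\<close>

lemma partialI:
  assumes "(\<phi> has_derivative D) (at x)"
  shows "partial_deriv i \<phi> x = D (axis i 1)"
  using frechet_derivative_at[OF assms] by (simp add: partial_deriv_def)

lemma differentiable_has_derivative:
  assumes "\<phi> differentiable (at x)"
  shows "(\<phi> has_derivative frechet_derivative \<phi> (at x)) (at x)"
  using assms frechet_derivative_works by blast

lemma Ck_SucD: "Ck (Suc k) \<phi> \<Longrightarrow> Ck k \<phi>"
proof (induction k arbitrary: \<phi>)
  case 0
  then show ?case
    by (simp add: continuous_at_imp_continuous_on differentiable_imp_continuous_within)
next
  case (Suc k)
  have "\<forall>i. Ck k (partial_deriv i \<phi>)"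
    using Suc.prems Suc.IH by (metis Ck.simps(2))
  then show ?case using Suc.prems by simp
qed

lemma partial_const: "partial_deriv i (\<lambda>x. c) = (\<lambda>x. 0)"
  by (rule ext, subst partialI[OF has_derivative_const]) simp

lemma Ck_const: "Ck k (\<lambda>x. c)"
  by (induction k arbitrary: c) (auto simp: partial_const)

lemma partial_add:
  assumes "\<forall>x. f differentiable (at x)" "\<forall>x. g differentiable (at x)"
  shows "partial_deriv i (\<lambda>x. f x + g x) = (\<lambda>x. partial_deriv i f x + partial_deriv i g x)"
proof
  fix x
  show "partial_deriv i (\<lambda>x. f x + g x) x = partial_deriv i f x + partial_deriv i g x"
    using assms differentiable_has_derivative
    by (subst partialI[OF has_derivative_add[of f "frechet_derivative f (at x)" _ g
          "frechet_derivative g (at x)"]])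
       (auto simp: partial_deriv_def)
qed

lemma partial_mult:
  assumes "\<forall>x. f differentiable (at x)" "\<forall>x. g differentiable (at x)"
  shows "partial_deriv i (\<lambda>x. f x * g x) = (\<lambda>x. f x * partial_deriv i g x + partial_deriv i f x * g x)"
proof
  fix x
  show "partial_deriv i (\<lambda>x. f x * g x) x = f x * partial_deriv i g x + partial_deriv i f x * g x"
    using assms differentiable_has_derivative
    by (subst partialI[OF has_derivative_mult[of f "frechet_derivative f (at x)" _ _ g
          "frechet_derivative g (at x)"]])
       (auto simp: partial_deriv_def)
qed

lemma Ck_add: "Ck k f \<Longrightarrow> Ck k g \<Longrightarrow> Ck k (\<lambda>x. f x + g x)"
proof (induction k arbitrary: f g)
  case 0
  then show ?case by (auto intro: continuous_intros)
next
  case (Suc k)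
  then show ?case by (auto simp: partial_add)
qed

lemma Ck_mult: "Ck k f \<Longrightarrow> Ck k g \<Longrightarrow> Ck k (\<lambda>x. f x * g x)"
proof (induction k arbitrary: f g)
  case 0
  then show ?case by (auto intro: continuous_intros)
next
  case (Suc k)
  have fg: "Ck k f" "Ck k g" using Suc.prems Ck_SucD by blast+
  then show ?case
    using Suc by (auto simp: partial_mult intro!: Ck_add)
qed

lemma Ck_prod: "finite S \<Longrightarrow> (\<And>i. i \<in> S \<Longrightarrow> Ck k (f i)) \<Longrightarrow> Ck k (\<lambda>x. \<Prod>i\<in>S. f i x)"
  by (induction S rule: finite_induct) (auto intro: Ck_const Ck_mult)

definition flat :: "nat \<Rightarrow> real \<Rightarrow> real" where
  "flat m t = (if t \<le> 0 then 0 else inverse t ^ m * exp (- inverse t))"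

lemma flat_tendsto_0: "(flat m \<longlongrightarrow> 0) (at 0)"
proof -
  have "((\<lambda>t. inverse t ^ m / exp (inverse t)) \<longlongrightarrow> (0::real)) (at_right 0)"
    by (rule filterlim_compose[OF tendsto_power_div_exp_0 filterlim_inverse_at_top_right])
  then have r: "(flat m \<longlongrightarrow> 0) (at_right 0)"
    by (rule Lim_transform_eventually)
       (auto simp: flat_def eventually_at_filter exp_minus divide_inverse)
  have "(flat m \<longlongrightarrow> 0) (at_left 0)"
    by (rule Lim_transform_eventually[OF tendsto_const])
       (auto simp: flat_def eventually_at_filter)
  with r show ?thesis by (rule filterlim_split_at[rotated])
qed

lemma flat_deriv:
  "(flat m has_real_derivative (- real m * flat (m + 1) t + flat (m + 2) t)) (at t)"
proof -
  consider "t < 0" | "t = 0" | "t > 0" by linarith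
  then show ?thesis
  proof cases
    case 1
    have "((\<lambda>t. 0::real) has_real_derivative 0) (at t)" by simp
    then have "(flat m has_real_derivative 0) (at t)"
      by (rule DERIV_cong_ev[THEN iffD1, rotated 3, OF _ refl _ refl])
         (use 1 in \<open>auto simp: flat_def intro!: eventually_mono[OF eventually_nhds_in_open[of "{..<0}"]]\<close>)
    then show ?thesis using 1 by (simp add: flat_def)
  next
    case 2
    have "((\<lambda>h. flat m h / h) \<longlongrightarrow> 0) (at 0)"
      by (rule Lim_transform_eventually[OF flat_tendsto_0[of "Suc m"]])
         (auto simp: flat_def eventually_at_filter divide_inverse)
    then have "(flat m has_real_derivative 0) (at 0)"
      unfolding DERIV_def by (simp add: flat_def[of _ 0])
    then show ?thesis using 2 by (simp add: flat_def)
  next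
    case 3
    have "((\<lambda>t. inverse t ^ m * exp (- inverse t)) has_real_derivative
        (- real m * flat (m + 1) t + flat (m + 2) t)) (at t)"
      using 3 by (auto intro!: derivative_eq_intros simp: flat_def)
         (cases m; simp add: field_simps power2_eq_square)
    then show ?thesis
      by (rule DERIV_cong_ev[THEN iffD1, rotated 3, OF _ refl _ refl])
         (use 3 in \<open>auto simp: flat_def intro!: eventually_mono[OF eventually_nhds_in_open[of "{0<..}"]]\<close>)
  qed
qed

lemma flat_affine_deriv:
  "((\<lambda>x::real^3. flat m (c * x $ i + d)) has_derivative
    (\<lambda>h. (- real m * flat (m + 1) (c * x $ i + d) + flat (m + 2) (c * x $ i + d)) * (c * h $ i))) (at x)"
proof -
  have "((\<lambda>x::real^3. c * x $ i + d) has_derivative (\<lambda>h. c * h $ i)) (at x)"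
    by (auto intro!: derivative_eq_intros bounded_linear.has_derivative[OF bounded_linear_vec_nth])
  from has_derivative_compose[OF this flat_deriv[unfolded has_field_derivative_def]]
  show ?thesis by (simp add: mult.commute)
qed

lemma Ck_flat_affine: "Ck k (\<lambda>x. flat m (c * x $ i + d))"
proof (induction k arbitrary: m)
  case 0
  show ?case
    by (auto intro!: continuous_at_imp_continuous_on has_derivative_continuous[OF flat_affine_deriv])
next
  case (Suc k)
  have "partial_deriv j (\<lambda>x. flat m (c * x $ i + d)) =
     (\<lambda>x. ((- real m) * flat (m + 1) (c * x $ i + d) + flat (m + 2) (c * x $ i + d)) * (c * axis j 1 $ i))" for j
    by (rule ext) (subst partialI[OF flat_affine_deriv], simp)
  moreover have "(\<lambda>x::real^3. flat m (c * x $ i + d)) differentiable (at x)" for x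
    using flat_affine_deriv differentiable_def by blast
  moreover have "Ck k (\<lambda>x::real^3. ((- real m) * flat (m + 1) (c * x $ i + d) + flat (m + 2) (c * x $ i + d)) * (c * axis j 1 $ i))" for j
    by (rule Ck_mult[OF Ck_add[OF Ck_mult[OF Ck_const Suc.IH] Suc.IH] Ck_const])
  ultimately show ?case unfolding Ck.simps by presburger
qed

definition box_bump :: "real^3 \<Rightarrow> real^3 \<Rightarrow> nat \<Rightarrow> real^3 \<Rightarrow> real" where
  "box_bump a b n x = (\<Prod>i\<in>UNIV. flat 0 (real n * x $ i + (- real n * a $ i)) *
      flat 0 ((- real n) * x $ i + real n * b $ i))"

lemma box_bump_eq:
  "box_bump a b n x = (\<Prod>i\<in>UNIV. flat 0 (real n * (x $ i - a $ i)) * flat 0 (real n * (b $ i - x $ i)))"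
  by (simp add: box_bump_def algebra_simps)

lemma flat_0_bounds: "0 \<le> flat 0 t" "flat 0 t \<le> 1"
  by (auto simp: flat_def)

lemma box_bump_bounds: "0 \<le> box_bump a b n x" "box_bump a b n x \<le> 1"
  unfolding box_bump_def
  by (auto intro!: prod_nonneg prod_le_1 mult_nonneg_nonneg mult_le_one flat_0_bounds)

lemma box_bump_outside: "x \<notin> box a b \<Longrightarrow> box_bump a b n x = 0"
proof -
  assume "x \<notin> box a b"
  then obtain i where "\<not> (a $ i < x $ i \<and> x $ i < b $ i)"
    by (auto simp: mem_box_cart)
  then have "flat 0 (real n * (x $ i - a $ i)) * flat 0 (real n * (b $ i - x $ i)) = 0"
    by (auto simp: flat_def mult_le_0_iff not_less)
  then show ?thesis unfolding box_bump_eq by (intro prod_zero) auto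
qed

lemma test_function_box_bump: "test_function (box_bump a b n)"
  unfolding test_function_def
proof
  show "\<forall>k. Ck k (box_bump a b n)"
    unfolding box_bump_def by (rule allI, rule Ck_prod, rule finite, rule Ck_mult; rule Ck_flat_affine)
  have "{x. box_bump a b n x \<noteq> 0} \<subseteq> box a b" using box_bump_outside by blast
  then show "compact (closure {x. box_bump a b n x \<noteq> 0})"
    by (meson bounded_box bounded_subset compact_closure)
qed

lemma flat_0_tendsto_1: "0 < t \<Longrightarrow> (\<lambda>n. flat 0 (real n * t)) \<longlonglongrightarrow> 1"
proof -
  assume t: "0 < t"
  have "(\<lambda>n. exp (- (inverse t * inverse (real n)))) \<longlonglongrightarrow> exp (- (inverse t * 0))"
    by (intro tendsto_intros lim_inverse_n)
  then have "(\<lambda>n. exp (- (inverse t * inverse (real n)))) \<longlonglongrightarrow> 1" by simp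
  then show ?thesis
    by (rule Lim_transform_eventually)
       (use t in \<open>auto simp: flat_def mult_le_0_iff intro!: eventually_mono[OF eventually_gt_at_top[of 0]]\<close>)
qed

lemma box_bump_tendsto: "(\<lambda>n. box_bump a b n x) \<longlonglongrightarrow> indicator (box a b) x"
proof (cases "x \<in> box a b")
  case True
  have "(\<lambda>n. box_bump a b n x) \<longlonglongrightarrow> (\<Prod>i\<in>(UNIV::3 set). 1 * 1)"
    unfolding box_bump_eq
    by (intro tendsto_prod tendsto_mult flat_0_tendsto_1) (use True in \<open>auto simp: mem_box_cart\<close>)
  then show ?thesis using True by simp
qed (simp add: box_bump_outside)

lemma test_function_measurable [measurable]:
  "test_function \<phi> \<Longrightarrow> \<phi> \<in> borel_measurable borel"
  unfolding test_function_def by (metis Ck.simps(1) borel_measurable_continuous_onI)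

lemma test_function_partial_continuous:
  "test_function \<phi> \<Longrightarrow> continuous_on UNIV (partial_deriv i \<phi>)"
  unfolding test_function_def by (metis Ck.simps)

subsection \<open>Uniqueness of the weak gradient\<close>

lemma square_integrable_measurable:
  "square_integrable g \<Longrightarrow> g \<in> borel_measurable borel"
  by (simp add: square_integrable_def)

lemma integrable_mult_of_square:
  fixes f g :: "real^3 \<Rightarrow> real"
  assumes [measurable]: "f \<in> borel_measurable borel" "g \<in> borel_measurable borel"
    and "integrable lborel (\<lambda>x. (f x)\<^sup>2)" "integrable lborel (\<lambda>x. (g x)\<^sup>2)"
  shows "integrable lborel (\<lambda>x. f x * g x)"
proof (rule Bochner_Integration.integrable_bound)
  show "integrable lborel (\<lambda>x. (f x)\<^sup>2 + (g x)\<^sup>2)" using assms by simp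
  have "\<bar>a * b\<bar> \<le> a\<^sup>2 + b\<^sup>2" for a b :: real
  proof -
    have "0 \<le> (\<bar>a\<bar> - \<bar>b\<bar>)\<^sup>2" "0 \<le> \<bar>a\<bar> * \<bar>b\<bar>" by auto
    then have "2 * (\<bar>a\<bar> * \<bar>b\<bar>) \<le> a\<^sup>2 + b\<^sup>2" by (simp add: power2_diff)
    then show ?thesis unfolding abs_mult using \<open>0 \<le> \<bar>a\<bar> * \<bar>b\<bar>\<close> by linarith
  qed
  then show "AE x in lborel. norm (f x * g x) \<le> norm ((f x)\<^sup>2 + (g x)\<^sup>2)" by simp
qed simp

lemma square_integrable_inner:
  assumes "square_integrable f" "square_integrable g"
  shows "integrable lborel (\<lambda>x. f x \<bullet> g x)"
proof (rule Bochner_Integration.integrable_bound)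
  note [measurable] = assms[THEN square_integrable_measurable]
  show "integrable lborel (\<lambda>x. norm (f x) * norm (g x))"
    using assms by (intro integrable_mult_of_square) (auto simp: square_integrable_def)
  show "(\<lambda>x. f x \<bullet> g x) \<in> borel_measurable lborel" by measurable
  show "AE x in lborel. norm (f x \<bullet> g x) \<le> norm (norm (f x) * norm (g x))"
    by (simp add: Cauchy_Schwarz_ineq2)
qed

lemma square_integrable_mult:
  fixes f g :: "real^3 \<Rightarrow> real"
  shows "square_integrable f \<Longrightarrow> square_integrable g \<Longrightarrow> integrable lborel (\<lambda>x. f x * g x)"
  using square_integrable_inner[of f g] by simp

lemma square_integrable_scaleR:
  assumes "square_integrable f"
  shows "square_integrable (\<lambda>x. c *\<^sub>R f x)"
proof -
  note [measurable] = square_integrable_measurable[OF assms]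
  have "(\<lambda>x. c *\<^sub>R f x) \<in> borel_measurable lborel" by measurable
  then show ?thesis using assms by (simp add: square_integrable_def power_mult_distrib)
qed

lemma square_integrable_add:
  assumes "square_integrable f" "square_integrable g"
  shows "square_integrable (\<lambda>x. f x + g x)"
proof -
  have eq: "(norm (f x + g x))\<^sup>2 = (norm (f x))\<^sup>2 + 2 * (f x \<bullet> g x) + (norm (g x))\<^sup>2" for x
    by (simp add: power2_norm_eq_inner inner_simps inner_commute)
  note [measurable] = assms[THEN square_integrable_measurable]
  have "(\<lambda>x. f x + g x) \<in> borel_measurable lborel" by measurable
  then show ?thesis
    using assms square_integrable_inner[OF assms] eq by (simp add: square_integrable_def)
qed

lemma square_integrable_0: "square_integrable (\<lambda>x. 0)"
  by (simp add: square_integrable_def)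

lemma square_integrable_nth:
  assumes "square_integrable (g :: real^3 \<Rightarrow> real^3)"
  shows "square_integrable (\<lambda>x. g x $ i)"
  unfolding square_integrable_def
proof
  note [measurable] = square_integrable_measurable[OF assms]
  show m: "(\<lambda>x. g x $ i) \<in> borel_measurable lborel"
    unfolding cart_eq_inner_axis by measurable
  show "integrable lborel (\<lambda>x. (norm (g x $ i))\<^sup>2)"
  proof (rule Bochner_Integration.integrable_bound)
    show "integrable lborel (\<lambda>x. (norm (g x))\<^sup>2)"
      using assms by (simp add: square_integrable_def)
    show "(\<lambda>x. (norm (g x $ i))\<^sup>2) \<in> borel_measurable lborel"
      using m by measurable
    show "AE x in lborel. norm ((norm (g x $ i))\<^sup>2) \<le> norm ((norm (g x))\<^sup>2)"
      by (simp add: power2_le_iff_abs_le component_le_norm_cart)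
  qed
qed

lemma square_integrable_compact_support:
  fixes \<phi> :: "real^3 \<Rightarrow> real"
  assumes "continuous_on UNIV \<phi>" "compact S" "\<And>x. x \<notin> S \<Longrightarrow> \<phi> x = 0"
  shows "square_integrable \<phi>"
  unfolding square_integrable_def
proof
  show [measurable]: "\<phi> \<in> borel_measurable lborel"
    using assms(1) by (simp add: borel_measurable_continuous_onI)
  have "integrable lborel (\<lambda>x. indicator S x *\<^sub>R (norm (\<phi> x))\<^sup>2)"
    by (rule borel_integrable_compact[OF assms(2)])
       (auto intro!: continuous_intros continuous_on_subset[OF assms(1)])
  moreover have "(\<lambda>x. indicator S x *\<^sub>R (norm (\<phi> x))\<^sup>2) = (\<lambda>x. (norm (\<phi> x))\<^sup>2)"
    using assms(3) by (auto simp: fun_eq_iff indicator_def)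
  ultimately show "integrable lborel (\<lambda>x. (norm (\<phi> x))\<^sup>2)" by simp
qed

lemma test_function_square_integrable:
  assumes "test_function \<phi>"
  shows "square_integrable \<phi>"
proof (rule square_integrable_compact_support)
  show "continuous_on UNIV \<phi>"
    using assms by (metis test_function_def Ck.simps(1))
  show "compact (closure {x. \<phi> x \<noteq> 0})" using assms by (simp add: test_function_def)
  show "\<And>x. x \<notin> closure {x. \<phi> x \<noteq> 0} \<Longrightarrow> \<phi> x = 0"
    using closure_subset[of "{x. \<phi> x \<noteq> 0}"] by auto
qed

lemma test_function_partial_square_integrable:
  assumes "test_function \<phi>"
  shows "square_integrable (partial_deriv i \<phi>)"
proof (rule square_integrable_compact_support)
  show "continuous_on UNIV (partial_deriv i \<phi>)"
    using assms by (rule test_function_partial_continuous)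
  show "compact (closure {x. \<phi> x \<noteq> 0})" using assms by (simp add: test_function_def)
  fix x assume x: "x \<notin> closure {x. \<phi> x \<noteq> 0}"
  have "((\<lambda>x. 0::real) has_derivative (\<lambda>h. 0)) (at x)" by simp
  then have "(\<phi> has_derivative (\<lambda>h. 0)) (at x)"
    by (rule has_derivative_transform_within_open[of _ _ x UNIV "- closure {x. \<phi> x \<noteq> 0}"])
       (use x closure_subset[of "{x. \<phi> x \<noteq> 0}"] in auto)
  then show "partial_deriv i \<phi> x = 0" using partialI by fastforce
qed

lemma square_integrable_indicator_box:
  "square_integrable (indicator (box a b) :: real^3 \<Rightarrow> real)"
proof -
  have "(\<lambda>x. (norm (indicator (box a b) x :: real))\<^sup>2) = (indicator (box a b) :: real^3 \<Rightarrow> real)"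
    by (simp add: indicator_def fun_eq_iff)
  then show ?thesis
    using emeasure_lborel_box_finite[of a b] by (simp add: square_integrable_def)
qed

lemma zero_if_box_integrals_zero:
  fixes g :: "real^3 \<Rightarrow> real"
  assumes g: "square_integrable g"
    and 0: "\<And>a b. (LINT x|lborel. indicator (box a b) x * g x) = 0"
  shows "AE x in lborel. g x = 0"
proof -
  note [measurable] = square_integrable_measurable[OF g]
  have int: "integrable lborel (\<lambda>x. indicator (box a b) x * h x)"
    if "square_integrable h" for a b :: "real^3" and h :: "real^3 \<Rightarrow> real"
    by (rule square_integrable_mult[OF square_integrable_indicator_box that])
  define p where "p x = max 0 (g x)" for x
  define m where "m x = max 0 (- g x)" for x
  have [measurable]: "p \<in> borel_measurable borel" "m \<in> borel_measurable borel"
    unfolding p_def m_def by measurable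
  have bound: "square_integrable h"
    if [measurable]: "h \<in> borel_measurable borel" and le: "\<And>x. \<bar>h x\<bar> \<le> \<bar>g x\<bar>" for h :: "real^3 \<Rightarrow> real"
    unfolding square_integrable_def
  proof
    show "integrable lborel (\<lambda>x. (norm (h x))\<^sup>2)"
    proof (rule Bochner_Integration.integrable_bound)
      show "integrable lborel (\<lambda>x. (norm (g x))\<^sup>2)" using g by (simp add: square_integrable_def)
      show "AE x in lborel. norm ((norm (h x))\<^sup>2) \<le> norm ((norm (g x))\<^sup>2)"
        using le by (simp add: abs_le_square_iff)
    qed measurable
  qed measurable
  have sp: "square_integrable p" "square_integrable m"
    by (rule bound; simp add: p_def m_def)+
  have pm: "g x = p x - m x" "0 \<le> p x" "0 \<le> m x" for x by (auto simp: p_def m_def)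
  have eq: "(LINT x|lborel. indicator (box a b) x * p x) = (LINT x|lborel. indicator (box a b) x * m x)" for a b
    using 0[of a b] int[OF sp(1), of a b] int[OF sp(2), of a b]
    by (simp add: pm(1) right_diff_distrib)
  let ?P = "density lborel (\<lambda>x. ennreal (p x))" and ?M = "density lborel (\<lambda>x. ennreal (m x))"
  have em: "emeasure (density lborel (\<lambda>x. ennreal (h x))) (box a b)
      = ennreal (LINT x|lborel. indicator (box a b) x * h x)"
    if "square_integrable h" "\<And>x. 0 \<le> h x" for a b h
  proof -
    note [measurable] = square_integrable_measurable[OF that(1)]
    have "emeasure (density lborel (\<lambda>x. ennreal (h x))) (box a b)
      = (\<integral>\<^sup>+x. ennreal (indicator (box a b) x * h x) \<partial>lborel)"
      by (subst emeasure_density) (auto intro!: nn_integral_cong simp: indicator_def)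
    also have "\<dots> = ennreal (LINT x|lborel. indicator (box a b) x * h x)"
      by (rule nn_integral_eq_integral[OF int[OF that(1)]]) (use that(2) in auto)
    finally show ?thesis .
  qed
  have "?P = ?M"
  proof (rule measure_eqI_generator_eq)
    let ?E = "range (\<lambda>(a, b). box a b::(real^3) set)"
    show "Int_stable ?E"
      by (auto simp: Int_stable_def box_Int_box)
    show "?E \<subseteq> Pow UNIV" "sets ?P = sigma_sets UNIV ?E" "sets ?M = sigma_sets UNIV ?E"
      by (simp_all add: borel_eq_box)
    let ?A = "\<lambda>n::nat. box (- (real n *\<^sub>R One)) (real n *\<^sub>R One) :: (real^3) set"
    show "range ?A \<subseteq> ?E" "(\<Union>i. ?A i) = UNIV"
      unfolding UN_box_eq_UNIV by auto
    show "emeasure ?P (?A i) \<noteq> \<infinity>" for i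
      using em[OF sp(1) pm(2)] by simp
    show "emeasure ?P X = emeasure ?M X" if "X \<in> ?E" for X
      using that em[OF sp(1) pm(2)] em[OF sp(2) pm(3)] eq by auto
  qed
  then have "AE x in lborel. ennreal (p x) = ennreal (m x)"
    by (subst (asm) sigma_finite_measure.density_unique_iff[OF sigma_finite_lborel]) auto
  then show ?thesis by (auto simp: pm)
qed

lemma zero_if_orthogonal_to_test_functions:
  fixes g :: "real^3 \<Rightarrow> real"
  assumes g: "square_integrable g"
    and 0: "\<And>\<phi>. test_function \<phi> \<Longrightarrow> (LINT x|lborel. g x * \<phi> x) = 0"
  shows "AE x in lborel. g x = 0"
proof (rule zero_if_box_integrals_zero[OF g])
  fix a b :: "real^3"
  note [measurable] = square_integrable_measurable[OF g]
  have [measurable]: "box_bump a b n \<in> borel_measurable borel" for n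
    by (rule test_function_measurable[OF test_function_box_bump])
  from square_integrable_mult[OF g square_integrable_indicator_box]
  have int: "integrable lborel (\<lambda>x. \<bar>g x * indicator (box a b) x\<bar>)" by simp
  have "(\<lambda>n. LINT x|lborel. g x * box_bump a b n x) \<longlonglongrightarrow> (LINT x|lborel. g x * indicator (box a b) x)"
  proof (rule integral_dominated_convergence[OF _ _ int])
    show "AE x in lborel. (\<lambda>n. g x * box_bump a b n x) \<longlonglongrightarrow> g x * indicator (box a b) x"
      by (auto intro!: tendsto_intros box_bump_tendsto)
    show "AE x in lborel. norm (g x * box_bump a b n x) \<le> \<bar>g x * indicator (box a b) x\<bar>" for n
      using box_bump_bounds[of a b n] box_bump_outside[of _ a b n]
      by (intro AE_I2) (auto simp: abs_mult indicator_def intro!: mult_left_le)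
  qed measurable
  moreover have "(LINT x|lborel. g x * box_bump a b n x) = 0" for n
    by (rule 0[OF test_function_box_bump])
  ultimately have "(LINT x|lborel. g x * indicator (box a b) x) = 0"
    by (simp add: LIMSEQ_const_iff)
  then show "(LINT x|lborel. indicator (box a b) x * g x) = 0" by (simp add: mult.commute)
qed

lemma is_weak_gradient_unique:
  assumes uv: "AE x in lborel. u x = v x" and [measurable]: "u \<in> borel_measurable borel" "v \<in> borel_measurable borel"
    and g: "is_weak_gradient u g" and h: "is_weak_gradient v h"
  shows "AE x in lborel. g x = h x"
proof -
  have sg: "square_integrable g" "square_integrable h"
    using g h by (auto simp: is_weak_gradient_def)
  have "AE x in lborel. g x $ i - h x $ i = 0" for i
  proof (rule zero_if_orthogonal_to_test_functions)
    show "square_integrable (\<lambda>x. g x $ i - h x $ i)"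
      using square_integrable_add[OF square_integrable_nth[OF sg(1), of i]
          square_integrable_scaleR[OF square_integrable_nth[OF sg(2), of i], of "-1"]] by simp
    fix \<phi> assume \<phi>: "test_function \<phi>"
    have [measurable]: "partial_deriv i \<phi> \<in> borel_measurable borel"
      using test_function_partial_continuous[OF \<phi>] by (rule borel_measurable_continuous_onI)
    have "(LINT x|lborel. u x * partial_deriv i \<phi> x) = (LINT x|lborel. v x * partial_deriv i \<phi> x)"
      by (rule integral_cong_AE) (use uv in auto)
    moreover have "integrable lborel (\<lambda>x. g x $ i * \<phi> x)" "integrable lborel (\<lambda>x. h x $ i * \<phi> x)"
      by (intro square_integrable_mult square_integrable_nth sg test_function_square_integrable[OF \<phi>])+
    ultimately show "(LINT x|lborel. (g x $ i - h x $ i) * \<phi> x) = 0"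
      using g h \<phi> by (simp add: is_weak_gradient_def left_diff_distrib)
  qed
  then have "AE x in lborel. \<forall>i. g x $ i - h x $ i = 0"
    by (simp add: AE_finite_all AE_all_countable)
  then show ?thesis by (simp add: vec_eq_iff)
qed

lemma is_weak_gradient_weak_gradient: "H1_function u \<Longrightarrow> is_weak_gradient u (weak_gradient u)"
  unfolding H1_function_def weak_gradient_def by (metis someI_ex)

lemma is_weak_gradient_add:
  assumes "square_integrable u" "square_integrable v" "is_weak_gradient u g" "is_weak_gradient v h"
  shows "is_weak_gradient (\<lambda>x. u x + v x) (\<lambda>x. g x + h x)"
  unfolding is_weak_gradient_def
proof (intro conjI allI impI)
  have sg: "square_integrable g" "square_integrable h"
    using assms by (auto simp: is_weak_gradient_def)
  then show "square_integrable (\<lambda>x. g x + h x)" by (rule square_integrable_add)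
  fix \<phi> i assume \<phi>: "test_function \<phi>"
  have "integrable lborel (\<lambda>x. u x * partial_deriv i \<phi> x)" "integrable lborel (\<lambda>x. v x * partial_deriv i \<phi> x)"
    "integrable lborel (\<lambda>x. g x $ i * \<phi> x)" "integrable lborel (\<lambda>x. h x $ i * \<phi> x)"
    by (intro square_integrable_mult square_integrable_nth sg assms test_function_square_integrable[OF \<phi>]
        test_function_partial_square_integrable[OF \<phi>])+
  then show "(LINT x|lborel. (u x + v x) * partial_deriv i \<phi> x) = - (LINT x|lborel. (g x + h x) $ i * \<phi> x)"
    using assms(3,4) \<phi> by (simp add: is_weak_gradient_def distrib_right)
qed

lemma is_weak_gradient_scaleR:
  assumes "is_weak_gradient u g"
  shows "is_weak_gradient (\<lambda>x. c * u x) (\<lambda>x. c *\<^sub>R g x)"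
  using assms by (auto simp: is_weak_gradient_def square_integrable_scaleR mult.assoc)

lemma is_weak_gradient_0: "is_weak_gradient (\<lambda>x. 0) (\<lambda>x. 0)"
  by (simp add: is_weak_gradient_def square_integrable_0)

lemma H1_function_add: "H1_function u \<Longrightarrow> H1_function v \<Longrightarrow> H1_function (\<lambda>x. u x + v x)"
  unfolding H1_function_def using is_weak_gradient_add square_integrable_add by blast

lemma H1_function_scaleR: "H1_function u \<Longrightarrow> H1_function (\<lambda>x. c * u x)"
  unfolding H1_function_def
  using is_weak_gradient_scaleR square_integrable_scaleR[of u c] by auto

lemma H1_function_0: "H1_function (\<lambda>x. 0)"
  unfolding H1_function_def using square_integrable_0 is_weak_gradient_0 by blast

subsection \<open>The Hilbert space structure on equivalence classes\<close>

quotient_type h1 = "real^3 \<Rightarrow> real" / partial: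
  "\<lambda>u v. H1_function u \<and> H1_function v \<and> (AE x in lborel. u x = v x)"
proof (rule part_equivpI)
  show "\<exists>u. H1_function u \<and> H1_function u \<and> (AE x in lborel. u x = u x)"
    using H1_function_0 by auto
qed (auto intro!: sympI transpI)

text \<open>\<open>rep_h1 w\<close> is an unspecified representative of the class \<open>w\<close>; the quantities below are
  insensitive to its choice.\<close>

definition grad :: "h1 \<Rightarrow> real^3 \<Rightarrow> real^3" where
  "grad w = weak_gradient (rep_h1 w)"

instantiation h1 :: real_vector
begin

lift_definition zero_h1 :: h1 is "\<lambda>x. 0" by (simp add: H1_function_0)

lift_definition plus_h1 :: "h1 \<Rightarrow> h1 \<Rightarrow> h1" is "\<lambda>u v x. u x + v x"
  by (auto simp: H1_function_add)

lift_definition scaleR_h1 :: "real \<Rightarrow> h1 \<Rightarrow> h1" is "\<lambda>c u x. c * u x"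
  by (auto simp: H1_function_scaleR)

definition uminus_h1 :: "h1 \<Rightarrow> h1" where "uminus_h1 u = (-1) *\<^sub>R u"

definition minus_h1 :: "h1 \<Rightarrow> h1 \<Rightarrow> h1" where "minus_h1 u v = u + (-1) *\<^sub>R v"

instance
proof
  fix a b :: real and u v w :: h1
  show "u + v + w = u + (v + w)" by transfer (auto simp: H1_function_add add.assoc)
  show "u + v = v + u" by transfer (auto simp: H1_function_add add.commute)
  show "0 + u = u" by transfer (auto)
  show "- u + u = 0" unfolding uminus_h1_def
    by transfer (auto simp: H1_function_0 H1_function_add H1_function_scaleR[of _ "-1", simplified])
  show "u - v = u + - v" by (simp add: uminus_h1_def minus_h1_def)
  show "a *\<^sub>R (u + v) = a *\<^sub>R u + a *\<^sub>R v"
    by transfer (auto simp: H1_function_add H1_function_scaleR distrib_left)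
  show "(a + b) *\<^sub>R u = a *\<^sub>R u + b *\<^sub>R u"
    by transfer (auto simp: H1_function_add H1_function_scaleR distrib_right)
  show "a *\<^sub>R b *\<^sub>R u = (a * b) *\<^sub>R u"
    by transfer (auto simp: H1_function_scaleR mult.assoc)
  show "1 *\<^sub>R u = u" by transfer auto
qed

end

lemma H1_function_rep: "H1_function (rep_h1 w)"
  using Quotient_rep_reflp[OF Quotient_h1] by blast

lemma rep_abs_h1: "H1_function u \<Longrightarrow> AE x in lborel. rep_h1 (abs_h1 u) x = u x"
  using Quotient_rep_abs[OF Quotient_h1, of u] by blast

lemma h1_eq_iff: "u = v \<longleftrightarrow> (AE x in lborel. rep_h1 u x = rep_h1 v x)"
  using Quotient_rel_rep[OF Quotient_h1, of u v] H1_function_rep[of u] H1_function_rep[of v] by simp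

lemma rep_add: "AE x in lborel. rep_h1 (u + v) x = rep_h1 u x + rep_h1 v x"
proof -
  have "u + v = abs_h1 (\<lambda>x. rep_h1 u x + rep_h1 v x)"
    by (simp add: plus_h1_def)
  then show ?thesis using rep_abs_h1 H1_function_add H1_function_rep by metis
qed

lemma rep_scaleR: "AE x in lborel. rep_h1 (c *\<^sub>R u) x = c * rep_h1 u x"
proof -
  have "c *\<^sub>R u = abs_h1 (\<lambda>x. c * rep_h1 u x)"
    by (simp add: scaleR_h1_def)
  then show ?thesis using rep_abs_h1 H1_function_scaleR H1_function_rep by metis
qed

lemma rep_0: "AE x in lborel. rep_h1 0 x = 0"
  using rep_abs_h1[OF H1_function_0] by (simp add: zero_h1_def)

lemma is_weak_gradient_grad: "is_weak_gradient (rep_h1 w) (grad w)"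
  unfolding grad_def by (rule is_weak_gradient_weak_gradient[OF H1_function_rep])

lemma square_integrable_rep: "square_integrable (rep_h1 w)"
  using H1_function_rep H1_function_def by blast

lemma square_integrable_grad: "square_integrable (grad w)"
  using is_weak_gradient_grad is_weak_gradient_def by blast

lemma rep_measurable [measurable]: "rep_h1 w \<in> borel_measurable borel"
  by (rule square_integrable_measurable[OF square_integrable_rep])

lemma grad_measurable [measurable]: "grad w \<in> borel_measurable borel"
  by (rule square_integrable_measurable[OF square_integrable_grad])

lemma grad_add: "AE x in lborel. grad (u + v) x = grad u x + grad v x"
  by (rule is_weak_gradient_unique[OF rep_add _ _ is_weak_gradient_grad
        is_weak_gradient_add[OF square_integrable_rep square_integrable_rep
          is_weak_gradient_grad is_weak_gradient_grad]]) auto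

lemma grad_scaleR: "AE x in lborel. grad (c *\<^sub>R u) x = c *\<^sub>R grad u x"
  by (rule is_weak_gradient_unique[OF rep_scaleR _ _ is_weak_gradient_grad
        is_weak_gradient_scaleR[OF is_weak_gradient_grad]]) auto

lemma grad_0: "AE x in lborel. grad 0 x = 0"
  by (rule is_weak_gradient_unique[OF rep_0 _ _ is_weak_gradient_grad is_weak_gradient_0]) auto

lemma integrable_rep_mult: "integrable lborel (\<lambda>x. rep_h1 u x * rep_h1 v x)"
  by (intro square_integrable_mult square_integrable_rep)

lemma integrable_grad_inner: "integrable lborel (\<lambda>x. grad u x \<bullet> grad v x)"
  by (intro square_integrable_inner square_integrable_grad)

instantiation h1 :: real_inner
begin

definition inner_h1 :: "h1 \<Rightarrow> h1 \<Rightarrow> real" where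
  "inner_h1 u v = (LINT x|lborel. rep_h1 u x * rep_h1 v x) + (LINT x|lborel. grad u x \<bullet> grad v x)"

definition norm_h1 :: "h1 \<Rightarrow> real" where "norm_h1 u = sqrt (u \<bullet> u)"

definition sgn_h1 :: "h1 \<Rightarrow> h1" where "sgn_h1 u = inverse (norm u) *\<^sub>R u"

definition dist_h1 :: "h1 \<Rightarrow> h1 \<Rightarrow> real" where "dist_h1 u v = norm (u - v)"

definition uniformity_h1 :: "(h1 \<times> h1) filter" where
  "uniformity_h1 = (INF e\<in>{0 <..}. principal {(u, v). dist u v < e})"

definition open_h1 :: "h1 set \<Rightarrow> bool" where
  "open_h1 S \<longleftrightarrow> (\<forall>u\<in>S. \<forall>\<^sub>F (u', v) in uniformity. u' = u \<longrightarrow> v \<in> S)"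

instance
proof
  fix u v w :: h1 and c :: real and S :: "h1 set"
  show "dist u v = norm (u - v)" by (rule dist_h1_def)
  show "sgn u = inverse (norm u) *\<^sub>R u" by (rule sgn_h1_def)
  show "uniformity = (INF e\<in>{0 <..}. principal {(u, v::h1). dist u v < e})"
    by (rule uniformity_h1_def)
  show "open S \<longleftrightarrow> (\<forall>u\<in>S. \<forall>\<^sub>F (u', v) in uniformity. u' = u \<longrightarrow> v \<in> S)"
    by (rule open_h1_def)
  show "norm u = sqrt (u \<bullet> u)" by (rule norm_h1_def)
  show "u \<bullet> v = v \<bullet> u" by (simp add: inner_h1_def inner_commute mult.commute)
  have "(LINT x|lborel. rep_h1 (u + v) x * rep_h1 w x)
      = (LINT x|lborel. rep_h1 u x * rep_h1 w x + rep_h1 v x * rep_h1 w x)"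
    by (rule integral_cong_AE) (use rep_add[of u v] in \<open>auto simp: distrib_right\<close>)
  moreover have "(LINT x|lborel. grad (u + v) x \<bullet> grad w x)
      = (LINT x|lborel. grad u x \<bullet> grad w x + grad v x \<bullet> grad w x)"
    by (rule integral_cong_AE) (use grad_add[of u v] in \<open>auto simp: inner_add_left\<close>)
  ultimately show "(u + v) \<bullet> w = u \<bullet> w + v \<bullet> w"
    by (simp add: inner_h1_def integrable_rep_mult integrable_grad_inner)
  have "(LINT x|lborel. rep_h1 (c *\<^sub>R u) x * rep_h1 v x) = (LINT x|lborel. c * (rep_h1 u x * rep_h1 v x))"
    by (rule integral_cong_AE) (use rep_scaleR[of c u] in auto)
  moreover have "(LINT x|lborel. grad (c *\<^sub>R u) x \<bullet> grad v x) = (LINT x|lborel. c * (grad u x \<bullet> grad v x))"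
    by (rule integral_cong_AE) (use grad_scaleR[of c u] in auto)
  ultimately show "(c *\<^sub>R u) \<bullet> v = c * (u \<bullet> v)"
    by (simp add: inner_h1_def distrib_left)
  have nn: "0 \<le> (LINT x|lborel. rep_h1 u x * rep_h1 u x)" "0 \<le> (LINT x|lborel. grad u x \<bullet> grad u x)"
    by auto
  then show "0 \<le> u \<bullet> u" by (simp add: inner_h1_def)
  show "u \<bullet> u = 0 \<longleftrightarrow> u = 0"
  proof
    assume "u \<bullet> u = 0"
    then have "(LINT x|lborel. rep_h1 u x * rep_h1 u x) = 0"
      using nn unfolding inner_h1_def by linarith
    then have "AE x in lborel. rep_h1 u x * rep_h1 u x = 0"
      by (subst (asm) integral_nonneg_eq_0_iff_AE) (auto simp: integrable_rep_mult)
    then show "u = 0" using rep_0 by (auto simp: h1_eq_iff elim: AE_mp)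
  next
    assume u: "u = 0"
    have "(LINT x|lborel. rep_h1 0 x * rep_h1 0 x) = (LINT x|(lborel::(real^3) measure). 0)"
      by (rule integral_cong_AE) (use rep_0 in auto)
    moreover have "(LINT x|lborel. grad 0 x \<bullet> grad 0 x) = (LINT x|(lborel::(real^3) measure). 0)"
      by (rule integral_cong_AE) (use grad_0 in auto)
    ultimately show "u \<bullet> u = 0" using u by (simp add: inner_h1_def)
  qed
qed

end

type_synonym h1_dual = "h1 \<Rightarrow>\<^sub>L real"

text \<open>The norm of \<open>H\<^sup>1(S)\<close> applied to the restriction of \<open>w\<close> to \<open>S\<close>.\<close>

definition h1_norm_on :: "(real^3) set \<Rightarrow> h1 \<Rightarrow> real" where
  "h1_norm_on S w = sqrt ((LINT x:S|lborel. (rep_h1 w x)\<^sup>2) + (LINT x:S|lborel. (norm (grad w x))\<^sup>2))"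

section \<open>The screened Dirichlet problem and the Method of Reflections\<close>

definition eq_on :: "(real^3) set \<Rightarrow> h1 \<Rightarrow> h1 \<Rightarrow> bool" where
  "eq_on A u v \<longleftrightarrow> (AE x in lborel. x \<in> A \<longrightarrow> rep_h1 u x = rep_h1 v x)"

text \<open>Weak form of \<open>-\<Delta>w + \<xi>\<^sup>-\<^sup>2 w = f\<close> in \<open>\<real>\<^sup>3 - A\<close>, tested with all \<open>v \<in> H\<^sup>1(\<real>\<^sup>3)\<close> vanishing in \<open>A\<close>.\<close>

definition solves_outside :: "real \<Rightarrow> (real^3) set \<Rightarrow> h1_dual \<Rightarrow> h1 \<Rightarrow> bool" where
  "solves_outside \<xi> A f w \<longleftrightarrow> (\<forall>v. eq_on A v 0 \<longrightarrow>
     (LINT x|lborel. grad w x \<bullet> grad v x) + (LINT x|lborel. rep_h1 w x * rep_h1 v x) / \<xi>\<^sup>2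
       = blinfun_apply f v)"

definition dirichlet_solution :: "real \<Rightarrow> (real^3) set \<Rightarrow> h1_dual \<Rightarrow> h1 \<Rightarrow> bool" where
  "dirichlet_solution \<xi> K f u \<longleftrightarrow> eq_on K u 0 \<and> solves_outside \<xi> K f u"

definition particles :: "'i set \<Rightarrow> ('i \<Rightarrow> real^3) \<Rightarrow> ('i \<Rightarrow> real) \<Rightarrow> (real^3) set" where
  "particles I x r = (\<Union>i\<in>I. cball (x i) (r i))"

text \<open>Extended reals, so that \<open>d\<^sub>i = \<infinity>\<close> and \<open>r\<^sub>i d\<^sub>i\<^sup>-\<^sup>3 = 0\<close> when \<open>i\<close> is the only particle.\<close>

definition nearest_dist :: "'i set \<Rightarrow> ('i \<Rightarrow> real^3) \<Rightarrow> 'i \<Rightarrow> ereal" where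
  "nearest_dist I x i = (INF j\<in>I - {i}. ereal (dist (x i) (x j)))"

definition max_capacity :: "'i set \<Rightarrow> ('i \<Rightarrow> real^3) \<Rightarrow> ('i \<Rightarrow> real) \<Rightarrow> ereal" where
  "max_capacity I x r = (SUP i\<in>I. ereal (r i) / nearest_dist I x i ^ 3)"

definition Q_proj :: "real \<Rightarrow> real^3 \<Rightarrow> real \<Rightarrow> h1 \<Rightarrow> h1" where
  "Q_proj \<xi> y s w = (THE z. eq_on (cball y s) z w \<and> solves_outside \<xi> (cball y s) 0 z)"

definition Phi0 :: "real \<Rightarrow> h1_dual \<Rightarrow> h1" where
  "Phi0 \<xi> f = (THE w. solves_outside \<xi> {} f w)"

text \<open>Index shift: \<open>reflection \<dots> k i\<close> is \<open>\<Phi>\<^bsub>k+1,i\<^esub>\<close>.\<close>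

primrec reflection ::
  "real \<Rightarrow> 'i set \<Rightarrow> ('i \<Rightarrow> real^3) \<Rightarrow> ('i \<Rightarrow> real) \<Rightarrow> h1_dual \<Rightarrow> nat \<Rightarrow> 'i \<Rightarrow> h1" where
  "reflection \<xi> I x r f 0 = (\<lambda>i. - Q_proj \<xi> (x i) (r i) (Phi0 \<xi> f))"
| "reflection \<xi> I x r f (Suc k) =
     (\<lambda>i. - Q_proj \<xi> (x i) (r i) (\<Sum>\<^sub>\<infinity>j\<in>I - {i}. reflection \<xi> I x r f k j))"

primrec Phi ::
  "real \<Rightarrow> 'i set \<Rightarrow> ('i \<Rightarrow> real^3) \<Rightarrow> ('i \<Rightarrow> real) \<Rightarrow> h1_dual \<Rightarrow> nat \<Rightarrow> h1" where
  "Phi \<xi> I x r f 0 = Phi0 \<xi> f"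
| "Phi \<xi> I x r f (Suc k) = (\<Sum>\<^sub>\<infinity>i\<in>I. reflection \<xi> I x r f k i)"

end

theory Submission
  imports Defs
begin

text \<open>
  Let \<open>a(u,v) = \<integral>\<nabla>u\<cdot>\<nabla>v + \<xi>\<^sup>-\<^sup>2 \<integral>uv\<close> and let \<open>W\<^sub>i\<close> be the functions vanishing in the
  \<open>i\<close>-th ball, so that \<open>Q\<^sub>i\<close> is the \<open>a\<close>-orthogonal projection onto the complement of \<open>W\<^sub>i\<close>. With
  \<open>L = \<Sum>\<^sub>i Q\<^sub>i\<close>, the partial sums of the Method of Reflections are \<open>(1 - L)\<^sup>k \<Phi>\<^sub>0\<close>, and a suitable
  averaging turns them into the relaxed iteration \<open>(1 - \<gamma>L)\<^sup>N \<Phi>\<^sub>0\<close>. The solution is the projection of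
  \<open>\<Phi>\<^sub>0\<close> onto \<open>\<Inter>\<^sub>i W\<^sub>i\<close>, so geometric convergence follows once \<open>L\<close> is bounded, and coercive on the
  complement of this intersection. Both facts use the cutoff \<open>\<eta>\<^sub>i u\<close> to a neighbourhood of the \<open>i\<close>-th
  ball as a competitor for the minimal extension \<open>Q\<^sub>i u\<close>: its energy is controlled by that of \<open>u\<close> in the
  ball of radius \<open>d\<^sub>i/2\<close>, and these balls are disjoint. The control rests on a Hardy inequality with a
  remainder proportional to \<open>r\<^sub>i d\<^sub>i\<^sup>-\<^sup>3\<close>, which is where the bound on \<open>\<mu>\<^sub>0\<close> enters.
\<close>

section \<open>Smooth functions and weak gradients\<close>

text \<open>Relaxation is needed because \<open>L\<close> is bounded only by a constant that may be
  large: \<open>1 - L\<close> need not be a contraction. With \<open>g = 1 / (2 * M)\<close> the map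
  \<open>1 - g L\<close> shrinks the energy by the factor \<open>1 - 1 / (2 * M^2)\<close> on the
  complement of the intersection. The single number \<open>M\<close> comes from one cutoff profile
  for \<kappa> and from the capacity bound, so weights and rate are fixed before \<xi>, the
  particles and f. The obstacle is the cost of a cutoff at scale r, namely r^(-2) times the integral
  of u^2 near the particle. It can be absorbed only if the gradient constant of the Hardy inequality
  is of order r^2 uniformly in R/r. Dilating a test function from radius r to radius R achieves
  this: the derivative in the dilation parameter s costs s^(-1/2), which is integrable at 0 in
  dimension three. Dilated test functions combined with L2 duality touch u only through the defining
  identity of its weak gradient. For infinitely many particles, all series are controlled through
  their finite partial sums, where coercivity turns small energy into small norm.\<close>

lemma frechet_derivative_eq_sum_partial:
  assumes "\<phi> differentiable (at x)"
  shows "frechet_derivative \<phi> (at x) h = (\<Sum>i\<in>UNIV. h $ i * partial_deriv i \<phi> x)"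
proof -
  interpret linear "frechet_derivative \<phi> (at x)"
    using linear_frechet_derivative[OF assms] .
  have "frechet_derivative \<phi> (at x) h = frechet_derivative \<phi> (at x) (\<Sum>i\<in>UNIV. h $ i *\<^sub>R axis i 1)"
    by (metis basis_expansion scalar_mult_eq_scaleR)
  then show ?thesis by (simp add: sum scale partial_deriv_def)
qed

text \<open>The induction ranges over all \<open>m\<close> because differentiating
  \<open>flat m\<close> produces \<open>flat (m + 1)\<close> and \<open>flat (m + 2)\<close>.
  Composition with a general smooth function is wanted for radial bumps, whose argument is a squared
  norm.\<close>

lemma Ck_flat_comp: "Ck k p \<Longrightarrow> Ck k (\<lambda>x. flat m (p x))"
proof (induction k arbitrary: m)
  case 0
  have "isCont (flat m) t" for t using DERIV_isCont[OF flat_deriv] .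
  then have "continuous_on UNIV (flat m)"
    by (simp add: continuous_at_imp_continuous_on)
  with 0 show ?case
    using continuous_on_compose2[of UNIV "flat m" UNIV p] by simp
next
  case (Suc k)
  have d: "((\<lambda>x. flat m (p x)) has_derivative
      (\<lambda>h. (- real m * flat (m + 1) (p x) + flat (m + 2) (p x)) * frechet_derivative p (at x) h)) (at x)" for x
  proof -
    have "(p has_derivative frechet_derivative p (at x)) (at x)"
      using Suc.prems by (simp add: differentiable_has_derivative)
    from has_derivative_compose[OF this flat_deriv[unfolded has_field_derivative_def]]
    show ?thesis by (simp add: mult.commute)
  qed
  have "partial_deriv i (\<lambda>x. flat m (p x)) =
      (\<lambda>x. ((- real m) * flat (m + 1) (p x) + flat (m + 2) (p x)) * partial_deriv i p x)" for i
    by (rule ext) (subst partialI[OF d], simp add: partial_deriv_def)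
  moreover have "Ck k (\<lambda>x. ((- real m) * flat (m + 1) (p x) + flat (m + 2) (p x)) * partial_deriv i p x)" for i
    using Suc.prems Ck_SucD[OF Suc.prems]
    by (intro Ck_mult[OF Ck_add[OF Ck_mult[OF Ck_const Suc.IH] Suc.IH]]) auto
  moreover have "(\<lambda>x. flat m (p x)) differentiable (at x)" for x
    using d differentiable_def by blast
  ultimately show ?case unfolding Ck.simps by presburger
qed

lemma Ck_inverse: "Ck k p \<Longrightarrow> (\<And>x. p x \<noteq> 0) \<Longrightarrow> Ck k (\<lambda>x. inverse (p x))"
proof (induction k)
  case 0
  then show ?case by (auto intro!: continuous_intros)
next
  case (Suc k)
  have d: "((\<lambda>x. inverse (p x)) has_derivative
      (\<lambda>h. - (inverse (p x) * frechet_derivative p (at x) h * inverse (p x)))) (at x)" for x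
    by (rule Deriv.has_derivative_inverse) (use Suc.prems differentiable_has_derivative in auto)
  have "partial_deriv i (\<lambda>x. inverse (p x)) =
      (\<lambda>x. (-1) * (inverse (p x) * partial_deriv i p x * inverse (p x)))" for i
    by (rule ext) (subst partialI[OF d], simp add: partial_deriv_def)
  moreover have "Ck k (\<lambda>x. (-1) * (inverse (p x) * partial_deriv i p x * inverse (p x)))" for i
    using Suc Ck_SucD[OF Suc.prems(1)] by (intro Ck_mult Ck_const) auto
  moreover have "(\<lambda>x. inverse (p x)) differentiable (at x)" for x
    using d differentiable_def by blast
  ultimately show ?case unfolding Ck.simps by presburger
qed

lemma Ck_bounded_linear:
  assumes "bounded_linear p"
  shows "Ck k p"
proof (cases k)
  case 0
  then show ?thesis using assms by (simp add: linear_continuous_on)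
next
  case (Suc l)
  have d: "(p has_derivative p) (at x)" for x
    by (rule bounded_linear_imp_has_derivative[OF assms])
  then have "partial_deriv i p = (\<lambda>x. p (axis i 1))" for i
    by (auto simp: partialI[OF d])
  then show ?thesis using d Suc by (auto simp: Ck_const differentiable_def)
qed

text \<open>Lets Weierstrass polynomials become test functions after multiplication by a smooth
  bump.\<close>

lemma Ck_polynomial: "real_polynomial_function p \<Longrightarrow> Ck k p"
  by (induction rule: real_polynomial_function.induct)
     (auto intro: Ck_bounded_linear Ck_const Ck_add Ck_mult)

lemma Ck_nth: "Ck k (\<lambda>x. x $ i)"
  by (rule Ck_bounded_linear[OF bounded_linear_vec_nth])

lemma Ck_sum: "finite S \<Longrightarrow> (\<And>i. i \<in> S \<Longrightarrow> Ck k (f i)) \<Longrightarrow> Ck k (\<lambda>x. \<Sum>i\<in>S. f i x)"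
  by (induction S rule: finite_induct) (auto intro: Ck_const Ck_add)

lemma power2_norm_vec: "(norm x)\<^sup>2 = (\<Sum>i\<in>UNIV. x $ i * x $ i)" for x :: "real^3"
  by (simp add: power2_norm_eq_inner inner_vec_def)

lemma Ck_power2_norm: "Ck k (\<lambda>x. (norm x)\<^sup>2)"
  unfolding power2_norm_vec by (intro Ck_sum Ck_mult Ck_nth) auto

lemma
  assumes "\<And>x. \<phi> differentiable (at x)"
  shows differentiable_rescale: "(\<lambda>z. \<phi> (c *\<^sub>R (z - y))) differentiable (at z)"
    and partial_rescale: "partial_deriv i (\<lambda>z. \<phi> (c *\<^sub>R (z - y))) = (\<lambda>z. c * partial_deriv i \<phi> (c *\<^sub>R (z - y)))"
proof -
  have d: "((\<lambda>z. \<phi> (c *\<^sub>R (z - y))) has_derivative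
      (\<lambda>h. frechet_derivative \<phi> (at (c *\<^sub>R (z - y))) (c *\<^sub>R h))) (at z)" for z
    by (rule has_derivative_compose[OF _ differentiable_has_derivative[OF assms]])
       (auto intro!: derivative_eq_intros)
  show "(\<lambda>z. \<phi> (c *\<^sub>R (z - y))) differentiable (at z)"
    using d differentiable_def by blast
  show "partial_deriv i (\<lambda>z. \<phi> (c *\<^sub>R (z - y))) = (\<lambda>z. c * partial_deriv i \<phi> (c *\<^sub>R (z - y)))"
    by (rule ext) (subst partialI[OF d],
      simp add: partial_deriv_def linear_scale[OF linear_frechet_derivative[OF assms]])
qed

lemma Ck_rescale: "Ck k \<phi> \<Longrightarrow> Ck k (\<lambda>z. \<phi> (c *\<^sub>R (z - y)))"
proof (induction k arbitrary: \<phi>)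
  case 0
  then have "continuous_on UNIV \<phi>" by simp
  then show ?case
    using continuous_on_compose2[of UNIV \<phi> UNIV "\<lambda>z. c *\<^sub>R (z - y)"]
    by (simp add: continuous_on_scaleR continuous_on_diff)
next
  case (Suc k)
  then show ?case
    by (auto simp: partial_rescale intro!: differentiable_rescale Ck_mult[OF Ck_const])
qed

section \<open>Test functions as multipliers, and the product rule for weak gradients\<close>

lemma test_functionI:
  assumes "\<And>k. Ck k \<phi>" "bounded S" "\<And>x. x \<notin> S \<Longrightarrow> \<phi> x = 0"
  shows "test_function \<phi>"
proof -
  have "bounded {x. \<phi> x \<noteq> 0}"
    by (rule bounded_subset[OF assms(2)]) (use assms(3) in auto)
  then show ?thesis
    unfolding test_function_def using assms(1) compact_closure by blast
qed

lemma test_function_Ck: "test_function \<phi> \<Longrightarrow> Ck k \<phi>"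
  by (simp add: test_function_def)

lemma test_function_differentiable: "test_function \<phi> \<Longrightarrow> \<phi> differentiable (at x)"
  using test_function_Ck[of \<phi> "Suc 0"] by simp

lemma test_function_continuous: "test_function \<phi> \<Longrightarrow> continuous_on UNIV \<phi>"
  using test_function_Ck[of \<phi> 0] by simp

lemma test_function_bounded_support: "test_function \<phi> \<Longrightarrow> bounded {x. \<phi> x \<noteq> 0}"
  by (simp add: test_function_def)

lemma partial_zero_outside:
  assumes "x \<notin> closure {x. \<phi> x \<noteq> 0}"
  shows "partial_deriv i \<phi> x = 0"
proof -
  have "((\<lambda>x. 0::real) has_derivative (\<lambda>h. 0)) (at x)" by simp
  then have "(\<phi> has_derivative (\<lambda>h. 0)) (at x)"
    by (rule has_derivative_transform_within_open[of _ _ x UNIV "- closure {x. \<phi> x \<noteq> 0}"])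
       (use assms closure_subset[of "{x. \<phi> x \<noteq> 0}"] in auto)
  then show ?thesis using partialI by fastforce
qed

lemma test_function_partial:
  assumes "test_function \<phi>"
  shows "test_function (partial_deriv i \<phi>)"
proof (rule test_functionI)
  show "Ck k (partial_deriv i \<phi>)" for k
    using test_function_Ck[OF assms, of "Suc k"] by simp
  show "bounded (closure {x. \<phi> x \<noteq> 0})"
    using assms by (simp add: test_function_def compact_imp_bounded)
qed (rule partial_zero_outside)

lemma test_function_mult:
  assumes "\<And>k. Ck k \<eta>" "test_function \<phi>"
  shows "test_function (\<lambda>x. \<eta> x * \<phi> x)"
  by (rule test_functionI[OF _ test_function_bounded_support[OF assms(2)]])
     (auto intro: Ck_mult assms test_function_Ck)

lemma test_function_bounded:
  assumes "test_function \<phi>"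
  obtains M where "0 \<le> M" "\<And>x. \<bar>\<phi> x\<bar> \<le> M"
proof -
  have "compact (\<phi> ` closure {x. \<phi> x \<noteq> 0})"
    using assms test_function_continuous[OF assms]
    by (intro compact_continuous_image) (auto simp: test_function_def intro: continuous_on_subset)
  then have "bounded (\<phi> ` closure {x. \<phi> x \<noteq> 0})" by (rule compact_imp_bounded)
  then obtain M where M: "\<And>x. x \<in> closure {x. \<phi> x \<noteq> 0} \<Longrightarrow> \<bar>\<phi> x\<bar> \<le> M"
    unfolding bounded_iff by auto
  show ?thesis
  proof (rule that[of "max M 0"])
    show "\<bar>\<phi> x\<bar> \<le> max M 0" for x
      using M[of x] closure_subset[of "{x. \<phi> x \<noteq> 0}"] by (cases "\<phi> x = 0") auto
  qed simp
qed

lemma square_integrable_mult_bounded: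
  fixes f :: "real^3 \<Rightarrow> real" and g :: "real^3 \<Rightarrow> 'b::euclidean_space"
  assumes [measurable]: "f \<in> borel_measurable borel" and "\<And>x. \<bar>f x\<bar> \<le> M" and g: "square_integrable g"
  shows "square_integrable (\<lambda>x. f x *\<^sub>R g x)"
  unfolding square_integrable_def
proof
  note [measurable] = square_integrable_measurable[OF g]
  show "(\<lambda>x. f x *\<^sub>R g x) \<in> borel_measurable lborel" by measurable
  show "integrable lborel (\<lambda>x. (norm (f x *\<^sub>R g x))\<^sup>2)"
  proof (rule Bochner_Integration.integrable_bound)
    show "integrable lborel (\<lambda>x. M\<^sup>2 * (norm (g x))\<^sup>2)"
      using g by (simp add: square_integrable_def)
    have "(f x)\<^sup>2 \<le> M\<^sup>2" for x using assms(2)[of x] by (rule power2_le_iff_abs_le[THEN iffD2, rotated]) (use assms(2)[of x] in linarith)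
    then show "AE x in lborel. norm ((norm (f x *\<^sub>R g x))\<^sup>2) \<le> norm (M\<^sup>2 * (norm (g x))\<^sup>2)"
      by (auto simp: power_mult_distrib intro!: mult_right_mono)
  qed measurable
qed

definition gradient :: "(real^3 \<Rightarrow> real) \<Rightarrow> real^3 \<Rightarrow> real^3" where
  "gradient \<phi> x = (\<chi> i. partial_deriv i \<phi> x)"

lemma gradient_bounded:
  assumes "test_function \<phi>"
  obtains M where "0 \<le> M" "\<And>x. norm (gradient \<phi> x) \<le> M"
proof -
  have "\<exists>M. 0 \<le> M \<and> (\<forall>x. \<bar>partial_deriv i \<phi> x\<bar> \<le> M)" for i
    using test_function_bounded[OF test_function_partial[OF assms]] by blast
  then obtain M where M: "\<And>i. 0 \<le> M i" "\<And>i x. \<bar>partial_deriv i \<phi> x\<bar> \<le> M i" by metis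
  show ?thesis
  proof (rule that[of "\<Sum>i\<in>UNIV. M i"])
    show "norm (gradient \<phi> x) \<le> (\<Sum>i\<in>UNIV. M i)" for x
      by (rule order_trans[OF norm_le_l1_cart]) (auto simp: gradient_def intro!: sum_mono M)
  qed (simp add: sum_nonneg M)
qed

lemma gradient_measurable [measurable]:
  assumes "test_function \<phi>"
  shows "gradient \<phi> \<in> borel_measurable borel"
  unfolding gradient_def
  by (intro borel_measurable_continuous_onI continuous_intros test_function_partial_continuous assms)

text \<open>The weak gradient of \<open>u\<close> is tested with the product of \<eta> and \<phi>,
  which is again a test function; the classical product rule then moves \<eta> to the other factor.
  Boundedness of \<eta> and of its gradient keeps both summands square integrable.\<close>

lemma is_weak_gradient_mult:
  assumes \<eta>: "test_function \<eta>" and u: "square_integrable u" and g: "is_weak_gradient u g"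
  shows "square_integrable (\<lambda>x. \<eta> x * u x)"
    and "is_weak_gradient (\<lambda>x. \<eta> x * u x) (\<lambda>x. \<eta> x *\<^sub>R g x + u x *\<^sub>R gradient \<eta> x)"
proof -
  note [measurable] = square_integrable_measurable[OF u] test_function_measurable[OF \<eta>] gradient_measurable[OF \<eta>]
  have sg: "square_integrable g" using g by (simp add: is_weak_gradient_def)
  obtain M where M: "\<And>x. \<bar>\<eta> x\<bar> \<le> M" using test_function_bounded[OF \<eta>] by blast
  obtain M' where M': "\<And>x. norm (gradient \<eta> x) \<le> M'" using gradient_bounded[OF \<eta>] by blast
  show sq: "square_integrable (\<lambda>x. \<eta> x * u x)"
    using square_integrable_mult_bounded[OF _ M u] by simp
  have s1: "square_integrable (\<lambda>x. \<eta> x *\<^sub>R g x)"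
    using square_integrable_mult_bounded[OF _ M sg] by simp
  have s2: "square_integrable (\<lambda>x. u x *\<^sub>R gradient \<eta> x)"
    unfolding square_integrable_def
  proof
    show "integrable lborel (\<lambda>x. (norm (u x *\<^sub>R gradient \<eta> x))\<^sup>2)"
    proof (rule Bochner_Integration.integrable_bound)
      show "integrable lborel (\<lambda>x. M'\<^sup>2 * (norm (u x))\<^sup>2)"
        using u unfolding square_integrable_def by auto
      have "(norm (gradient \<eta> x))\<^sup>2 \<le> M'\<^sup>2" for x by (rule power_mono[OF M']) simp
      then show "AE x in lborel. norm ((norm (u x *\<^sub>R gradient \<eta> x))\<^sup>2) \<le> norm (M'\<^sup>2 * (norm (u x))\<^sup>2)"
        by (auto simp: power_mult_distrib mult.commute[of "M'\<^sup>2"] intro!: mult_left_mono)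
    qed measurable
  qed measurable
  show "is_weak_gradient (\<lambda>x. \<eta> x * u x) (\<lambda>x. \<eta> x *\<^sub>R g x + u x *\<^sub>R gradient \<eta> x)"
    unfolding is_weak_gradient_def
  proof (intro conjI allI impI)
    show "square_integrable (\<lambda>x. \<eta> x *\<^sub>R g x + u x *\<^sub>R gradient \<eta> x)"
      using square_integrable_add[OF s1 s2] .
    fix \<phi> i assume \<phi>: "test_function \<phi>"
    have t: "test_function (\<lambda>x. \<eta> x * \<phi> x)"
      by (rule test_function_mult[OF test_function_Ck[OF \<eta>] \<phi>])
    have p: "partial_deriv i (\<lambda>x. \<eta> x * \<phi> x) = (\<lambda>x. \<eta> x * partial_deriv i \<phi> x + partial_deriv i \<eta> x * \<phi> x)"
      by (rule partial_mult) (auto simp: test_function_differentiable \<eta> \<phi>)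
    have i1: "integrable lborel (\<lambda>x. u x * partial_deriv i (\<lambda>x. \<eta> x * \<phi> x) x)"
      by (rule square_integrable_mult[OF u test_function_partial_square_integrable[OF t]])
    have i2: "integrable lborel (\<lambda>x. (u x *\<^sub>R gradient \<eta> x) $ i * \<phi> x)"
      by (rule square_integrable_mult[OF square_integrable_nth[OF s2] test_function_square_integrable[OF \<phi>]])
    have i3: "integrable lborel (\<lambda>x. (\<eta> x *\<^sub>R g x) $ i * \<phi> x)"
      by (rule square_integrable_mult[OF square_integrable_nth[OF s1] test_function_square_integrable[OF \<phi>]])
    have "(LINT x|lborel. \<eta> x * u x * partial_deriv i \<phi> x)
        = (LINT x|lborel. u x * partial_deriv i (\<lambda>x. \<eta> x * \<phi> x) x - (u x *\<^sub>R gradient \<eta> x) $ i * \<phi> x)"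
      by (rule Bochner_Integration.integral_cong) (auto simp: p gradient_def algebra_simps)
    also have "\<dots> = - (LINT x|lborel. g x $ i * (\<eta> x * \<phi> x)) - (LINT x|lborel. (u x *\<^sub>R gradient \<eta> x) $ i * \<phi> x)"
      using g t i1 i2 by (simp add: is_weak_gradient_def)
    also have "\<dots> = - (LINT x|lborel. (\<eta> x *\<^sub>R g x) $ i * \<phi> x + (u x *\<^sub>R gradient \<eta> x) $ i * \<phi> x)"
      using i2 i3 by (simp add: algebra_simps)
    finally show "(LINT x|lborel. \<eta> x * u x * partial_deriv i \<phi> x)
      = - (LINT x|lborel. (\<eta> x *\<^sub>R g x + u x *\<^sub>R gradient \<eta> x) $ i * \<phi> x)"
      by (simp add: algebra_simps)
  qed
qed

section \<open>Completeness of the Sobolev space\<close>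

text \<open>Either \<open>t\<close> is below the threshold \<open>(1/2) ^ k\<close> or
  \<open>1 \<le> 2 ^ k * t\<close>. It bounds unsquared increments by weighted squares up to a
  summable error, as needed for almost everywhere convergence.\<close>

lemma le_pow2_square:
  fixes t :: real
  assumes "0 \<le> t"
  shows "t \<le> (1/2) ^ k + 2 ^ k * t\<^sup>2"
proof (cases "t \<le> (1/2) ^ k")
  case True
  then show ?thesis by (simp add: add_increasing2)
next
  case False
  then have "1 \<le> 2 ^ k * t" by (simp add: power_divide field_simps)
  from mult_right_mono[OF this assms] have "t \<le> 2 ^ k * t\<^sup>2" by (simp add: power2_eq_square)
  then show ?thesis by (simp add: add_increasing)
qed

lemma square_integrable_diff:
  assumes "square_integrable f" "square_integrable g"
  shows "square_integrable (\<lambda>x. f x - g x)"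
  using square_integrable_add[OF assms(1) square_integrable_scaleR[OF assms(2), of "-1"]] by simp

text \<open>Riesz-Fischer for vector-valued functions: a rapidly Cauchy subsequence converges almost
  everywhere, and Fatou's lemma upgrades this to convergence of the full sequence in L2.\<close>

proposition square_integrable_complete:
  fixes f :: "nat \<Rightarrow> real^3 \<Rightarrow> 'b::euclidean_space"
  assumes sq: "\<And>n. square_integrable (f n)"
    and Cauchy: "\<And>e. 0 < e \<Longrightarrow> \<exists>N. \<forall>m\<ge>N. \<forall>n\<ge>N. (LINT x|lborel. (norm (f m x - f n x))\<^sup>2) < e"
  obtains g where "square_integrable g" "(\<lambda>n. LINT x|lborel. (norm (f n x - g x))\<^sup>2) \<longlonglongrightarrow> 0"
proof -
  note [measurable] = square_integrable_measurable[OF sq]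
  have int: "integrable lborel (\<lambda>x. (norm (f m x - f n x))\<^sup>2)" for m n
    using square_integrable_diff[OF sq sq] by (simp add: square_integrable_def)
  define D where "D m n x = (norm (f m x - f n x))\<^sup>2" for m n x
  have [measurable]: "D m n \<in> borel_measurable borel" for m n unfolding D_def by measurable
  have D_int: "(\<integral>\<^sup>+x. ennreal (D m n x) \<partial>lborel) = ennreal (LINT x|lborel. D m n x)" for m n
    unfolding D_def by (rule nn_integral_eq_integral[OF int]) simp
  \<comment> \<open>The level \<open>(1/4) ^ k\<close> leaves room for a weight
    \<open>2 ^ k\<close>: the weighted squared increments then have integrals bounded by a geometric
    series of ratio 1/2.\<close>
  have "\<forall>k. \<exists>N. \<forall>m\<ge>N. \<forall>n\<ge>N. (LINT x|lborel. D m n x) < (1/4) ^ k"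
    unfolding D_def using Cauchy by simp
  then obtain N where N: "\<And>k m n. N k \<le> m \<Longrightarrow> N k \<le> n \<Longrightarrow> (LINT x|lborel. D m n x) < (1/4) ^ k"
    by metis
  \<comment> \<open>Both \<open>r k\<close> and \<open>r (Suc k)\<close> dominate
    \<open>N k\<close>, so consecutive members of the subsequence are compared at level
    \<open>k\<close>; the summand \<open>k\<close> forces \<open>r k\<close> to infinity.\<close>
  define r where "r k = k + (\<Sum>j\<le>k. N j)" for k
  have r1: "N k \<le> r k" for k
    using member_le_sum[of k "{..k}" N] by (auto simp: r_def intro: trans_le_add2)
  have r2: "N k \<le> r (Suc k)" for k
    using r1[of k] by (simp add: r_def)
  have r_ge: "k \<le> r k" for k by (simp add: r_def)
  have "(\<integral>\<^sup>+x. (\<Sum>k. ennreal (2 ^ k * D (r (Suc k)) (r k) x)) \<partial>lborel)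
      = (\<Sum>k. \<integral>\<^sup>+x. ennreal (2 ^ k * D (r (Suc k)) (r k) x) \<partial>lborel)"
    by (rule nn_integral_suminf) measurable
  also have "\<dots> \<le> (\<Sum>k. ennreal ((1/2) ^ k))"
  proof (rule suminf_le)
    fix k
    have "(\<integral>\<^sup>+x. ennreal (2 ^ k * D (r (Suc k)) (r k) x) \<partial>lborel)
        = ennreal (2 ^ k) * ennreal (LINT x|lborel. D (r (Suc k)) (r k) x)"
      unfolding D_int[symmetric] by (simp add: ennreal_mult' nn_integral_cmult)
    also have "\<dots> \<le> ennreal (2 ^ k) * ennreal ((1/4) ^ k)"
      using N[OF r2 r1, of k] by (intro mult_left_mono ennreal_leI) auto
    also have "\<dots> = ennreal ((1/2) ^ k)"
      by (simp add: ennreal_mult'[symmetric] power_mult_distrib[symmetric])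
    finally show "(\<integral>\<^sup>+x. ennreal (2 ^ k * D (r (Suc k)) (r k) x) \<partial>lborel) \<le> ennreal ((1/2) ^ k)" .
  qed auto
  also have "\<dots> < \<infinity>"
    by (simp add: suminf_ennreal2 summable_geometric)
  finally have "AE x in lborel. (\<Sum>k. ennreal (2 ^ k * D (r (Suc k)) (r k) x)) \<noteq> \<infinity>"
    by (intro nn_integral_noteq_infinite) auto
  then have "AE x in lborel. convergent (\<lambda>k. f (r k) x)"
  proof (rule AE_mp[OF _ AE_I2], intro impI)
    fix x assume "(\<Sum>k. ennreal (2 ^ k * D (r (Suc k)) (r k) x)) \<noteq> \<infinity>"
    then have s: "summable (\<lambda>k. 2 ^ k * D (r (Suc k)) (r k) x)"
      by (intro summable_suminf_not_top) (auto simp: D_def)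
    have "summable (\<lambda>k. norm (f (r (Suc k)) x - f (r k) x))"
    proof (rule summable_comparison_test')
      show "summable (\<lambda>k. (1/2) ^ k + 2 ^ k * D (r (Suc k)) (r k) x)"
        by (intro summable_add s summable_geometric) auto
      show "norm (norm (f (r (Suc k)) x - f (r k) x)) \<le> (1/2) ^ k + 2 ^ k * D (r (Suc k)) (r k) x" for k
        unfolding D_def using le_pow2_square[of "norm (f (r (Suc k)) x - f (r k) x)" k] by simp
    qed
    then have "summable (\<lambda>k. f (r (Suc k)) x - f (r k) x)" by (rule summable_norm_cancel)
    then have "convergent (\<lambda>n. f (r 0) x + (\<Sum>k<n. f (r (Suc k)) x - f (r k) x))"
      by (intro convergent_add convergent_const) (simp add: summable_iff_convergent)
    moreover have "(\<lambda>n. f (r 0) x + (\<Sum>k<n. f (r (Suc k)) x - f (r k) x)) = (\<lambda>n. f (r n) x)"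
      by (rule ext) (subst sum_lessThan_telescope, simp)
    ultimately show "convergent (\<lambda>k. f (r k) x)" by simp
  qed
  define g where "g x = lim (\<lambda>k. f (r k) x)" for x
  have [measurable]: "g \<in> borel_measurable borel" unfolding g_def by measurable
  from \<open>AE x in lborel. convergent (\<lambda>k. f (r k) x)\<close>
  have lim: "AE x in lborel. (\<lambda>k. f (r k) x) \<longlonglongrightarrow> g x"
    unfolding g_def by (simp add: convergent_LIMSEQ_iff)
  \<comment> \<open>Fatou along the subsequence: the distance of \<open>f n\<close> to the limit is
    at most the lower limit of its distances to \<open>f (r k)\<close>.\<close>
  have bound: "(\<integral>\<^sup>+x. ennreal ((norm (f n x - g x))\<^sup>2) \<partial>lborel) \<le> ennreal e"
    if n: "\<forall>m\<ge>n0. (LINT x|lborel. D n m x) < e" for n n0 e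
  proof -
    have "(\<integral>\<^sup>+x. ennreal ((norm (f n x - g x))\<^sup>2) \<partial>lborel)
        = (\<integral>\<^sup>+x. liminf (\<lambda>k. ennreal (D n (r k) x)) \<partial>lborel)"
    proof (rule nn_integral_cong_AE, rule AE_mp[OF lim AE_I2], intro impI)
      fix x assume "(\<lambda>k. f (r k) x) \<longlonglongrightarrow> g x"
      then have "(\<lambda>k. ennreal (D n (r k) x)) \<longlonglongrightarrow> ennreal ((norm (f n x - g x))\<^sup>2)"
        unfolding D_def by (intro tendsto_intros)
      from lim_imp_Liminf[OF _ this]
      show "ennreal ((norm (f n x - g x))\<^sup>2) = liminf (\<lambda>k. ennreal (D n (r k) x))" by simp
    qed
    also have "\<dots> \<le> liminf (\<lambda>k. \<integral>\<^sup>+x. ennreal (D n (r k) x) \<partial>lborel)"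
      by (rule nn_integral_liminf) measurable
    also have "\<dots> \<le> ennreal e"
      unfolding D_int
    proof (rule order_trans[OF Liminf_mono])
      show "\<forall>\<^sub>F k in sequentially. ennreal (LINT x|lborel. D n (r k) x) \<le> ennreal e"
        using eventually_ge_at_top[of n0]
      proof eventually_elim
        case (elim k)
        then show ?case using n r_ge[of k] by (intro ennreal_leI less_imp_le) auto
      qed
    qed (simp add: Liminf_const)
    finally show ?thesis .
  qed
  have CN: "\<exists>N. \<forall>m\<ge>N. \<forall>n\<ge>N. (LINT x|lborel. D m n x) < e" if "0 < e" for e
    using Cauchy[OF that] unfolding D_def .
  have fg: "square_integrable (\<lambda>x. f n0 x - g x)" if "\<forall>m\<ge>n0. (LINT x|lborel. D n0 m x) < 1" for n0
    unfolding square_integrable_def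
  proof
    show "integrable lborel (\<lambda>x. (norm (f n0 x - g x))\<^sup>2)"
      by (rule integrableI_bounded) (use bound[OF that] in \<open>auto simp: le_less_trans\<close>)
  qed measurable
  obtain n0 where "\<forall>m\<ge>n0. \<forall>n\<ge>n0. (LINT x|lborel. D m n x) < 1" using CN[of 1] by auto
  then have "square_integrable (\<lambda>x. f n0 x - (f n0 x - g x))"
    by (intro square_integrable_diff sq fg) auto
  then have g: "square_integrable g" by simp
  have gint: "integrable lborel (\<lambda>x. (norm (f n x - g x))\<^sup>2)" for n
    using square_integrable_diff[OF sq g] by (simp add: square_integrable_def)
  have "(\<lambda>n. LINT x|lborel. (norm (f n x - g x))\<^sup>2) \<longlonglongrightarrow> 0"
  proof (rule LIMSEQ_I)
    fix e :: real assume e: "0 < e"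
    then obtain N0 where N0: "\<forall>m\<ge>N0. \<forall>n\<ge>N0. (LINT x|lborel. D m n x) < e/2" using CN[of "e/2"] by auto
    have "norm ((LINT x|lborel. (norm (f n x - g x))\<^sup>2) - 0) < e" if "N0 \<le> n" for n
    proof -
      have "ennreal (LINT x|lborel. (norm (f n x - g x))\<^sup>2) \<le> ennreal (e/2)"
        using bound[of N0 n "e/2"] N0 that by (subst nn_integral_eq_integral[OF gint, symmetric]) auto
      then have "(LINT x|lborel. (norm (f n x - g x))\<^sup>2) \<le> e/2"
        using e by (simp add: ennreal_le_iff)
      moreover have "0 \<le> (LINT x|lborel. (norm (f n x - g x))\<^sup>2)" by simp
      ultimately show ?thesis using e by simp
    qed
    then show "\<exists>no. \<forall>n\<ge>no. norm ((LINT x|lborel. (norm (f n x - g x))\<^sup>2) - 0) < e" by blast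
  qed
  with g that show ?thesis by blast
qed

text \<open>The squared norm of \<open>s f + t g\<close> is a nonnegative quadratic form in
  \<open>(s, t)\<close> with coefficients \<open>A\<close>, \<open>B\<close>, \<open>C\<close>, so
  its discriminant has a sign.\<close>

lemma square_integrable_Cauchy_Schwarz:
  fixes f g :: "real^3 \<Rightarrow> 'b::euclidean_space"
  assumes f: "square_integrable f" and g: "square_integrable g"
  shows "(LINT x|lborel. f x \<bullet> g x)\<^sup>2 \<le> (LINT x|lborel. (norm (f x))\<^sup>2) * (LINT x|lborel. (norm (g x))\<^sup>2)"
proof -
  define A B C where "A = (LINT x|lborel. (norm (f x))\<^sup>2)" and "B = (LINT x|lborel. f x \<bullet> g x)"
    and "C = (LINT x|lborel. (norm (g x))\<^sup>2)"
  have i: "integrable lborel (\<lambda>x. (norm (f x))\<^sup>2)" "integrable lborel (\<lambda>x. f x \<bullet> g x)"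
    "integrable lborel (\<lambda>x. (norm (g x))\<^sup>2)"
    using f g square_integrable_inner[OF f g] by (auto simp: square_integrable_def)
  have "0 \<le> s * s * A + 2 * s * t * B + t * t * C" for s t
  proof -
    have "0 \<le> (LINT x|lborel. (norm (s *\<^sub>R f x + t *\<^sub>R g x))\<^sup>2)" by simp
    also have "\<dots> = (LINT x|lborel. s * s * (norm (f x))\<^sup>2 + 2 * s * t * (f x \<bullet> g x) + t * t * (norm (g x))\<^sup>2)"
      by (rule Bochner_Integration.integral_cong)
         (auto simp: power2_norm_eq_inner inner_simps inner_commute algebra_simps)
    also have "\<dots> = s * s * A + 2 * s * t * B + t * t * C"
      using i by (simp add: A_def B_def C_def)
    finally show ?thesis .
  qed
  \<comment> \<open>At \<open>(C, -B)\<close> and \<open>(-B, A)\<close> the form equals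
    \<open>A * C - B * B\<close> times \<open>C\<close> and \<open>A\<close>; the values at
    \<open>(1, 1)\<close> and \<open>(1, -1)\<close> settle the degenerate case
    \<open>A = C = 0\<close>.\<close>
  from this[of C "- B"] this[of "- B" A] this[of 1 1] this[of 1 "-1"] this[of 1 0] this[of 0 1]
  have *: "0 \<le> C * (A * C - B * B)" "0 \<le> A * (A * C - B * B)" "0 \<le> A + 2 * B + C" "0 \<le> A - 2 * B + C"
    "0 \<le> A" "0 \<le> C"
    by (auto simp: algebra_simps)
  have "B * B \<le> A * C"
  proof (cases "A = 0 \<and> C = 0")
    case True
    then show ?thesis using *(3,4) by simp
  next
    case False
    then have "0 < A \<or> 0 < C" using *(5,6) by auto
    then show ?thesis using *(1,2) by (auto simp: zero_le_mult_iff)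
  qed
  then show ?thesis by (simp add: A_def B_def C_def power2_eq_square)
qed

section \<open>Closedness of the weak gradient and completeness of \<open>h1\<close>\<close>

lemma rep_diff: "AE x in lborel. rep_h1 (u - v) x = rep_h1 u x - rep_h1 v x"
  using rep_add[of u "(-1) *\<^sub>R v"] rep_scaleR[of "-1" v]
  unfolding minus_h1_def by eventually_elim linarith

lemma grad_diff: "AE x in lborel. grad (u - v) x = grad u x - grad v x"
  using grad_add[of u "(-1) *\<^sub>R v"] grad_scaleR[of "-1" v]
  unfolding minus_h1_def
proof eventually_elim
  case (elim x)
  show ?case unfolding elim by (simp only: scaleR_minus1_left diff_conv_add_uminus)
qed

lemma norm_h1_sq: "(norm u)\<^sup>2 = (LINT x|lborel. (rep_h1 u x)\<^sup>2) + (LINT x|lborel. (norm (grad u x))\<^sup>2)"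
  by (simp add: power2_norm_eq_inner inner_h1_def) (simp add: power2_eq_square)

lemma norm_h1_diff_sq: "(norm (u - v))\<^sup>2 = (LINT x|lborel. (norm (rep_h1 u x - rep_h1 v x))\<^sup>2)
    + (LINT x|lborel. (norm (grad u x - grad v x))\<^sup>2)"
proof -
  have "(LINT x|lborel. (rep_h1 (u - v) x)\<^sup>2) = (LINT x|lborel. (norm (rep_h1 u x - rep_h1 v x))\<^sup>2)"
    by (rule integral_cong_AE) (use rep_diff[of u v] in auto)
  moreover have "(LINT x|lborel. (norm (grad (u - v) x))\<^sup>2) = (LINT x|lborel. (norm (grad u x - grad v x))\<^sup>2)"
    by (rule integral_cong_AE) (use grad_diff[of u v] in auto)
  ultimately show ?thesis by (simp add: norm_h1_sq)
qed

lemma tendsto_integral_inner: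
  fixes f :: "nat \<Rightarrow> real^3 \<Rightarrow> 'b::euclidean_space"
  assumes sq: "\<And>n. square_integrable (f n)" "square_integrable g" "square_integrable h"
    and lim: "(\<lambda>n. LINT x|lborel. (norm (f n x - g x))\<^sup>2) \<longlonglongrightarrow> 0"
  shows "(\<lambda>n. LINT x|lborel. f n x \<bullet> h x) \<longlonglongrightarrow> (LINT x|lborel. g x \<bullet> h x)"
proof (rule Lim_null_comparison[THEN LIM_zero_cancel])
  have d: "(LINT x|lborel. f n x \<bullet> h x) - (LINT x|lborel. g x \<bullet> h x) = (LINT x|lborel. (f n x - g x) \<bullet> h x)" for n
    using square_integrable_inner[OF sq(1,3)] square_integrable_inner[OF sq(2,3)]
    by (simp add: inner_diff_left)
  show "\<forall>\<^sub>F n in sequentially. norm ((LINT x|lborel. f n x \<bullet> h x) - (LINT x|lborel. g x \<bullet> h x))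
      \<le> sqrt ((LINT x|lborel. (norm (f n x - g x))\<^sup>2) * (LINT x|lborel. (norm (h x))\<^sup>2))"
    using square_integrable_Cauchy_Schwarz[OF square_integrable_diff[OF sq(1,2)] sq(3)]
    by (intro always_eventually allI) (simp add: d real_le_rsqrt)
  have "(\<lambda>n. sqrt ((LINT x|lborel. (norm (f n x - g x))\<^sup>2) * (LINT x|lborel. (norm (h x))\<^sup>2)))
      \<longlonglongrightarrow> sqrt (0 * (LINT x|lborel. (norm (h x))\<^sup>2))"
    by (intro tendsto_intros lim)
  then show "(\<lambda>n. sqrt ((LINT x|lborel. (norm (f n x - g x))\<^sup>2) * (LINT x|lborel. (norm (h x))\<^sup>2))) \<longlonglongrightarrow> 0"
    by simp
qed

text \<open>The defining identity pairs \<open>u\<close> and its gradient with fixed square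
  integrable functions, so both sides pass to L2 limits.\<close>

lemma is_weak_gradient_limit:
  assumes sq: "\<And>n. square_integrable (f n)" "square_integrable u" "square_integrable g"
    and w: "\<And>n. is_weak_gradient (f n) (h n)"
    and lim: "(\<lambda>n. LINT x|lborel. (norm (f n x - u x))\<^sup>2) \<longlonglongrightarrow> 0" "(\<lambda>n. LINT x|lborel. (norm (h n x - g x))\<^sup>2) \<longlonglongrightarrow> 0"
  shows "is_weak_gradient u g"
  unfolding is_weak_gradient_def
proof (intro conjI allI impI sq)
  fix \<phi> i assume \<phi>: "test_function \<phi>"
  have h: "square_integrable (h n)" for n using w by (simp add: is_weak_gradient_def)
  have s\<phi>: "square_integrable \<phi>" by (rule test_function_square_integrable[OF \<phi>])
  \<comment> \<open>The \<open>i\<close>-th component of a field times \<phi> is its inner product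
    with this vector field, which brings the gradient side under
    \<open>tendsto_integral_inner\<close>.\<close>
  have axis: "square_integrable (\<lambda>x. \<phi> x *\<^sub>R (axis i 1 :: real^3))"
    unfolding square_integrable_def
  proof
    note [measurable] = test_function_measurable[OF \<phi>]
    show "(\<lambda>x. \<phi> x *\<^sub>R (axis i 1 :: real^3)) \<in> borel_measurable lborel" by measurable
    show "integrable lborel (\<lambda>x. (norm (\<phi> x *\<^sub>R (axis i 1 :: real^3)))\<^sup>2)"
      using s\<phi> by (simp add: square_integrable_def)
  qed
  have "(\<lambda>n. LINT x|lborel. f n x \<bullet> partial_deriv i \<phi> x) \<longlonglongrightarrow> (LINT x|lborel. u x \<bullet> partial_deriv i \<phi> x)"
    by (rule tendsto_integral_inner[OF sq(1,2) test_function_partial_square_integrable[OF \<phi>] lim(1)])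
  moreover have "(\<lambda>n. - (LINT x|lborel. h n x \<bullet> (\<phi> x *\<^sub>R (axis i 1 :: real^3)))) \<longlonglongrightarrow> - (LINT x|lborel. g x \<bullet> (\<phi> x *\<^sub>R (axis i 1 :: real^3)))"
    by (intro tendsto_minus tendsto_integral_inner[OF h sq(3) axis lim(2)])
  moreover have "(LINT x|lborel. f n x \<bullet> partial_deriv i \<phi> x) = - (LINT x|lborel. h n x \<bullet> (\<phi> x *\<^sub>R (axis i 1 :: real^3)))" for n
    using w[of n] \<phi> by (simp add: is_weak_gradient_def inner_axis mult.commute)
  ultimately have "(LINT x|lborel. u x \<bullet> partial_deriv i \<phi> x) = - (LINT x|lborel. g x \<bullet> (\<phi> x *\<^sub>R (axis i 1 :: real^3)))"
    by (simp only: LIMSEQ_unique)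
  then show "(LINT x|lborel. u x * partial_deriv i \<phi> x) = - (LINT x|lborel. g x $ i * \<phi> x)"
    by (simp add: inner_axis mult.commute)
qed

text \<open>Representative and gradient of a class are unspecified choices; uniqueness almost
  everywhere ties them to concrete functions.\<close>

lemma grad_abs_h1:
  assumes u: "square_integrable u" and g: "is_weak_gradient u g"
  shows "AE x in lborel. rep_h1 (abs_h1 u) x = u x" "AE x in lborel. grad (abs_h1 u) x = g x"
proof -
  have "H1_function u" using u g by (auto simp: H1_function_def)
  from rep_abs_h1[OF this] show r: "AE x in lborel. rep_h1 (abs_h1 u) x = u x" .
  show "AE x in lborel. grad (abs_h1 u) x = g x"
    by (rule is_weak_gradient_unique[OF r _ _ is_weak_gradient_grad g])
       (auto simp: square_integrable_measurable[OF u])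
qed

text \<open>Representatives and gradients converge separately in L2, and closedness of the weak
  gradient makes the second limit the gradient of the first.\<close>

instance h1 :: banach
proof
  fix X :: "nat \<Rightarrow> h1" assume X: "Cauchy X"
  have C: "\<exists>N. \<forall>m\<ge>N. \<forall>n\<ge>N. (norm (X m - X n))\<^sup>2 < e" if e: "0 < e" for e
  proof -
    obtain N where N: "\<forall>m\<ge>N. \<forall>n\<ge>N. dist (X m) (X n) < sqrt e"
      using metric_CauchyD[OF X, of "sqrt e"] e by auto
    have "(norm (X m - X n))\<^sup>2 < e" if mn: "N \<le> m" "N \<le> n" for m n
    proof -
      have "norm (X m - X n) < sqrt e" using N mn by (simp add: dist_norm)
      then have "(norm (X m - X n))\<^sup>2 < (sqrt e)\<^sup>2" by (intro power_strict_mono) auto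
      then show ?thesis using \<open>0 < e\<close> by simp
    qed
    then show ?thesis by blast
  qed
  have nn: "0 \<le> (LINT x|lborel. (norm (rep_h1 u x - rep_h1 v x))\<^sup>2)"
    "0 \<le> (LINT x|lborel. (norm (grad u x - grad v x))\<^sup>2)" for u v by auto
  have c1: "\<exists>N. \<forall>m\<ge>N. \<forall>n\<ge>N. (LINT x|lborel. (norm (rep_h1 (X m) x - rep_h1 (X n) x))\<^sup>2) < e" if e: "0 < e" for e
  proof -
    obtain N where N: "\<forall>m\<ge>N. \<forall>n\<ge>N. (norm (X m - X n))\<^sup>2 < e" using C[OF e] by blast
    have "(LINT x|lborel. (norm (rep_h1 (X m) x - rep_h1 (X n) x))\<^sup>2) \<le> (norm (X m - X n))\<^sup>2" for m n
      unfolding norm_h1_diff_sq using nn(2)[of "X m" "X n"] by linarith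
    then show ?thesis using N by (meson le_less_trans)
  qed
  have c2: "\<exists>N. \<forall>m\<ge>N. \<forall>n\<ge>N. (LINT x|lborel. (norm (grad (X m) x - grad (X n) x))\<^sup>2) < e" if e: "0 < e" for e
  proof -
    obtain N where N: "\<forall>m\<ge>N. \<forall>n\<ge>N. (norm (X m - X n))\<^sup>2 < e" using C[OF e] by blast
    have "(LINT x|lborel. (norm (grad (X m) x - grad (X n) x))\<^sup>2) \<le> (norm (X m - X n))\<^sup>2" for m n
      unfolding norm_h1_diff_sq using nn(1)[of "X m" "X n"] by linarith
    then show ?thesis using N by (meson le_less_trans)
  qed
  obtain u where u: "square_integrable u" "(\<lambda>n. LINT x|lborel. (norm (rep_h1 (X n) x - u x))\<^sup>2) \<longlonglongrightarrow> 0"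
    using square_integrable_complete[of "\<lambda>n. rep_h1 (X n)", OF square_integrable_rep c1] by blast
  obtain g where g: "square_integrable g" "(\<lambda>n. LINT x|lborel. (norm (grad (X n) x - g x))\<^sup>2) \<longlonglongrightarrow> 0"
    using square_integrable_complete[of "\<lambda>n. grad (X n)", OF square_integrable_grad c2] by blast
  note [measurable] = square_integrable_measurable[OF u(1)] square_integrable_measurable[OF g(1)]
  have w: "is_weak_gradient u g"
    by (rule is_weak_gradient_limit[OF square_integrable_rep u(1) g(1) is_weak_gradient_grad u(2) g(2)])
  note ug = grad_abs_h1[OF u(1) w]
  have "(LINT x|lborel. (norm (rep_h1 (X n) x - rep_h1 (abs_h1 u) x))\<^sup>2) = (LINT x|lborel. (norm (rep_h1 (X n) x - u x))\<^sup>2)" for n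
    by (rule integral_cong_AE) (use ug(1) in auto)
  moreover have "(LINT x|lborel. (norm (grad (X n) x - grad (abs_h1 u) x))\<^sup>2) = (LINT x|lborel. (norm (grad (X n) x - g x))\<^sup>2)" for n
    by (rule integral_cong_AE) (use ug(2) in auto)
  ultimately have "(\<lambda>n. (norm (X n - abs_h1 u))\<^sup>2) \<longlonglongrightarrow> 0 + 0"
    unfolding norm_h1_diff_sq using u(2) g(2) by (intro tendsto_add) auto
  then have "(\<lambda>n. sqrt ((norm (X n - abs_h1 u))\<^sup>2)) \<longlonglongrightarrow> sqrt (0 + 0)"
    by (rule tendsto_real_sqrt)
  then have "(\<lambda>n. norm (X n - abs_h1 u)) \<longlonglongrightarrow> 0" by simp
  then have "X \<longlonglongrightarrow> abs_h1 u"
    using LIM_zero_cancel tendsto_norm_zero_iff by blast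
  then show "convergent X" by (auto simp: convergent_def)
qed

section \<open>Symmetric coercive forms\<close>

text \<open>Small sums over finite sets disjoint from \<open>F0\<close> say that the net of finite
  partial sums is Cauchy; completeness of the uniform space supplies its limit.\<close>

lemma summable_on_Cauchy_criterion:
  fixes g :: "'i \<Rightarrow> 'a::banach"
  assumes "\<And>e. 0 < e \<Longrightarrow> \<exists>F0. finite F0 \<and> F0 \<subseteq> A \<and>
      (\<forall>F. finite F \<longrightarrow> F \<subseteq> A - F0 \<longrightarrow> norm (sum g F) < e)"
  shows "g summable_on A"
proof -
  have "\<exists>P. eventually P (finite_subsets_at_top A) \<and> (\<forall>F G. P F \<and> P G \<longrightarrow> dist (sum g F) (sum g G) < e)"
    if e: "0 < e" for e
  proof -
    from e assms[of "e/2"] obtain F0 where F0: "finite F0" "F0 \<subseteq> A"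
      "\<And>F. finite F \<Longrightarrow> F \<subseteq> A - F0 \<Longrightarrow> norm (sum g F) < e/2" by auto
    define P where "P F \<longleftrightarrow> finite F \<and> F0 \<subseteq> F \<and> F \<subseteq> A" for F
    have "eventually P (finite_subsets_at_top A)"
      unfolding eventually_finite_subsets_at_top P_def using F0 by blast
    moreover have "dist (sum g F) (sum g G) < e" if "P F" "P G" for F G
    proof -
      have "dist (sum g H) (sum g F0) < e/2" if "P H" for H
        using F0(3)[of "H - F0"] that F0(1) by (auto simp: P_def dist_norm sum_diff[symmetric])
      from this[OF \<open>P F\<close>] this[OF \<open>P G\<close>] show ?thesis
        by (metis dist_commute dist_triangle_half_l)
    qed
    ultimately show ?thesis by blast
  qed
  then have "cauchy_filter (filtermap (sum g) (finite_subsets_at_top A))"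
    by (simp add: cauchy_filter_metric_filtermap)
  moreover have "complete (UNIV::'a set)"
    by (meson Cauchy_convergent UNIV_I complete_def convergent_def)
  ultimately obtain L where "(sum g \<longlongrightarrow> L) (finite_subsets_at_top A)"
    using complete_uniform[where S="UNIV::'a set"] by (force simp add: filterlim_def)
  then show ?thesis
    using summable_on_def has_sum_def by blast
qed

text \<open>The form is kept apart from the type-class inner product because the energy depends on
  \<xi>. Boundedness and coercivity make the two norms equivalent, so completeness of the type
  transfers to the form.\<close>

locale energy_form = form: bounded_bilinear form
  for form :: "'a::banach \<Rightarrow> 'a \<Rightarrow> real" +
  fixes c :: real
  assumes sym: "form u v = form v u"
    and c_pos: "0 < c"
    and coercive: "c * (norm u)\<^sup>2 \<le> form u u"
begin

lemma nonneg: "0 \<le> form u u"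
  using coercive[of u] c_pos by (smt (verit) mult_nonneg_nonneg zero_le_power2)

lemma form_eq_0_iff: "form u u = 0 \<longleftrightarrow> u = 0"
  using coercive[of u] c_pos by (auto simp: form.zero_left mult_le_0_iff)

lemma form_add_sq: "form (u + v) (u + v) = form u u + 2 * form u v + form v v"
  by (simp add: form.add_left form.add_right sym[of v u])

lemma form_diff_sq: "form (u - v) (u - v) = form u u - 2 * form u v + form v v"
  by (simp add: form.diff_left form.diff_right sym[of v u])

lemma form_parallelogram: "form (u - v) (u - v) + form (u + v) (u + v) = 2 * form u u + 2 * form v v"
  by (simp add: form_diff_sq form_add_sq)

text \<open>Direct method: as the form is symmetric, the solution is the minimiser over
  \<open>S\<close> of \<open>J v = form v v - 2 * l v\<close>, and the parallelogram law makes a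
  minimising sequence Cauchy.\<close>

proposition lax_milgram:
  assumes S: "subspace S" "closed S" and l: "bounded_linear l"
  shows "\<exists>u\<in>S. \<forall>v\<in>S. form u v = l v"
proof -
  interpret l: bounded_linear l by fact
  define J where "J v = form v v - 2 * l v" for v
  obtain B where B: "\<And>v. \<bar>l v\<bar> \<le> norm v * B"
    using l.bounded by auto
  \<comment> \<open>Completing the square in \<open>c * norm v - B\<close> bounds \<open>J\<close>
    below, so its infimum is finite.\<close>
  have lower: "- B\<^sup>2 / c \<le> J v" for v
  proof -
    have "0 \<le> (c * norm v - B)\<^sup>2" by simp
    then have "- B\<^sup>2 \<le> c * (c * (norm v)\<^sup>2 - 2 * (norm v * B))"
      by (simp add: power2_eq_square algebra_simps)
    then have "- B\<^sup>2 / c \<le> c * (norm v)\<^sup>2 - 2 * (norm v * B)"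
      using c_pos by (simp add: field_simps)
    also have "\<dots> \<le> J v" using coercive[of v] B[of v] unfolding J_def by linarith
    finally show ?thesis .
  qed
  define m where "m = Inf (J ` S)"
  have bdd: "bdd_below (J ` S)" using lower by (auto intro!: bdd_belowI)
  have m_le: "m \<le> J v" if "v \<in> S" for v
    unfolding m_def by (rule cInf_lower[OF _ bdd]) (use that in auto)
  have ne: "J ` S \<noteq> {}" using subspace_0[OF S(1)] by auto
  define \<delta> :: "nat \<Rightarrow> real" where "\<delta> n = inverse (real (Suc n))" for n
  have "\<exists>v\<in>S. J v < m + \<delta> n" for n
  proof -
    have "Inf (J ` S) < m + \<delta> n" by (simp add: m_def \<delta>_def)
    from cInf_lessD[OF ne this] show ?thesis by auto
  qed
  then obtain w where w: "\<And>n. w n \<in> S" "\<And>n. J (w n) < m + \<delta> n"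
    by metis
  have arith: "D \<le> 2 * d + 2 * e"
    if "4 * m + 4 * (x + y) \<le> S" "f - 2 * x < m + d" "g - 2 * y < m + e" "D + S = 2 * f + 2 * g"
    for m x y S f g d e D :: real
    using that by argo
  \<comment> \<open>The midpoint of \<open>w i\<close> and \<open>w j\<close> lies in
    \<open>S\<close>, hence has \<open>J\<close> at least \<open>m\<close>; the parallelogram law
    leaves only the excesses over \<open>m\<close> for the difference.\<close>
  have gap: "c * (norm (w i - w j))\<^sup>2 \<le> 2 * \<delta> i + 2 * \<delta> j" for i j
  proof -
    have h: "(1/2) *\<^sub>R (w i + w j) \<in> S" using S(1) w(1) by (intro subspace_scale subspace_add)
    have "J ((1/2) *\<^sub>R (w i + w j)) = form (w i + w j) (w i + w j) / 4 - (l (w i) + l (w j))"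
      unfolding J_def form.scaleR_left form.scaleR_right l.scaleR
      by (simp add: l.add add_divide_distrib)
    then have "form (w i + w j) (w i + w j) \<ge> 4 * m + 4 * (l (w i) + l (w j))"
      using m_le[OF h] by simp
    moreover have "form (w i) (w i) - 2 * l (w i) < m + \<delta> i"
      "form (w j) (w j) - 2 * l (w j) < m + \<delta> j"
      using w(2) by (auto simp: J_def)
    ultimately have "form (w i - w j) (w i - w j) \<le> 2 * \<delta> i + 2 * \<delta> j"
      using form_parallelogram[of "w i" "w j"] arith[of m _ _ "form (w i + w j) (w i + w j)"] by blast
    then show ?thesis using coercive[of "w i - w j"] by linarith
  qed
  have "Cauchy w"
  proof (rule metric_CauchyI)
    fix e :: real assume e: "0 < e"
    then have "0 < c * e\<^sup>2 / 4" using c_pos by simp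
    then obtain N where N: "\<delta> N < c * e\<^sup>2 / 4" unfolding \<delta>_def using reals_Archimedean by blast
    have "dist (w i) (w j) < e" if "N \<le> i" "N \<le> j" for i j
    proof -
      have "\<delta> i \<le> \<delta> N" "\<delta> j \<le> \<delta> N"
        unfolding \<delta>_def using that by (auto intro!: le_imp_inverse_le)
      with N have "\<delta> i < c * e\<^sup>2 / 4" "\<delta> j < c * e\<^sup>2 / 4"
        by linarith+
      then have "c * (norm (w i - w j))\<^sup>2 < c * e\<^sup>2" using gap[of i j] by linarith
      then have "(norm (w i - w j))\<^sup>2 < e\<^sup>2" using c_pos by simp
      then show ?thesis using e by (simp add: dist_norm power2_less_imp_less)
    qed
    then show "\<exists>N. \<forall>i\<ge>N. \<forall>j\<ge>N. dist (w i) (w j) < e" by blast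
  qed
  then obtain u where u: "w \<longlonglongrightarrow> u" using Cauchy_convergent convergent_def by blast
  have uS: "u \<in> S" using closed_sequentially[OF S(2) _ u] w(1) by blast
  have "(\<lambda>n. J (w n)) \<longlonglongrightarrow> J u"
    unfolding J_def by (intro tendsto_intros form.tendsto l.tendsto u)
  moreover have "(\<lambda>n. m + \<delta> n) \<longlonglongrightarrow> m + 0"
    unfolding \<delta>_def by (intro tendsto_add tendsto_const LIMSEQ_inverse_real_of_nat)
  ultimately have Ju: "J u \<le> m"
    using LIMSEQ_le[of "\<lambda>n. J (w n)" "J u" "\<lambda>n. m + \<delta> n" "m + 0"] w(2)
    by (simp add: less_imp_le)
  have "form u v = l v" if v: "v \<in> S" for v
  proof (cases "v = 0")
    case False
    then have pos: "0 < form v v" using nonneg[of v] form_eq_0_iff[of v] by linarith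
    define d where "d = form u v - l v"
    \<comment> \<open>This \<open>t\<close> minimises \<open>J\<close> along the line through
      \<open>u\<close> in direction \<open>v\<close>; the decrease it would give is
      \<open>d^2 / form v v\<close>, which minimality of \<open>u\<close> forces to vanish.\<close>
    define t where "t = d / form v v"
    have "u - t *\<^sub>R v \<in> S" using S(1) uS v by (intro subspace_diff subspace_scale)
    then have "J u \<le> J (u - t *\<^sub>R v)" using Ju m_le by force
    also have "\<dots> = J u - 2 * t * d + t * t * form v v"
      by (simp add: J_def form_diff_sq form.scaleR_left form.scaleR_right l.diff l.scaleR d_def algebra_simps)
    also have "\<dots> = J u - d\<^sup>2 / form v v"
      using pos by (simp add: t_def power2_eq_square field_simps)
    finally have "d\<^sup>2 / form v v \<le> 0" by simp
    then have "d\<^sup>2 \<le> 0" using pos by (simp add: divide_le_0_iff)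
    then show ?thesis by (simp add: d_def)
  qed (simp add: form.zero_right l.zero)
  then show ?thesis using uS by blast
qed

section \<open>Orthogonal projections onto the complement of a closed subspace\<close>

lemma orthogonal_unique:
  assumes "subspace S" "u \<in> S" "u' \<in> S" "\<And>v. v \<in> S \<Longrightarrow> form u v = form u' v"
  shows "u = u'"
proof -
  have "form (u - u') (u - u') = 0"
    using assms subspace_diff[OF assms(1-3)] by (simp add: form.diff_left)
  then show ?thesis by (simp add: form_eq_0_iff)
qed

text \<open>Identity minus the orthogonal projection onto \<open>S\<close>. The description
  prescribes \<open>w\<close> modulo \<open>S\<close>, matching the shape of \<open>Q_proj\<close>:
  boundary data inside the ball, equation outside.\<close>

definition outer_proj :: "'a set \<Rightarrow> 'a \<Rightarrow> 'a" where
  "outer_proj S w = (THE z. z - w \<in> S \<and> (\<forall>v\<in>S. form z v = 0))"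

lemma outer_proj_ex1:
  assumes S: "subspace S" "closed S"
  shows "\<exists>!z. z - w \<in> S \<and> (\<forall>v\<in>S. form z v = 0)"
proof -
  obtain s where s: "s \<in> S" "\<And>v. v \<in> S \<Longrightarrow> form s v = form w v"
    using lax_milgram[OF S form.bounded_linear_right, of w] by blast
  show ?thesis
  proof (rule ex1I[of _ "w - s"])
    show "w - s - w \<in> S \<and> (\<forall>v\<in>S. form (w - s) v = 0)"
      using s subspace_neg[OF S(1)] by (auto simp: form.diff_left)
    fix z assume z: "z - w \<in> S \<and> (\<forall>v\<in>S. form z v = 0)"
    have "w - z \<in> S" using z subspace_neg[OF S(1), of "z - w"] by simp
    then have "w - z = s"
      by (rule orthogonal_unique[OF S(1) _ s(1)]) (use z s(2) in \<open>simp add: form.diff_left\<close>)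
    then show "z = w - s" by auto
  qed
qed

context
  fixes S :: "'a set" assumes S: "subspace S" "closed S"
begin

lemma outer_proj_diff: "outer_proj S w - w \<in> S"
  and outer_proj_orth: "v \<in> S \<Longrightarrow> form (outer_proj S w) v = 0"
  using theI'[OF outer_proj_ex1[OF S, of w]] unfolding outer_proj_def by blast+

lemma outer_proj_eqI: "z - w \<in> S \<Longrightarrow> (\<And>v. v \<in> S \<Longrightarrow> form z v = 0) \<Longrightarrow> outer_proj S w = z"
  using outer_proj_ex1[OF S, of w] outer_proj_diff outer_proj_orth by blast

lemma outer_proj_idem: "(\<And>v. v \<in> S \<Longrightarrow> form w v = 0) \<Longrightarrow> outer_proj S w = w"
  by (rule outer_proj_eqI) (use subspace_0[OF S(1)] in auto)

lemma outer_proj_add: "outer_proj S (u + v) = outer_proj S u + outer_proj S v"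
proof (rule outer_proj_eqI)
  have "(outer_proj S u - u) + (outer_proj S v - v) \<in> S"
    by (intro subspace_add[OF S(1)] outer_proj_diff)
  then show "outer_proj S u + outer_proj S v - (u + v) \<in> S" by (simp add: algebra_simps)
qed (simp add: form.add_left outer_proj_orth)

lemma outer_proj_scaleR: "outer_proj S (t *\<^sub>R u) = t *\<^sub>R outer_proj S u"
proof (rule outer_proj_eqI)
  have "t *\<^sub>R (outer_proj S u - u) \<in> S"
    by (intro subspace_scale[OF S(1)] outer_proj_diff)
  then show "t *\<^sub>R outer_proj S u - t *\<^sub>R u \<in> S" by (simp add: algebra_simps)
qed (simp add: form.scaleR_left outer_proj_orth)

lemma form_outer_proj: "form (outer_proj S u) v = form (outer_proj S u) (outer_proj S v)"
  using outer_proj_orth[OF outer_proj_diff, of u v] by (simp add: form.diff_right)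

text \<open>Pythagoras: \<open>w - outer_proj S u\<close> lies in \<open>S\<close> and is orthogonal
  to the projection. Any competitor with the right values modulo \<open>S\<close> thus bounds the
  energy of the projection.\<close>

lemma outer_proj_minimal:
  assumes "w - u \<in> S"
  shows "form (outer_proj S u) (outer_proj S u) \<le> form w w"
proof -
  have "w - outer_proj S u = (w - u) - (outer_proj S u - u)" by simp
  then have "w - outer_proj S u \<in> S"
    using subspace_diff[OF S(1) assms outer_proj_diff] by metis
  then have "form w w = form (outer_proj S u) (outer_proj S u) + form (w - outer_proj S u) (w - outer_proj S u)"
    using form_add_sq[of "outer_proj S u" "w - outer_proj S u"] by (simp add: outer_proj_orth)
  then show ?thesis using nonneg[of "w - outer_proj S u"] by linarith
qed

end

text \<open>The bound on every finite subset lets the tails of the numerical series \<open>b\<close>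
  control those of \<open>g\<close> through coercivity. It serves both the series of projections and
  the sum of cutoffs.\<close>

lemma summable_on_of_form_bound:
  assumes b: "b summable_on A" "\<And>i. i \<in> A \<Longrightarrow> 0 \<le> b i" and M: "0 \<le> M"
    and g: "\<And>F. finite F \<Longrightarrow> F \<subseteq> A \<Longrightarrow> form (sum g F) (sum g F) \<le> M * sum b F"
  shows "g summable_on A"
    and "form (infsum g A) (infsum g A) \<le> M * infsum b A"
proof -
  show s: "g summable_on A"
  proof (rule summable_on_Cauchy_criterion)
    fix e :: real assume e: "0 < e"
    \<comment> \<open>The denominator \<open>M + 1\<close> also covers \<open>M = 0\<close>; the
      choice makes \<open>M * d\<close> smaller than \<open>c\<close> times the square of
      \<open>e\<close>.\<close>
    define d where "d = c * e\<^sup>2 / (M + 1)"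
    have d: "0 < d" using e c_pos M by (simp add: d_def)
    have "(sum b \<longlongrightarrow> infsum b A) (finite_subsets_at_top A)"
      using b(1) infsum_tendsto by blast
    then have "\<forall>\<^sub>F F in finite_subsets_at_top A. dist (sum b F) (infsum b A) < d"
      using d tendstoD by blast
    then obtain F0 where F0: "finite F0" "F0 \<subseteq> A" "dist (sum b F0) (infsum b A) < d"
      unfolding eventually_finite_subsets_at_top by blast
    have "norm (sum g F) < e" if F: "finite F" "F \<subseteq> A - F0" for F
    proof -
      have "sum b (F0 \<union> F) \<le> infsum b A"
        by (rule finite_sum_le_infsum[OF b(1)]) (use F F0 b(2) in auto)
      moreover have "sum b (F0 \<union> F) = sum b F0 + sum b F"
        by (rule sum.union_disjoint) (use F F0 in auto)
      ultimately have "sum b F < d" using F0(3) by (auto simp: dist_real_def)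
      then have "M * sum b F \<le> M * d" using M by (simp add: mult_left_mono)
      also have "\<dots> < (M + 1) * d" using d by simp
      also have "\<dots> = c * e\<^sup>2" using M by (simp add: d_def)
      finally have "c * (norm (sum g F))\<^sup>2 < c * e\<^sup>2"
        using g[OF F(1)] F(2) coercive[of "sum g F"] by (meson Diff_subset le_less_trans order_trans)
      then have "(norm (sum g F))\<^sup>2 < e\<^sup>2" using c_pos by simp
      then show ?thesis using e by (simp add: power2_less_imp_less)
    qed
    then show "\<exists>F0. finite F0 \<and> F0 \<subseteq> A \<and> (\<forall>F. finite F \<longrightarrow> F \<subseteq> A - F0 \<longrightarrow> norm (sum g F) < e)"
      using F0 by blast
  qed
  show "form (infsum g A) (infsum g A) \<le> M * infsum b A"
  proof (rule tendsto_le[OF finite_subsets_at_top_neq_bot])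
    show "((\<lambda>F. M * sum b F) \<longlongrightarrow> M * infsum b A) (finite_subsets_at_top A)"
      by (rule tendsto_mult[OF tendsto_const infsum_tendsto[OF b(1)]])
    show "((\<lambda>F. form (sum g F) (sum g F)) \<longlongrightarrow> form (infsum g A) (infsum g A)) (finite_subsets_at_top A)"
      by (rule form.tendsto[OF infsum_tendsto[OF s] infsum_tendsto[OF s]])
    show "\<forall>\<^sub>F F in finite_subsets_at_top A. form (sum g F) (sum g F) \<le> M * sum b F"
      by (rule eventually_finite_subsets_at_top_weakI) (rule g)
  qed
qed

end

section \<open>Averaged sums of projections\<close>

text \<open>The recursion makes the weighted sums \<open>\<Psi>\<^sub>N\<close> satisfy \<open>\<Psi>\<^bsub>N+1\<^esub> = \<Psi>\<^sub>N - g L \<Psi>\<^sub>N\<close>; solved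
  explicitly, the weights are tails of binomial distributions.\<close>

primrec averaging_weight :: "real \<Rightarrow> nat \<Rightarrow> nat \<Rightarrow> real" where
  "averaging_weight g k 0 = (if k = 0 then 1 else 0)"
| "averaging_weight g k (Suc N) =
     (if k = 0 then 1 else (1 - g) * averaging_weight g k N + g * averaging_weight g (k - 1) N)"

lemma averaging_weight_0 [simp]: "averaging_weight g 0 N = 1"
  by (cases N) auto

lemma averaging_weight_Suc_Suc [simp]:
  "averaging_weight g (Suc k) (Suc N) = (1 - g) * averaging_weight g (Suc k) N + g * averaging_weight g k N"
  by simp

lemma averaging_weight_beyond: "N < k \<Longrightarrow> averaging_weight g k N = 0"
  by (induction N arbitrary: k) auto

context
  fixes g :: real assumes g: "0 < g" "g < 1"
begin

lemma averaging_weight_bounds: "0 \<le> averaging_weight g k N \<and> averaging_weight g k N \<le> 1"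
proof (induction N arbitrary: k)
  case (Suc N)
  have "(1 - g) * averaging_weight g k N + g * averaging_weight g (k - 1) N \<le> (1 - g) * 1 + g * 1"
    using Suc g by (intro add_mono mult_left_mono) auto
  then show ?case using Suc g by simp
qed simp

lemma averaging_weight_antimono: "averaging_weight g (Suc k) N \<le> averaging_weight g k N"
proof (induction N arbitrary: k)
  case (Suc N)
  show ?case
  proof (cases k)
    case 0
    then show ?thesis using averaging_weight_bounds[of "Suc k" "Suc N"] by simp
  next
    case (Suc l)
    then show ?thesis
      using Suc.IH[of k] Suc.IH[of l] g by (auto intro!: add_mono mult_left_mono)
  qed
qed simp

text \<open>The recursion turns antimonotonicity in \<open>k\<close> into monotonicity in
  \<open>N\<close>, and boundedness by 1 gives a limit \<open>l\<close>. Passing to the limit in the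
  recursion yields \<open>l = (1 - g) * l + g\<close>.\<close>

lemma averaging_weight_tendsto: "(\<lambda>N. averaging_weight g k N) \<longlonglongrightarrow> 1"
proof (induction k)
  case (Suc k)
  have "averaging_weight g (Suc k) N \<le> averaging_weight g (Suc k) (Suc N)" for N
    using mult_left_mono[OF averaging_weight_antimono[of k N], of g] g by (simp add: algebra_simps)
  then have "incseq (\<lambda>N. averaging_weight g (Suc k) N)" by (rule incseq_SucI)
  then obtain l where l: "(\<lambda>N. averaging_weight g (Suc k) N) \<longlonglongrightarrow> l"
    using incseq_convergent[of _ 1] averaging_weight_bounds by blast
  have "(\<lambda>N. averaging_weight g (Suc k) (Suc N)) \<longlonglongrightarrow> (1 - g) * l + g * 1"
    unfolding averaging_weight_Suc_Suc by (intro tendsto_intros l Suc)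
  moreover have "(\<lambda>N. averaging_weight g (Suc k) (Suc N)) \<longlonglongrightarrow> l"
    using l by (rule LIMSEQ_Suc)
  ultimately have "l = (1 - g) * l + g * 1" using LIMSEQ_unique by blast
  then have "g * (l - 1) = 0" by (simp add: algebra_simps)
  then have "l = 1" using g by simp
  then show ?case using l by simp
qed simp

end

text \<open>\<open>upper\<close> is a Bessel inequality and bounds the operator \<open>L\<close>
  defined below. \<open>lower\<close> is a stable lifting: some \<open>w\<close> agrees with
  \<open>u\<close> modulo every \<open>W i\<close> at a cost measured by the projections alone,
  which yields coercivity. Both are the standard requirements on an additive Schwarz method.\<close>

locale subspace_family = energy_form form c
  for form :: "'a::banach \<Rightarrow> 'a \<Rightarrow> real" and c +
  fixes I :: "'i set" and W :: "'i \<Rightarrow> 'a set" and M :: real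
  assumes W: "i \<in> I \<Longrightarrow> subspace (W i)" "i \<in> I \<Longrightarrow> closed (W i)"
    and M: "1 \<le> M"
    and upper: "finite F \<Longrightarrow> F \<subseteq> I \<Longrightarrow>
      (\<Sum>i\<in>F. form (outer_proj (W i) u) (outer_proj (W i) u)) \<le> M * form u u"
    and lower: "\<exists>w. (\<forall>i\<in>I. w - u \<in> W i) \<and>
      form w w \<le> M * (\<Sum>\<^sub>\<infinity>i\<in>I. form (outer_proj (W i) u) (outer_proj (W i) u))"
begin

section \<open>The operator \<open>L\<close> and its quadratic form \<open>q\<close>\<close>

abbreviation Q where "Q i \<equiv> outer_proj (W i)"

definition V :: "'a set" where "V = (\<Inter>i\<in>I. W i)"

definition L :: "'a \<Rightarrow> 'a" where "L u = (\<Sum>\<^sub>\<infinity>i\<in>I. Q i u)"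

definition q :: "'a \<Rightarrow> real" where "q u = (\<Sum>\<^sub>\<infinity>i\<in>I. form (Q i u) (Q i u))"

lemma V_subspace: "subspace V" and V_closed: "closed V"
  unfolding V_def using W by (auto intro!: subspace_Inter)

lemma q_summable: "(\<lambda>i. form (Q i u) (Q i u)) summable_on I"
  by (rule nonneg_bdd_above_summable_on) (auto simp: nonneg intro!: bdd_aboveI[of _ "M * form u u"] upper)

lemma q_nonneg: "0 \<le> q u"
  unfolding q_def by (rule infsum_nonneg) (rule nonneg)

text \<open>With \<open>s\<close> the sum, \<open>form s s\<close> is the sum of
  \<open>form (Q i u) (Q i s)\<close>. Young's inequality with weight \<open>M\<close>, followed by
  \<open>upper\<close> applied to \<open>s\<close> itself, leaves one copy of
  \<open>form s s\<close> to be absorbed.\<close>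

lemma sum_Q_le:
  assumes F: "finite F" "F \<subseteq> I"
  shows "form (\<Sum>i\<in>F. Q i u) (\<Sum>i\<in>F. Q i u) \<le> M * (\<Sum>i\<in>F. form (Q i u) (Q i u))"
proof -
  define s where "s = (\<Sum>i\<in>F. Q i u)"
  define A where "A = (\<Sum>i\<in>F. form (Q i u) (Q i u))"
  have "2 * form (Q i u) s \<le> M * form (Q i u) (Q i u) + form (Q i s) (Q i s) / M" if "i \<in> F" for i
  proof -
    have "0 \<le> form (M *\<^sub>R Q i u - Q i s) (M *\<^sub>R Q i u - Q i s)" by (rule nonneg)
    also have "\<dots> = M * (M * form (Q i u) (Q i u)) - 2 * M * form (Q i u) (Q i s) + form (Q i s) (Q i s)"
      by (simp add: form_diff_sq form.scaleR_left form.scaleR_right)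
    finally have "2 * form (Q i u) (Q i s) \<le> M * form (Q i u) (Q i u) + form (Q i s) (Q i s) / M"
      using M by (simp add: field_simps)
    then show ?thesis using form_outer_proj[OF W, of i u s] that F by auto
  qed
  then have "(\<Sum>i\<in>F. 2 * form (Q i u) s) \<le> (\<Sum>i\<in>F. M * form (Q i u) (Q i u) + form (Q i s) (Q i s) / M)"
    by (rule sum_mono)
  also have "\<dots> = M * A + (\<Sum>i\<in>F. form (Q i s) (Q i s)) / M"
    by (simp add: sum.distrib sum_distrib_left A_def sum_divide_distrib)
  also have "\<dots> \<le> M * A + form s s"
    using upper[OF F, of s] M by (simp add: divide_le_eq mult.commute)
  finally have "2 * form s s \<le> M * A + form s s"
    by (simp add: s_def form.sum_left sum_distrib_left)
  then show ?thesis by (simp add: s_def A_def)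
qed

lemma Q_summable: "(\<lambda>i. Q i u) summable_on I"
  and L_le: "form (L u) (L u) \<le> M * q u"
  using summable_on_of_form_bound[OF q_summable nonneg _ sum_Q_le, of u] M unfolding L_def q_def by auto

lemma form_L_has_sum: "((\<lambda>i. form (Q i u) v) has_sum form (L u) v) I"
  unfolding L_def
  by (rule has_sum_bounded_linear[OF form.bounded_linear_left has_sum_infsum[OF Q_summable]])

lemma form_L_self: "form (L u) u = q u"
proof -
  have "((\<lambda>i. form (Q i u) (Q i u)) has_sum form (L u) u) I"
    by (rule has_sum_cong[THEN iffD1, OF _ form_L_has_sum[of u u]]) (rule form_outer_proj[OF W])
  then show ?thesis unfolding q_def by (simp add: infsumI)
qed

text \<open>Each \<open>Q i u\<close> is orthogonal to \<open>W i\<close>, which contains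
  \<open>V\<close>. Hence the iteration stays in the complement of \<open>V\<close>, where
  \<open>L\<close> is coercive.\<close>

lemma form_L_V: "v \<in> V \<Longrightarrow> form (L u) v = 0"
proof -
  assume v: "v \<in> V"
  have "((\<lambda>i. 0) has_sum form (L u) v) I"
    by (rule has_sum_cong[THEN iffD1, OF _ form_L_has_sum[of u v]])
       (use v in \<open>auto simp: V_def intro: outer_proj_orth[OF W]\<close>)
  then show ?thesis by (rule has_sum_unique) (rule has_sum_0, simp)
qed

lemma Q_V: "v \<in> V \<Longrightarrow> i \<in> I \<Longrightarrow> Q i v = 0"
  by (rule outer_proj_eqI[OF W]) (auto simp: V_def subspace_neg W form.zero_left)

lemma L_V: "v \<in> V \<Longrightarrow> L v = 0"
  unfolding L_def using Q_V by (simp add: infsum_0)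

lemma L_add: "L (u + v) = L u + L v"
proof -
  have "L (u + v) = (\<Sum>\<^sub>\<infinity>i\<in>I. Q i u + Q i v)"
    unfolding L_def by (rule infsum_cong) (simp add: outer_proj_add W)
  then show ?thesis unfolding L_def by (simp add: infsum_add Q_summable)
qed

lemma L_scaleR: "L (t *\<^sub>R u) = t *\<^sub>R L u"
proof -
  have "((\<lambda>i. t *\<^sub>R Q i u) has_sum t *\<^sub>R L u) I"
    unfolding L_def
    by (rule has_sum_bounded_linear[OF bounded_linear_scaleR_right has_sum_infsum[OF Q_summable]])
  then have "((\<lambda>i. Q i (t *\<^sub>R u)) has_sum t *\<^sub>R L u) I"
    by (rule has_sum_cong[THEN iffD1, rotated]) (simp add: outer_proj_scaleR W)
  then show ?thesis unfolding L_def by (rule infsumI)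
qed

lemma L_sum: "L (\<Sum>k\<in>F. u k) = (\<Sum>k\<in>F. L (u k))"
  by (induction F rule: infinite_finite_induct) (use L_scaleR[of 0] in \<open>auto simp: L_add\<close>)

text \<open>The lifting from \<open>lower\<close> differs from \<open>u\<close> by an element of
  \<open>V\<close>, so by orthogonality it has at least the energy of \<open>u\<close>.\<close>

lemma q_lower:
  assumes "\<And>v. v \<in> V \<Longrightarrow> form u v = 0"
  shows "form u u \<le> M * q u"
proof -
  obtain w where w: "\<And>i. i \<in> I \<Longrightarrow> w - u \<in> W i" "form w w \<le> M * q u"
    using lower unfolding q_def by blast
  have "form u (w - u) = 0" using w(1) assms by (simp add: V_def)
  then have "form w w = form u u + form (w - u) (w - u)"
    using form_add_sq[of u "w - u"] by simp
  then show ?thesis using w(2) nonneg[of "w - u"] by linarith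
qed

text \<open>The cross term gains \<open>2 * g * q u\<close>, whereas the quadratic term loses at
  most \<open>g * g * M * q u\<close>; \<open>q_lower\<close> turns the remaining gain into a
  fraction of the energy.\<close>

lemma relaxation_contracts:
  assumes u: "\<And>v. v \<in> V \<Longrightarrow> form u v = 0" and g: "g = 1 / (2 * M)"
  shows "form (u - g *\<^sub>R L u) (u - g *\<^sub>R L u) \<le> (1 - g / M) * form u u"
proof -
  have "form (u - g *\<^sub>R L u) (u - g *\<^sub>R L u) = form u u - 2 * g * q u + g * g * form (L u) (L u)"
    by (simp add: form_diff_sq form.scaleR_left form.scaleR_right form_L_self sym[of u "L u"])
  also have "\<dots> \<le> form u u - 2 * g * q u + g * g * (M * q u)"
    using L_le[of u] by (intro add_left_mono mult_left_mono) auto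
  \<comment> \<open>Since \<open>g * M = 1/2\<close>, only a quarter of the gain is lost.\<close>
  also have "\<dots> = form u u - (3/2) * g * q u" using M by (simp add: g)
  also have "\<dots> \<le> form u u - g * q u" using M q_nonneg[of u] by (simp add: g field_simps)
  also have "\<dots> \<le> form u u - g * (form u u / M)"
    using q_lower[OF u] M by (intro diff_left_mono mult_left_mono) (auto simp: g divide_le_eq mult.commute)
  also have "\<dots> = (1 - g / M) * form u u" by (simp add: algebra_simps)
  finally show ?thesis .
qed

section \<open>The Method of Reflections in abstract form: \<open>P k\<close> is the k-th term,
  \<open>R k i\<close> the contribution of particle \<open>i\<close> to term k+1\<close>

context
  fixes p :: 'a and P :: "nat \<Rightarrow> 'a" and R :: "nat \<Rightarrow> 'i \<Rightarrow> 'a"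
  assumes P0: "P 0 = p" and P_Suc: "\<And>k. P (Suc k) = (\<Sum>\<^sub>\<infinity>i\<in>I. R k i)"
    and R0: "\<And>i. i \<in> I \<Longrightarrow> R 0 i = - Q i p"
    and R_Suc: "\<And>k i. i \<in> I \<Longrightarrow> R (Suc k) i = - Q i (\<Sum>\<^sub>\<infinity>j\<in>I - {i}. R k j)"
begin

text \<open>Write \<open>S\<close> for the sum of \<open>P l\<close> over \<open>l \<le> k\<close>.
  Omitting particle \<open>i\<close> from \<open>P (Suc k)\<close> adds back \<open>Q i S\<close>,
  and by idempotence \<open>Q i\<close> cannot distinguish \<open>Q i S\<close> from
  \<open>S\<close>. The exclusion of self-reflection thus accumulates all earlier terms.\<close>

lemma R_eq: "i \<in> I \<Longrightarrow> R k i = - Q i (\<Sum>l\<le>k. P l)"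
proof (induction k arbitrary: i)
  case 0
  then show ?case by (simp add: R0 P0)
next
  case (Suc k)
  let ?S = "\<Sum>l\<le>k. P l"
  have "(R k has_sum - L ?S) I"
    by (rule has_sum_cong[THEN iffD2, OF Suc.IH])
       (simp_all add: has_sum_uminus L_def has_sum_infsum Q_summable)
  moreover have "((R k) has_sum R k i) {i}" by (simp add: has_sum_finite_iff)
  ultimately have "(R k has_sum (- L ?S - R k i)) (I - {i})"
    by (rule has_sum_Diff) (use Suc.prems in simp)
  then have 1: "(\<Sum>\<^sub>\<infinity>j\<in>I - {i}. R k j) = - L ?S - R k i" by (rule infsumI)
  have 2: "P (Suc k) = - L ?S"
    unfolding P_Suc using \<open>(R k has_sum - L ?S) I\<close> by (rule infsumI)
  have idem: "Q i (Q i ?S) = Q i ?S"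
    by (rule outer_proj_idem[OF W]) (use Suc.prems in \<open>auto intro: outer_proj_orth[OF W]\<close>)
  have "(\<Sum>\<^sub>\<infinity>j\<in>I - {i}. R k j) = P (Suc k) + Q i ?S"
    using 1 2 Suc.IH[OF Suc.prems] by simp
  then have "R (Suc k) i = - (Q i (P (Suc k)) + Q i (Q i ?S))"
    using Suc.prems by (simp add: R_Suc outer_proj_add W)
  also have "\<dots> = - Q i (\<Sum>l\<le>Suc k. P l)"
    using Suc.prems by (simp add: idem outer_proj_add W)
  finally show ?case .
qed

lemma R_summable: "R k summable_on I"
  by (rule summable_on_cong[THEN iffD2, OF R_eq]) (auto simp: summable_on_uminus Q_summable)

lemma P_Suc_eq: "P (Suc k) = - L (\<Sum>l\<le>k. P l)"
proof -
  have "P (Suc k) = (\<Sum>\<^sub>\<infinity>i\<in>I. - Q i (\<Sum>l\<le>k. P l))"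
    unfolding P_Suc by (rule infsum_cong) (rule R_eq)
  then show ?thesis by (simp add: infsum_uminus L_def)
qed

text \<open>Partial sums evolve under \<open>1 - L\<close>, hence so do their increments; the first
  step differs, since \<open>P 1\<close> is \<open>- L (P 0)\<close>.\<close>

lemma P_Suc_Suc: "P (Suc (Suc k)) = P (Suc k) - L (P (Suc k))"
  using L_scaleR[of "-1"] L_add[of "\<Sum>l\<le>k. P l" "- L (\<Sum>l\<le>k. P l)"]
  by (simp add: P_Suc_eq[of "Suc k"] P_Suc_eq[of k])

definition \<Psi> :: "real \<Rightarrow> nat \<Rightarrow> 'a" where
  "\<Psi> g N = (\<Sum>k\<le>N. averaging_weight g k N *\<^sub>R P k)"

text \<open>The weight recursion splits the terms beyond \<open>P 0\<close> into
  \<open>1 - g\<close> times the tail of the old average and \<open>g\<close> times the average of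
  the shifted terms. The shift acts as \<open>1 - L\<close> up to \<open>P 0\<close>, and the copies
  of \<open>P 0\<close> cancel.\<close>

lemma \<Psi>_Suc: "\<Psi> g (Suc N) = \<Psi> g N - g *\<^sub>R L (\<Psi> g N)"
proof -
  let ?w = "averaging_weight g"
  \<comment> \<open>The weight at index \<open>Suc N\<close> vanishes at stage \<open>N\<close>, so
    the shifted sum is the old average without its first term.\<close>
  have rest: "(\<Sum>k\<le>N. ?w (Suc k) N *\<^sub>R P (Suc k)) = \<Psi> g N - P 0"
  proof -
    have "(\<Sum>k\<le>N. ?w (Suc k) N *\<^sub>R P (Suc k)) + ?w 0 N *\<^sub>R P 0 = (\<Sum>k\<le>Suc N. ?w k N *\<^sub>R P k)"
      by (subst sum.atMost_Suc_shift) (rule add.commute)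
    also have "\<dots> = \<Psi> g N" by (simp add: \<Psi>_def averaging_weight_beyond)
    finally show ?thesis by (simp add: algebra_simps)
  qed
  \<comment> \<open>The correction at \<open>k = 0\<close> records that \<open>P 1\<close> lacks the
    summand \<open>P 0\<close>.\<close>
  have step: "P (Suc k) = P k - L (P k) - (if k = 0 then P 0 else 0)" for k
    by (cases k) (auto simp: P_Suc_Suc P_Suc_eq[of 0])
  have "(\<Sum>k\<le>N. ?w k N *\<^sub>R P (Suc k))
      = (\<Sum>k\<le>N. ?w k N *\<^sub>R P k) - (\<Sum>k\<le>N. L (?w k N *\<^sub>R P k)) - (\<Sum>k\<le>N. if k = 0 then P 0 else 0)"
    unfolding sum_subtractf[symmetric]
  proof (rule sum.cong[OF refl])
    fix k
    show "?w k N *\<^sub>R P (Suc k) = ?w k N *\<^sub>R P k - L (?w k N *\<^sub>R P k) - (if k = 0 then P 0 else 0)"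
      by (subst step) (auto simp: L_scaleR scaleR_diff_right)
  qed
  also have "\<dots> = \<Psi> g N - L (\<Psi> g N) - P 0"
    by (simp add: \<Psi>_def L_sum)
  finally have shift: "(\<Sum>k\<le>N. ?w k N *\<^sub>R P (Suc k)) = \<Psi> g N - L (\<Psi> g N) - P 0" .
  have "\<Psi> g (Suc N) = P 0 + (\<Sum>k\<le>N. ?w (Suc k) (Suc N) *\<^sub>R P (Suc k))"
    unfolding \<Psi>_def by (subst sum.atMost_Suc_shift) (simp del: averaging_weight.simps)
  also have "(\<Sum>k\<le>N. ?w (Suc k) (Suc N) *\<^sub>R P (Suc k))
      = (1 - g) *\<^sub>R (\<Sum>k\<le>N. ?w (Suc k) N *\<^sub>R P (Suc k)) + g *\<^sub>R (\<Sum>k\<le>N. ?w k N *\<^sub>R P (Suc k))"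
    by (simp add: scaleR_left_distrib sum.distrib scaleR_sum_right del: averaging_weight.simps)
  finally show ?thesis
    unfolding rest shift by (simp add: algebra_simps)
qed

text \<open>As \<open>L\<close> annihilates \<open>u\<close>, the error obeys the same relaxed
  iteration as the averages. It starts orthogonal to \<open>V\<close> and remains so, and Pythagoras
  bounds the initial error by the energy of \<open>p\<close>.\<close>

proposition averaged_reflections_converge:
  assumes g: "g = 1 / (2 * M)" and u: "u \<in> V" "\<And>v. v \<in> V \<Longrightarrow> form (p - u) v = 0"
  shows "form (\<Psi> g N - u) (\<Psi> g N - u) \<le> (1 - g / M) ^ N * form p p"
proof -
  have "1 * 1 \<le> 2 * M * M" using M by (intro mult_mono) auto
  then have gM: "0 \<le> 1 - g / M" using M by (simp add: g divide_le_eq)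
  have "(\<forall>v\<in>V. form (\<Psi> g N - u) v = 0) \<and>
      form (\<Psi> g N - u) (\<Psi> g N - u) \<le> (1 - g / M) ^ N * form (p - u) (p - u)"
  proof (induction N)
    case 0
    then show ?case by (simp add: \<Psi>_def P0 u(2))
  next
    case (Suc N)
    have "L (\<Psi> g N - u) = L (\<Psi> g N)"
      using L_add[of "\<Psi> g N - u" u] by (simp add: L_V u(1))
    then have *: "\<Psi> g (Suc N) - u = (\<Psi> g N - u) - g *\<^sub>R L (\<Psi> g N - u)"
      by (simp add: \<Psi>_Suc algebra_simps)
    have "form (\<Psi> g (Suc N) - u) (\<Psi> g (Suc N) - u) \<le> (1 - g / M) * form (\<Psi> g N - u) (\<Psi> g N - u)"
      unfolding * by (rule relaxation_contracts[OF _ g]) (use Suc in auto)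
    also have "\<dots> \<le> (1 - g / M) * ((1 - g / M) ^ N * form (p - u) (p - u))"
      using Suc gM by (intro mult_left_mono) auto
    finally show ?case
      using Suc by (simp add: * form.diff_left form.scaleR_left form_L_V mult.assoc)
  qed
  moreover have "form (p - u) (p - u) \<le> form p p"
    using form_add_sq[of "p - u" u] nonneg[of u] u by simp
  ultimately show ?thesis
    using mult_left_mono[of "form (p - u) (p - u)" "form p p" "(1 - g / M) ^ N"] gM by force
qed

end

end

section \<open>A local Hardy inequality\<close>

lemma AE_lborel_limit_of_continuous:
  fixes f :: "real^3 \<Rightarrow> real"
  assumes "f \<in> borel_measurable borel"
  obtains g where "\<And>n. continuous_on UNIV (g n)" "AE x in lborel. (\<lambda>n. g n x) \<longlonglongrightarrow> f x"
proof -
  have "f \<in> borel_measurable lebesgue"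
    using assms by (simp add: measurable_completion)
  then have "f measurable_on UNIV"
    by (rule lebesgue_measurable_imp_measurable_on_real) simp
  then obtain N g where N: "negligible N" and g: "\<And>n. continuous_on UNIV (g n)"
    and lim: "\<And>x. x \<notin> N \<Longrightarrow> (\<lambda>n. g n x) \<longlonglongrightarrow> f x"
    unfolding measurable_on_def by auto
  have "AE x in lebesgue. x \<notin> N"
    using N by (simp add: negligible_iff_null_sets AE_not_in)
  then have "AE x in lebesgue. (\<lambda>n. g n x) \<longlonglongrightarrow> f x"
    by (rule AE_mp) (auto simp: lim)
  then have "AE x in lborel. (\<lambda>n. g n x) \<longlonglongrightarrow> f x" by (simp only: AE_completion_iff)
  then show ?thesis by (rule that[OF g])
qed

text \<open>The squared distance keeps the bump smooth at the centre. Supported in the ball, it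
  tends to 1 pointwise inside as \<open>n\<close> grows.\<close>

definition ball_bump :: "real^3 \<Rightarrow> real \<Rightarrow> nat \<Rightarrow> real^3 \<Rightarrow> real" where
  "ball_bump y \<rho> n x = flat 0 (real n * (\<rho>\<^sup>2 - (norm (x - y))\<^sup>2))"

lemma Ck_dist2: "Ck k (\<lambda>x. (norm (x - y))\<^sup>2)"
  using Ck_rescale[OF Ck_power2_norm, of k 1 y] by simp

lemma Ck_ball_bump: "Ck k (ball_bump y \<rho> n)"
proof -
  have "Ck k (\<lambda>x. flat 0 (real n * (\<rho>\<^sup>2 + (-1) * (norm (x - y))\<^sup>2)))"
    by (intro Ck_flat_comp Ck_mult Ck_add Ck_const Ck_dist2)
  then show ?thesis by (simp add: ball_bump_def[abs_def])
qed

lemma ball_bump_bounds: "0 \<le> ball_bump y \<rho> n x" "ball_bump y \<rho> n x \<le> 1"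
  by (simp_all add: ball_bump_def flat_0_bounds)

lemma ball_bump_outside: "0 \<le> \<rho> \<Longrightarrow> x \<notin> ball y \<rho> \<Longrightarrow> ball_bump y \<rho> n x = 0"
proof -
  assume "0 \<le> \<rho>" "x \<notin> ball y \<rho>"
  then have "\<rho>\<^sup>2 \<le> (norm (x - y))\<^sup>2"
    by (intro power_mono) (auto simp: dist_norm norm_minus_commute)
  then show ?thesis by (simp add: ball_bump_def flat_def mult_le_0_iff)
qed

lemma ball_bump_tendsto: "x \<in> ball y \<rho> \<Longrightarrow> (\<lambda>n. ball_bump y \<rho> n x) \<longlonglongrightarrow> 1"
proof -
  assume "x \<in> ball y \<rho>"
  then have "(norm (x - y))\<^sup>2 < \<rho>\<^sup>2"
    by (intro power_strict_mono) (auto simp: dist_norm norm_minus_commute)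
  then show ?thesis
    unfolding ball_bump_def by (intro flat_0_tendsto_1) simp
qed

text \<open>Continuous almost everywhere approximants are truncated at height \<open>T\<close>,
  replaced on the ball by uniformly close polynomials, and multiplied by \<open>ball_bump\<close>
  for smooth compact support. The bound \<open>T + 1\<close> provides the domination used
  later.\<close>

lemma test_function_approximation:
  fixes f :: "real^3 \<Rightarrow> real"
  assumes f: "f \<in> borel_measurable borel" and T: "\<And>x. \<bar>f x\<bar> \<le> T" and \<rho>: "0 \<le> \<rho>"
    and out: "\<And>x. x \<notin> ball y \<rho> \<Longrightarrow> f x = 0"
  obtains \<phi> where "\<And>n. test_function (\<phi> n)" "\<And>n x. x \<notin> ball y \<rho> \<Longrightarrow> \<phi> n x = 0"
    "\<And>n x. \<bar>\<phi> n x\<bar> \<le> T + 1" "AE x in lborel. (\<lambda>n. \<phi> n x) \<longlonglongrightarrow> f x"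
proof -
  obtain g where g: "\<And>n. continuous_on UNIV (g n)" "AE x in lborel. (\<lambda>n. g n x) \<longlonglongrightarrow> f x"
    using AE_lborel_limit_of_continuous[OF f] by blast
  define h where "h n x = max (-T) (min T (g n x))" for n x
  have h: "continuous_on (cball y \<rho>) (h n)" for n
    unfolding h_def by (intro continuous_intros continuous_on_subset[OF g(1)]) auto
  have "0 \<le> T" using T[of 0] by linarith
  then have hT: "\<bar>h n x\<bar> \<le> T" for n x by (auto simp: h_def)
  have "\<exists>p. real_polynomial_function p \<and> (\<forall>x\<in>cball y \<rho>. \<bar>h n x - p x\<bar> < inverse (real (Suc n)))" for n
    using Stone_Weierstrass_real_polynomial_function[OF compact_cball h, of "inverse (real (Suc n))"]
    by (metis inverse_positive_iff_positive of_nat_0_less_iff zero_less_Suc)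
  then obtain p where p: "\<And>n. real_polynomial_function (p n)"
    "\<And>n x. x \<in> cball y \<rho> \<Longrightarrow> \<bar>h n x - p n x\<bar> < inverse (real (Suc n))" by metis
  define \<phi> where "\<phi> n x = p n x * ball_bump y \<rho> n x" for n x
  have zero: "\<phi> n x = 0" if "x \<notin> ball y \<rho>" for n x
    using ball_bump_outside[OF \<rho> that] by (simp add: \<phi>_def)
  show ?thesis
  proof (rule that[of \<phi>])
    show "test_function (\<phi> n)" for n
      by (rule test_functionI[OF _ bounded_ball zero])
         (unfold \<phi>_def[abs_def], rule Ck_mult[OF Ck_polynomial[OF p(1)] Ck_ball_bump])
    show "\<And>n x. x \<notin> ball y \<rho> \<Longrightarrow> \<phi> n x = 0" by (rule zero)
    show "\<bar>\<phi> n x\<bar> \<le> T + 1" for n x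
    proof (cases "x \<in> ball y \<rho>")
      case True
      have "inverse (real (Suc n)) \<le> 1" by (simp add: inverse_le_1_iff)
      then have "\<bar>p n x\<bar> \<le> T + 1" using p(2)[of x n] hT[of n x] True by auto
      then have "\<bar>p n x\<bar> * \<bar>ball_bump y \<rho> n x\<bar> \<le> (T + 1) * 1"
        using ball_bump_bounds[of y \<rho> n x] \<open>0 \<le> T\<close> by (intro mult_mono) auto
      then show ?thesis by (simp add: \<phi>_def abs_mult)
    qed (use zero \<open>0 \<le> T\<close> in auto)
    show "AE x in lborel. (\<lambda>n. \<phi> n x) \<longlonglongrightarrow> f x"
    proof (rule AE_mp[OF g(2) AE_I2], intro impI)
      fix x assume lim: "(\<lambda>n. g n x) \<longlonglongrightarrow> f x"
      show "(\<lambda>n. \<phi> n x) \<longlonglongrightarrow> f x"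
      proof (cases "x \<in> ball y \<rho>")
        case True
        have "(\<lambda>n. h n x) \<longlonglongrightarrow> max (-T) (min T (f x))"
          unfolding h_def by (intro tendsto_intros lim)
        moreover have "max (-T) (min T (f x)) = f x" using T[of x] by auto
        moreover have "(\<lambda>n. h n x - p n x) \<longlonglongrightarrow> 0"
          by (rule Lim_null_comparison[OF _ LIMSEQ_inverse_real_of_nat])
             (use p(2)[of x] True in \<open>auto intro!: always_eventually less_imp_le\<close>)
        ultimately have "(\<lambda>n. h n x - (h n x - p n x)) \<longlonglongrightarrow> f x - 0"
          by (intro tendsto_diff) auto
        then have "(\<lambda>n. \<phi> n x) \<longlonglongrightarrow> f x * 1"
          unfolding \<phi>_def by (intro tendsto_mult ball_bump_tendsto[OF True]) simp
        then show ?thesis by simp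
      qed (simp add: zero out)
    qed
  qed
qed

lemma integrable_ball_indicator: "integrable lborel (\<lambda>x::real^3. indicator (ball y \<rho>) x * (c::real))"
  using emeasure_lborel_ball_finite[of y \<rho>] by (intro integrable_mult_left) simp

lemma square_integrable_ball: "square_integrable (\<lambda>x::real^3. indicator (ball y \<rho>) x * (c::real))"
  unfolding square_integrable_def
proof
  have "(\<lambda>x. (norm (indicator (ball y \<rho>) x * c))\<^sup>2) = (\<lambda>x. indicator (ball y \<rho>) x * c\<^sup>2)"
    by (auto simp: indicator_def)
  then show "integrable lborel (\<lambda>x. (norm (indicator (ball y \<rho>) x * c))\<^sup>2)"
    using integrable_ball_indicator by simp
  have [measurable]: "ball y \<rho> \<in> sets borel" by simp
  show "(\<lambda>x::real^3. indicator (ball y \<rho>) x * (c::real)) \<in> borel_measurable lborel" by measurable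
qed

text \<open>The extremal test function would be \<open>u\<close> itself on the ball. Its truncations
  are limits of admissible test functions, and the squared norm of a truncation is at most its
  pairing with \<open>u\<close>, hence at most \<open>K\<close> times its norm.\<close>

proposition L2_ball_bound_by_duality:
  fixes u :: "real^3 \<Rightarrow> real"
  assumes u: "square_integrable u" and K: "0 \<le> K" and \<rho>: "0 \<le> \<rho>"
    and dual: "\<And>\<phi>. test_function \<phi> \<Longrightarrow> (\<And>x. x \<notin> ball y \<rho> \<Longrightarrow> \<phi> x = 0) \<Longrightarrow>
      \<bar>LINT x|lborel. \<phi> x * u x\<bar> \<le> K * sqrt (LINT x|lborel. (\<phi> x)\<^sup>2)"
  shows "(LINT x|lborel. indicator (ball y \<rho>) x * (u x)\<^sup>2) \<le> K\<^sup>2"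
proof -
  note [measurable] = square_integrable_measurable[OF u]
  let ?B = "ball y \<rho>"
  have [measurable]: "?B \<in> sets borel" by simp
  have u2: "integrable lborel (\<lambda>x. (u x)\<^sup>2)" using u by (simp add: square_integrable_def)
  have u2B: "integrable lborel (\<lambda>x. indicator ?B x * (u x)\<^sup>2)"
    by (rule Bochner_Integration.integrable_bound[OF u2]) (auto simp: indicator_def)
  define f where "f T x = indicator ?B x * max (- real T) (min (real T) (u x))" for T x
  have [measurable]: "f T \<in> borel_measurable borel" for T unfolding f_def by measurable
  have main: "(LINT x|lborel. (f T x)\<^sup>2) \<le> K\<^sup>2" for T
  proof -
    have fT: "\<bar>f T x\<bar> \<le> real T" for x by (auto simp: f_def indicator_def)
    obtain \<phi> where \<phi>: "\<And>n. test_function (\<phi> n)" "\<And>n x. x \<notin> ?B \<Longrightarrow> \<phi> n x = 0"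
      "\<And>n x. \<bar>\<phi> n x\<bar> \<le> real T + 1" "AE x in lborel. (\<lambda>n. \<phi> n x) \<longlonglongrightarrow> f T x"
      using test_function_approximation[of "f T" "real T" \<rho> y, OF _ fT \<rho>] by (auto simp: f_def)
    note [measurable] = test_function_measurable[OF \<phi>(1)]
    have "(\<lambda>n. LINT x|lborel. \<phi> n x * u x) \<longlonglongrightarrow> (LINT x|lborel. f T x * u x)"
    proof (rule integral_dominated_convergence)
      have "integrable lborel (\<lambda>x. (indicator ?B x * (real T + 1)) * u x)"
        by (rule square_integrable_mult[OF square_integrable_ball u])
      then show "integrable lborel (\<lambda>x. \<bar>(indicator ?B x * (real T + 1)) * u x\<bar>)" by simp
      show "AE x in lborel. norm (\<phi> n x * u x) \<le> \<bar>(indicator ?B x * (real T + 1)) * u x\<bar>" for n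
        using \<phi>(2,3)[where n=n] by (intro AE_I2) (auto simp: abs_mult indicator_def intro!: mult_right_mono)
      show "AE x in lborel. (\<lambda>n. \<phi> n x * u x) \<longlonglongrightarrow> f T x * u x"
        using \<phi>(4) by eventually_elim (intro tendsto_intros)
    qed measurable
    then have l1: "(\<lambda>n. \<bar>LINT x|lborel. \<phi> n x * u x\<bar>) \<longlonglongrightarrow> \<bar>LINT x|lborel. f T x * u x\<bar>"
      by (rule tendsto_rabs)
    have "(\<lambda>n. LINT x|lborel. (\<phi> n x)\<^sup>2) \<longlonglongrightarrow> (LINT x|lborel. (f T x)\<^sup>2)"
    proof (rule integral_dominated_convergence)
      show "integrable lborel (\<lambda>x. indicator ?B x * (real T + 1)\<^sup>2)" by (rule integrable_ball_indicator)
      have "(\<phi> n x)\<^sup>2 \<le> (real T + 1)\<^sup>2" for n x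
        using \<phi>(3)[of n x] by (simp add: abs_le_square_iff[symmetric])
      then show "AE x in lborel. norm ((\<phi> n x)\<^sup>2) \<le> indicator ?B x * (real T + 1)\<^sup>2" for n
        using \<phi>(2)[where n=n] by (intro AE_I2) (auto simp: indicator_def)
      show "AE x in lborel. (\<lambda>n. (\<phi> n x)\<^sup>2) \<longlonglongrightarrow> (f T x)\<^sup>2"
        using \<phi>(4) by eventually_elim (intro tendsto_intros)
    qed measurable
    then have l2: "(\<lambda>n. K * sqrt (LINT x|lborel. (\<phi> n x)\<^sup>2)) \<longlonglongrightarrow> K * sqrt (LINT x|lborel. (f T x)\<^sup>2)"
      by (intro tendsto_intros)
    have 1: "\<bar>LINT x|lborel. f T x * u x\<bar> \<le> K * sqrt (LINT x|lborel. (f T x)\<^sup>2)"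
      by (rule LIMSEQ_le[OF l1 l2]) (use dual[OF \<phi>(1,2)] in auto)
    \<comment> \<open>The truncation \<open>m\<close> has the sign of \<open>u x\<close> and no
      larger modulus; all three inequalities follow.\<close>
    have sq: "(f T x)\<^sup>2 \<le> indicator ?B x * (u x)\<^sup>2" and mul: "(f T x)\<^sup>2 \<le> f T x * u x"
      and sgn: "f T x * u x \<le> indicator ?B x * (u x)\<^sup>2" for x
    proof -
      define m where "m = max (- real T) (min (real T) (u x))"
      have "0 \<le> m * (u x - m)" "0 \<le> u x * (u x - m)"
        by (auto simp: zero_le_mult_iff m_def max_def min_def)
      then have "m\<^sup>2 \<le> m * u x \<and> m * u x \<le> (u x)\<^sup>2"
        by (simp add: power2_eq_square algebra_simps)
      then show "(f T x)\<^sup>2 \<le> indicator ?B x * (u x)\<^sup>2" "(f T x)\<^sup>2 \<le> f T x * u x"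
        "f T x * u x \<le> indicator ?B x * (u x)\<^sup>2"
        unfolding f_def m_def[symmetric] by (auto simp: indicator_def)
    qed
    have i1: "integrable lborel (\<lambda>x. (f T x)\<^sup>2)"
      by (rule Bochner_Integration.integrable_bound[OF u2B]) (use sq in auto)
    have i2: "integrable lborel (\<lambda>x. f T x * u x)"
    proof (rule Bochner_Integration.integrable_bound[OF u2B])
      show "AE x in lborel. norm (f T x * u x) \<le> norm (indicator ?B x * (u x)\<^sup>2)"
      proof (intro AE_I2)
        fix x
        have "0 \<le> f T x * u x" using mul[of x] zero_le_power2[of "f T x"] by linarith
        then show "norm (f T x * u x) \<le> norm (indicator ?B x * (u x)\<^sup>2)"
          using sgn[of x] by (simp only: real_norm_def abs_of_nonneg)
      qed
    qed measurable
    have "(LINT x|lborel. (f T x)\<^sup>2) \<le> (LINT x|lborel. f T x * u x)"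
      by (rule integral_mono[OF i1 i2]) (rule mul)
    with 1 have "(LINT x|lborel. (f T x)\<^sup>2) \<le> K * sqrt (LINT x|lborel. (f T x)\<^sup>2)" by linarith
    moreover define s where "s = sqrt (LINT x|lborel. (f T x)\<^sup>2)"
    have "0 \<le> s" "s * s = (LINT x|lborel. (f T x)\<^sup>2)" by (auto simp: s_def)
    ultimately have "s * s \<le> K * s" by (simp add: s_def)
    then have "s \<le> K" using \<open>0 \<le> s\<close> K by (cases "s = 0") auto
    then have "s * s \<le> K * K" using \<open>0 \<le> s\<close> by (intro mult_mono) auto
    then show ?thesis using \<open>s * s = _\<close> by (simp add: power2_eq_square)
  qed
  have "(\<lambda>T. LINT x|lborel. (f T x)\<^sup>2) \<longlonglongrightarrow> (LINT x|lborel. indicator ?B x * (u x)\<^sup>2)"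
  proof (rule integral_dominated_convergence[OF _ _ u2])
    show "AE x in lborel. (\<lambda>T. (f T x)\<^sup>2) \<longlonglongrightarrow> indicator ?B x * (u x)\<^sup>2"
    proof (intro AE_I2 tendsto_eventually)
      fix x
      obtain T0 :: nat where T0: "\<bar>u x\<bar> \<le> real T0" using real_arch_simple by blast
      show "\<forall>\<^sub>F T in sequentially. (f T x)\<^sup>2 = indicator ?B x * (u x)\<^sup>2"
        using eventually_ge_at_top[of T0]
      proof eventually_elim
        case (elim T)
        then have "\<bar>u x\<bar> \<le> real T" using T0 by linarith
        then have "max (- real T) (min (real T) (u x)) = u x" by auto
        then show ?case by (simp add: f_def indicator_def)
      qed
    qed
    have "(max (- real T) (min (real T) (u x)))\<^sup>2 \<le> (u x)\<^sup>2" for T x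
      by (simp add: abs_le_square_iff[symmetric])
    then show "AE x in lborel. norm ((f T x)\<^sup>2) \<le> (u x)\<^sup>2" for T
      by (auto simp: f_def indicator_def)
  qed measurable
  then show ?thesis by (rule LIMSEQ_le_const2) (use main in auto)
qed

section \<open>Dilations of test functions\<close>

lemma integral_rescale:
  fixes h :: "real^3 \<Rightarrow> real"
  assumes [measurable]: "h \<in> borel_measurable borel" and s: "0 < s"
  shows "(LINT z|lborel. h (s *\<^sub>R (z - y))) = (LINT x|lborel. h x) / s ^ 3"
proof -
  let ?T = "\<lambda>x::real^3. - (s *\<^sub>R y) + s *\<^sub>R x"
  have "(LINT x|lborel. h x) = (LINT x|density (distr lborel borel ?T) (\<lambda>_. ennreal (s ^ 3)). h x)"
    using lborel_affine[of s "- (s *\<^sub>R y)"] s by simp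
  also have "\<dots> = (LINT x|lborel. s ^ 3 * h (?T x))"
    using s by (simp add: integral_density integral_distr)
  also have "\<dots> = s ^ 3 * (LINT z|lborel. h (s *\<^sub>R (z - y)))"
    by (simp add: algebra_simps)
  finally show ?thesis using s by simp
qed

text \<open>Dominated convergence of difference quotients: on the convex set \<open>S\<close> the
  mean value inequality bounds them by the majorant \<open>w\<close> of the derivatives.\<close>

lemma has_real_derivative_integral:
  fixes f :: "real \<Rightarrow> 'a \<Rightarrow> real"
  assumes int: "\<And>s. s \<in> S \<Longrightarrow> integrable M (f s)" and S: "open S" "convex S"
    and der: "\<And>s z. s \<in> S \<Longrightarrow> ((\<lambda>s. f s z) has_real_derivative f' s z) (at s)"
    and bound: "\<And>s z. s \<in> S \<Longrightarrow> \<bar>f' s z\<bar> \<le> w z" and w: "integrable M w"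
    and [measurable]: "\<And>s. s \<in> S \<Longrightarrow> f' s \<in> borel_measurable M"
    and s0: "s0 \<in> S"
  shows "((\<lambda>s. LINT z|M. f s z) has_real_derivative (LINT z|M. f' s0 z)) (at s0)"
proof -
  have "((\<lambda>s. ((LINT z|M. f s z) - (LINT z|M. f s0 z)) / (s - s0)) \<longlongrightarrow> (LINT z|M. f' s0 z)) (at s0 within S)"
    unfolding tendsto_at_iff_sequentially comp_def
  proof (intro allI impI)
    fix X assume X: "\<forall>n. X n \<in> S - {s0}" and lim: "X \<longlonglongrightarrow> s0"
    have [measurable]: "f (X n) \<in> borel_measurable M" "f s0 \<in> borel_measurable M" for n
      using int X s0 by blast+
    have l: "(\<lambda>n. LINT z|M. (f (X n) z - f s0 z) / (X n - s0)) \<longlonglongrightarrow> (LINT z|M. f' s0 z)"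
    proof (rule integral_dominated_convergence[OF _ _ w])
      show "AE z in M. (\<lambda>n. (f (X n) z - f s0 z) / (X n - s0)) \<longlonglongrightarrow> f' s0 z"
      proof (intro AE_I2)
        fix z
        have "((\<lambda>s. (f s z - f s0 z) / (s - s0)) \<longlongrightarrow> f' s0 z) (at s0)"
          using der[OF s0, of z] by (simp add: has_field_derivative_iff)
        then show "(\<lambda>n. (f (X n) z - f s0 z) / (X n - s0)) \<longlonglongrightarrow> f' s0 z"
          using X lim unfolding tendsto_at_iff_sequentially comp_def by auto
      qed
      show "AE z in M. norm ((f (X n) z - f s0 z) / (X n - s0)) \<le> w z" for n
      proof (intro AE_I2)
        fix z
        have "norm (f (X n) z - f s0 z) \<le> w z * norm (X n - s0)"
          by (rule field_differentiable_bound[OF S(2), of _ "\<lambda>s. f' s z"])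
             (use der bound X s0 in \<open>auto intro: DERIV_subset\<close>)
        then show "norm ((f (X n) z - f s0 z) / (X n - s0)) \<le> w z"
          using X by (simp add: divide_le_eq abs_divide)
      qed
    qed (use s0 in measurable)
    have "(LINT z|M. (f (X n) z - f s0 z) / (X n - s0))
        = ((LINT z|M. f (X n) z) - (LINT z|M. f s0 z)) / (X n - s0)" for n
    proof -
      have "(LINT z|M. f (X n) z - f s0 z) = (LINT z|M. f (X n) z) - (LINT z|M. f s0 z)"
        using int X s0 by (intro Bochner_Integration.integral_diff) auto
      then show ?thesis by simp
    qed
    with l show "(\<lambda>n. ((LINT z|M. f (X n) z) - (LINT z|M. f s0 z)) / (X n - s0)) \<longlonglongrightarrow> (LINT z|M. f' s0 z)"
      by (simp only:)
  qed
  then have "((\<lambda>s. LINT z|M. f s z) has_real_derivative (LINT z|M. f' s0 z)) (at s0 within S)"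
    by (simp only: has_field_derivative_iff)
  then show ?thesis by (simp only: at_within_open[OF s0 S(1)])
qed

lemma test_function_rescale:
  assumes \<phi>: "test_function \<phi>" and s: "s \<noteq> 0"
  shows "test_function (\<lambda>z. \<phi> (s *\<^sub>R (z - y)))"
proof -
  obtain b where b: "\<And>x. \<phi> x \<noteq> 0 \<Longrightarrow> norm x \<le> b"
    using test_function_bounded_support[OF \<phi>] by (auto simp: bounded_iff)
  show ?thesis
  proof (rule test_functionI[OF Ck_rescale[OF test_function_Ck[OF \<phi>]] bounded_cball])
    fix x assume x: "x \<notin> cball y (b / \<bar>s\<bar>)"
    show "\<phi> (s *\<^sub>R (x - y)) = 0"
    proof (rule ccontr)
      assume "\<phi> (s *\<^sub>R (x - y)) \<noteq> 0"
      from b[OF this] have "\<bar>s\<bar> * norm (x - y) \<le> b" by simp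
      then have "norm (x - y) \<le> b / \<bar>s\<bar>" using s by (simp add: pos_le_divide_eq mult.commute)
      then show False using x by (simp add: dist_norm norm_minus_commute)
    qed
  qed
qed

lemma integral_mult_le:
  fixes f g :: "real^3 \<Rightarrow> real"
  assumes "square_integrable f" "square_integrable g"
  shows "\<bar>LINT x|lborel. f x * g x\<bar> \<le> sqrt (LINT x|lborel. (f x)\<^sup>2) * sqrt (LINT x|lborel. (g x)\<^sup>2)"
  using square_integrable_Cauchy_Schwarz[OF assms]
  by (simp add: real_sqrt_mult[symmetric] real_le_rsqrt)

text \<open>The dilation \<open>s \<mapsto> \<integral> s\<^sup>3 \<phi>(s (z - y)) u(z) dz\<close> interpolates between an average over the small
  and over the large ball, and its \<open>s\<close>-derivative is a divergence.\<close>

lemma dilation_estimate: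
  assumes \<phi>: "test_function \<phi>" and out: "\<And>x. x \<notin> ball 0 \<rho> \<Longrightarrow> \<phi> x = 0"
    and u: "square_integrable u" and g: "is_weak_gradient u g" and \<rho>: "0 < \<rho>" "\<rho> \<le> R"
  shows "\<bar>LINT z|lborel. \<phi> (z - y) * u z\<bar> \<le> sqrt (LINT x|lborel. (\<phi> x)\<^sup>2) *
    (sqrt ((\<rho> / R) ^ 3) * sqrt (LINT z|lborel. indicator (ball y R) z * (u z)\<^sup>2)
      + 2 * \<rho> * sqrt (LINT z|lborel. indicator (ball y R) z * (norm (g z))\<^sup>2))"
proof -
  define N U G where "N = sqrt (LINT x|lborel. (\<phi> x)\<^sup>2)"
    and "U = sqrt (LINT z|lborel. indicator (ball y R) z * (u z)\<^sup>2)"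
    and "G = sqrt (LINT z|lborel. indicator (ball y R) z * (norm (g z))\<^sup>2)"
  have R: "0 < R" using \<rho> by linarith
  define \<sigma> where "\<sigma> = \<rho> / R"
  have \<sigma>: "0 < \<sigma>" "\<sigma> \<le> 1" using \<rho> R by (auto simp: \<sigma>_def)
  have N0: "0 \<le> N" "0 \<le> G" by (auto simp: N_def G_def)
  have sg: "square_integrable g" using g by (simp add: is_weak_gradient_def)
  note [measurable] = square_integrable_measurable[OF u] square_integrable_measurable[OF sg]
    test_function_measurable[OF \<phi>]
  have [measurable]: "ball y c \<in> sets borel" for c by simp
  \<comment> \<open>The components of the field \<phi>(x) x; its divergence \<psi> will be the
    generator of the dilation.\<close>
  define \<theta> where "\<theta> i x = x $ i * \<phi> x" for i x
  have \<theta>: "test_function (\<theta> i)" for i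
    unfolding \<theta>_def[abs_def] by (rule test_function_mult[OF Ck_nth \<phi>])
  define \<psi> where "\<psi> x = (\<Sum>i\<in>UNIV. partial_deriv i (\<theta> i) x)" for x
  have \<psi>_eq: "\<psi> x = 3 * \<phi> x + frechet_derivative \<phi> (at x) x" for x
  proof -
    have d: "((\<lambda>x. x $ i) has_derivative (\<lambda>h. h $ i)) (at x)" for i and x :: "real^3"
      by (rule bounded_linear_imp_has_derivative[OF bounded_linear_vec_nth])
    have "partial_deriv i (\<lambda>x. x $ i) x = 1" "(\<lambda>x. x $ i) differentiable (at x)" for i and x :: "real^3"
      using d by (auto simp: partialI[OF d] differentiable_def)
    then have "partial_deriv i (\<theta> i) x = x $ i * partial_deriv i \<phi> x + \<phi> x" for i
      unfolding \<theta>_def[abs_def] by (subst partial_mult) (auto simp: test_function_differentiable[OF \<phi>])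
    then show ?thesis
      unfolding \<psi>_def frechet_derivative_eq_sum_partial[OF test_function_differentiable[OF \<phi>]]
      by (simp add: sum.distrib)
  qed
  have \<psi>: "test_function \<psi>"
  proof (rule test_functionI[OF _ bounded_cball[of 0 \<rho>]])
    show "Ck k \<psi>" for k
      unfolding \<psi>_def[abs_def] by (intro Ck_sum test_function_Ck[OF test_function_partial[OF \<theta>]]) auto
    fix x :: "real^3" assume x: "x \<notin> cball 0 \<rho>"
    have "{x. \<theta> i x \<noteq> 0} \<subseteq> cball 0 \<rho>" for i
      using out by (force simp: \<theta>_def)
    then have "closure {x. \<theta> i x \<noteq> 0} \<subseteq> cball 0 \<rho>" for i
      by (rule closure_minimal) simp
    then have "x \<notin> closure {x. \<theta> i x \<noteq> 0}" for i using x by blast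
    then show "\<psi> x = 0"
      unfolding \<psi>_def using partial_zero_outside by (intro sum.neutral) blast
  qed
  note [measurable] = test_function_measurable[OF \<psi>]
  obtain m where m: "\<And>x. \<bar>\<psi> x\<bar> \<le> m" "0 \<le> m" using test_function_bounded[OF \<psi>] by blast
  obtain b where b: "\<And>x. \<psi> x \<noteq> 0 \<Longrightarrow> norm x < b" "0 < b"
    using test_function_bounded_support[OF \<psi>] unfolding bounded_pos_less by auto
  \<comment> \<open>An open interval around [\<sigma>, 1], so derivatives exist at both ends, and
    bounded away from 0, so all dilated supports fit in one ball.\<close>
  define S where "S = {\<sigma>/2<..<2}"
  have S_pos: "s \<in> S \<Longrightarrow> 0 < s" for s using \<sigma> by (auto simp: S_def)
  have sq\<phi>: "square_integrable (\<lambda>z. \<phi> (s *\<^sub>R (z - y)))" if "0 < s" for s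
    by (rule test_function_square_integrable[OF test_function_rescale[OF \<phi>]]) (use that in simp)
  have norm\<phi>: "sqrt (LINT z|lborel. (\<phi> (s *\<^sub>R (z - y)))\<^sup>2) = N / sqrt (s ^ 3)" if "0 < s" for s
    using integral_rescale[of "\<lambda>x. (\<phi> x)\<^sup>2" s y] that by (simp add: N_def real_sqrt_divide)
  \<comment> \<open>\<open>F 1\<close> is the integral to be bounded; at \<sigma> the support has
    been stretched from radius \<rho> to radius R.\<close>
  define F where "F s = (LINT z|lborel. s ^ 3 * \<phi> (s *\<^sub>R (z - y)) * u z)" for s
  define F' where "F' s = (LINT z|lborel. s\<^sup>2 * \<psi> (s *\<^sub>R (z - y)) * u z)" for s
  \<comment> \<open>The derivative of s^3 \<phi>(s(z - y)) is s^2 \<psi>(s(z - y)). On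
    \<open>S\<close> the dilated support of \<psi> stays within radius 2b/\<sigma> and s^2 is at
    most 4, which gives the majorant.\<close>
  have dF: "(F has_real_derivative F' s) (at s)" if s: "s \<in> S" for s
    unfolding F_def[abs_def] F'_def
  proof (rule has_real_derivative_integral[where S=S and w="\<lambda>z. 4 * m * (indicator (ball y (2 * b / \<sigma>)) z * \<bar>u z\<bar>)"])
    show "open S" "convex S" "s \<in> S" using s by (auto simp: S_def)
    show "integrable lborel (\<lambda>z. s ^ 3 * \<phi> (s *\<^sub>R (z - y)) * u z)" if "s \<in> S" for s
      using square_integrable_mult[OF sq\<phi>[OF S_pos[OF that]] u] by (simp add: mult.assoc)
    show "(\<lambda>z. s\<^sup>2 * \<psi> (s *\<^sub>R (z - y)) * u z) \<in> borel_measurable lborel" for s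
      by measurable
    have "square_integrable (indicator (ball y (2 * b / \<sigma>)) :: real^3 \<Rightarrow> real)"
    proof -
      have "(\<lambda>x. (norm (indicator (ball y c) x :: real))\<^sup>2) = (indicator (ball y c) :: real^3 \<Rightarrow> real)" for c
        by (auto simp: indicator_def fun_eq_iff)
      then show ?thesis
        using emeasure_lborel_ball_finite[of y] by (simp add: square_integrable_def)
    qed
    from square_integrable_mult[OF this u]
    have "integrable lborel (\<lambda>z. \<bar>indicator (ball y (2 * b / \<sigma>)) z * u z\<bar>)" by (rule integrable_abs)
    then show "integrable lborel (\<lambda>z. 4 * m * (indicator (ball y (2 * b / \<sigma>)) z * \<bar>u z\<bar>))"
      by (simp add: abs_mult)
    fix s z assume s: "s \<in> S"
    show "\<bar>s\<^sup>2 * \<psi> (s *\<^sub>R (z - y)) * u z\<bar> \<le> 4 * m * (indicator (ball y (2 * b / \<sigma>)) z * \<bar>u z\<bar>)"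
    proof (cases "\<psi> (s *\<^sub>R (z - y)) = 0")
      case True
      then show ?thesis using m(2) by simp
    next
      case False
      have "s * norm (z - y) < b" using b(1)[OF False] S_pos[OF s] by simp
      moreover have "\<sigma> / 2 * norm (z - y) \<le> s * norm (z - y)"
        using s by (intro mult_right_mono) (auto simp: S_def)
      ultimately have "norm (z - y) < 2 * b / \<sigma>" using \<sigma> by (simp add: field_simps)
      then have z: "z \<in> ball y (2 * b / \<sigma>)" by (simp add: dist_norm norm_minus_commute)
      have "s\<^sup>2 \<le> 2\<^sup>2" using S_pos[OF s] s by (intro power_mono) (auto simp: S_def)
      then have "s\<^sup>2 * \<bar>\<psi> (s *\<^sub>R (z - y))\<bar> * \<bar>u z\<bar> \<le> 4 * m * \<bar>u z\<bar>"
        using m by (intro mult_mono mult_right_mono) auto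
      then show ?thesis using z by (simp add: abs_mult)
    qed
    have ring: "(3 * s\<^sup>2 * a + s ^ 3 * d) * w = s\<^sup>2 * (3 * a + s *\<^sub>R d) * w" for a d w :: real
      by (simp add: algebra_simps power2_eq_square power3_eq_cube)
    have "((\<lambda>s. \<phi> (s *\<^sub>R (z - y))) has_derivative (\<lambda>h. frechet_derivative \<phi> (at (s *\<^sub>R (z - y))) (h *\<^sub>R (z - y)))) (at s)"
      by (rule has_derivative_compose[OF _ differentiable_has_derivative[OF test_function_differentiable[OF \<phi>]]])
         (auto intro!: derivative_eq_intros)
    then have "((\<lambda>s. \<phi> (s *\<^sub>R (z - y))) has_real_derivative frechet_derivative \<phi> (at (s *\<^sub>R (z - y))) (z - y)) (at s)"
      unfolding has_field_derivative_def
      by (simp add: linear_scale[OF linear_frechet_derivative[OF test_function_differentiable[OF \<phi>]]] mult_commute_abs)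
    then have "((\<lambda>s. s ^ 3 * \<phi> (s *\<^sub>R (z - y)) * u z) has_real_derivative
        (3 * s\<^sup>2 * \<phi> (s *\<^sub>R (z - y)) + s ^ 3 * frechet_derivative \<phi> (at (s *\<^sub>R (z - y))) (z - y)) * u z) (at s)"
      by (auto intro!: derivative_eq_intros simp: algebra_simps)
    also have "(3 * s\<^sup>2 * \<phi> (s *\<^sub>R (z - y)) + s ^ 3 * frechet_derivative \<phi> (at (s *\<^sub>R (z - y))) (z - y)) * u z
        = s\<^sup>2 * \<psi> (s *\<^sub>R (z - y)) * u z"
      unfolding \<psi>_eq linear_scale[OF linear_frechet_derivative[OF test_function_differentiable[OF \<phi>]]] by (rule ring)
    finally show "((\<lambda>s. s ^ 3 * \<phi> (s *\<^sub>R (z - y)) * u z) has_real_derivative s\<^sup>2 * \<psi> (s *\<^sub>R (z - y)) * u z) (at s)" .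
  qed
  \<comment> \<open>The integrand's kernel is s times the divergence of the dilated field, so the
    weak gradient takes over. The field is at most \<rho> times the dilated \<phi>, whose L2 norm is
    N s^(-3/2); the prefactor s leaves s^(-1/2).\<close>
  have F'_le: "\<bar>F' s\<bar> \<le> \<rho> * G * N / sqrt s" if s: "\<sigma> \<le> s" for s
  proof -
    have s0: "0 < s" using s \<sigma> by linarith
    define \<Theta> where "\<Theta> i z = \<theta> i (s *\<^sub>R (z - y))" for i z
    have \<Theta>: "test_function (\<Theta> i)" for i
      unfolding \<Theta>_def[abs_def] by (rule test_function_rescale[OF \<theta>]) (use s0 in simp)
    have p\<Theta>: "partial_deriv i (\<Theta> i) z = s * partial_deriv i (\<theta> i) (s *\<^sub>R (z - y))" for i z
      unfolding \<Theta>_def[abs_def] by (subst partial_rescale) (auto simp: test_function_differentiable[OF \<theta>])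
    have gi: "integrable lborel (\<lambda>z. g z $ i * \<Theta> i z)" for i
      by (rule square_integrable_mult[OF square_integrable_nth[OF sg] test_function_square_integrable[OF \<Theta>]])
    have "F' s = (LINT z|lborel. (\<Sum>i\<in>UNIV. s * (u z * partial_deriv i (\<Theta> i) z)))"
      unfolding F'_def \<psi>_def p\<Theta>
      by (rule Bochner_Integration.integral_cong)
         (simp_all add: sum_distrib_left sum_distrib_right power2_eq_square mult_ac)
    also have "\<dots> = (\<Sum>i\<in>UNIV. s * (LINT z|lborel. u z * partial_deriv i (\<Theta> i) z))"
      using square_integrable_mult[OF u test_function_partial_square_integrable[OF \<Theta>]]
      by (subst Bochner_Integration.integral_sum) auto
    also have "\<dots> = (\<Sum>i\<in>UNIV. - s * (LINT z|lborel. g z $ i * \<Theta> i z))"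
      using g \<Theta> by (simp add: is_weak_gradient_def)
    also have "\<dots> = - s * (LINT z|lborel. (\<Sum>i\<in>UNIV. g z $ i * \<Theta> i z))"
      using gi by (simp add: sum_distrib_left sum_negf)
    also have "(LINT z|lborel. (\<Sum>i\<in>UNIV. g z $ i * \<Theta> i z)) = (LINT z|lborel. \<phi> (s *\<^sub>R (z - y)) * (g z \<bullet> (s *\<^sub>R (z - y))))"
      by (rule Bochner_Integration.integral_cong)
         (simp_all add: \<Theta>_def \<theta>_def inner_vec_def sum_distrib_left mult_ac)
    finally have F'_eq: "F' s = - s * (LINT z|lborel. \<phi> (s *\<^sub>R (z - y)) * (g z \<bullet> (s *\<^sub>R (z - y))))" .
    have sub: "ball y (\<rho> / s) \<subseteq> ball y R"
    proof (rule subset_ball)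
      have "\<rho> / s \<le> \<rho> / \<sigma>" using s \<sigma> \<rho> by (intro divide_left_mono) auto
      then show "\<rho> / s \<le> R" using \<rho> R by (simp add: \<sigma>_def)
    qed
    have "z \<in> ball y (\<rho> / s) \<and> s * norm (z - y) < \<rho>" if "\<phi> (s *\<^sub>R (z - y)) \<noteq> 0" for z
    proof -
      have "s *\<^sub>R (z - y) \<in> ball 0 \<rho>" using that out by blast
      then have "s * norm (z - y) < \<rho>" using s0 by simp
      then show ?thesis using s0 by (simp add: dist_norm norm_minus_commute field_simps)
    qed
    from this[THEN conjunct1, THEN subsetD[OF sub]] this[THEN conjunct2]
    have supp: "z \<in> ball y R" "norm (s *\<^sub>R (z - y)) \<le> \<rho>" if "\<phi> (s *\<^sub>R (z - y)) \<noteq> 0" for z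
      using that s0 by (blast, fastforce)
    define gB where "gB z = indicator (ball y R) z * norm (g z)" for z
    have [measurable]: "gB \<in> borel_measurable borel" unfolding gB_def by measurable
    have gB2: "(gB z)\<^sup>2 = indicator (ball y R) z * (norm (g z))\<^sup>2" for z
      by (auto simp: gB_def indicator_def)
    have sgB: "square_integrable gB"
      unfolding square_integrable_def
    proof
      have "integrable lborel (\<lambda>z. (norm (g z))\<^sup>2)" using sg by (simp add: square_integrable_def)
      then show "integrable lborel (\<lambda>z. (norm (gB z))\<^sup>2)"
        by (rule Bochner_Integration.integrable_bound) (auto simp: gB_def indicator_def)
    qed measurable
    have ph: "square_integrable (\<lambda>z. \<bar>\<phi> (s *\<^sub>R (z - y))\<bar>)"
    proof -
      have "(\<lambda>z. \<bar>\<phi> (s *\<^sub>R (z - y))\<bar>) \<in> borel_measurable lborel" by measurable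
      then show ?thesis using sq\<phi>[OF s0] by (simp add: square_integrable_def)
    qed
    have int: "integrable lborel (\<lambda>z. \<rho> * (\<bar>\<phi> (s *\<^sub>R (z - y))\<bar> * gB z))"
      using square_integrable_mult[OF ph sgB] by simp
    have pw: "\<bar>\<phi> (s *\<^sub>R (z - y)) * (g z \<bullet> (s *\<^sub>R (z - y)))\<bar> \<le> \<rho> * (\<bar>\<phi> (s *\<^sub>R (z - y))\<bar> * gB z)" for z
    proof (cases "\<phi> (s *\<^sub>R (z - y)) = 0")
      case False
      have "\<bar>g z \<bullet> (s *\<^sub>R (z - y))\<bar> \<le> norm (g z) * norm (s *\<^sub>R (z - y))"
        by (rule Cauchy_Schwarz_ineq2)
      also have "\<dots> \<le> norm (g z) * \<rho>" by (intro mult_left_mono supp[OF False]) simp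
      finally have "\<bar>\<phi> (s *\<^sub>R (z - y))\<bar> * \<bar>g z \<bullet> (s *\<^sub>R (z - y))\<bar> \<le> \<bar>\<phi> (s *\<^sub>R (z - y))\<bar> * (norm (g z) * \<rho>)"
        by (intro mult_left_mono) auto
      moreover have "gB z = norm (g z)" using supp(1)[OF False] by (simp add: gB_def)
      ultimately show ?thesis by (simp add: abs_mult mult_ac)
    qed simp
    have "\<bar>LINT z|lborel. \<phi> (s *\<^sub>R (z - y)) * (g z \<bullet> (s *\<^sub>R (z - y)))\<bar>
        \<le> (LINT z|lborel. \<rho> * (\<bar>\<phi> (s *\<^sub>R (z - y))\<bar> * gB z))"
    proof -
      have "integrable lborel (\<lambda>z. \<phi> (s *\<^sub>R (z - y)) * (g z \<bullet> (s *\<^sub>R (z - y))))"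
      proof (rule Bochner_Integration.integrable_bound[OF int])
        show "AE z in lborel. norm (\<phi> (s *\<^sub>R (z - y)) * (g z \<bullet> (s *\<^sub>R (z - y))))
            \<le> norm (\<rho> * (\<bar>\<phi> (s *\<^sub>R (z - y))\<bar> * gB z))"
          using order_trans[OF pw abs_ge_self] by (intro AE_I2) (simp only: real_norm_def)
      qed measurable
      from Bochner_Integration.integral_norm_bound_integral[OF this int] pw show ?thesis by (simp only: real_norm_def)
    qed
    also have "\<dots> \<le> \<rho> * (N / sqrt (s ^ 3) * G)"
    proof -
      have "(LINT z|lborel. \<bar>\<phi> (s *\<^sub>R (z - y))\<bar> * gB z) \<le> N / sqrt (s ^ 3) * G"
        using order_trans[OF abs_ge_self integral_mult_le[OF ph sgB]]
        by (simp only: power2_abs norm\<phi>[OF s0] gB2 G_def)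
      from mult_left_mono[OF this, of \<rho>] show ?thesis using \<rho> by simp
    qed
    finally have "s * \<bar>LINT z|lborel. \<phi> (s *\<^sub>R (z - y)) * (g z \<bullet> (s *\<^sub>R (z - y)))\<bar>
        \<le> s * (\<rho> * (N / sqrt (s ^ 3) * G))"
      using s0 by (intro mult_left_mono) auto
    also have "sqrt (s ^ 3) = s * sqrt s"
      using s0 by (simp add: power3_eq_cube real_sqrt_mult)
    finally show ?thesis using s0 by (simp add: F'_eq abs_mult mult_ac)
  qed
  \<comment> \<open>\<open>F\<close> is compared with 2 \<rho> G N sqrt(s), a primitive of the bound
    on \<open>F'\<close>. It stays bounded as s tends to 0, which makes the gradient constant
    independent of R. The sign \<open>e\<close> covers both halves of the absolute value.\<close>
  have step: "e * F 1 - e * F \<sigma> \<le> 2 * \<rho> * G * N * (1 - sqrt \<sigma>)" if e: "e = 1 \<or> e = -1" for e :: real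
  proof -
    have "2 * \<rho> * G * N * sqrt \<sigma> - e * F \<sigma> \<le> 2 * \<rho> * G * N * sqrt 1 - e * F 1"
    proof (rule DERIV_nonneg_imp_nondecreasing[OF \<sigma>(2)])
      fix s assume s: "\<sigma> \<le> s" "s \<le> 1"
      then have "s \<in> S" "0 < s" using \<sigma> by (auto simp: S_def)
      have "((\<lambda>s. 2 * \<rho> * G * N * sqrt s - e * F s) has_real_derivative
          2 * \<rho> * G * N * (inverse (sqrt s) / 2) - e * F' s) (at s)"
        by (rule DERIV_diff[OF DERIV_cmult[OF DERIV_real_sqrt[OF \<open>0 < s\<close>]] DERIV_cmult[OF dF[OF \<open>s \<in> S\<close>]]])
      moreover have "0 \<le> 2 * \<rho> * G * N * (inverse (sqrt s) / 2) - e * F' s"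
      proof -
        have 1: "e * f \<le> \<bar>f\<bar>" for f :: real
          using e by (elim disjE) auto
        have 2: "a / b = 2 * a * (inverse b / 2)" for a b :: real
          by (simp add: inverse_eq_divide)
        show ?thesis
          using F'_le[OF s(1)] 1[of "F' s"] 2[of "\<rho> * G * N" "sqrt s"] by (simp only: mult.assoc)
      qed
      ultimately show "\<exists>y. ((\<lambda>s. 2 * \<rho> * G * N * sqrt s - e * F s) has_real_derivative y) (at s) \<and> 0 \<le> y"
        by blast
    qed
    then show ?thesis by (simp add: algebra_simps)
  qed
  have "\<bar>F 1\<bar> \<le> \<bar>F \<sigma>\<bar> + 2 * \<rho> * G * N * (1 - sqrt \<sigma>)"
    using step[of 1] step[of "-1"] by linarith
  also have "\<dots> \<le> \<bar>F \<sigma>\<bar> + 2 * \<rho> * G * N"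
    using N0 \<rho> \<sigma> by (intro add_left_mono mult_left_le) auto
  also have "\<bar>F \<sigma>\<bar> \<le> sqrt (\<sigma> ^ 3) * N * U"
  proof -
    define uB where "uB z = indicator (ball y R) z * u z" for z
    have [measurable]: "uB \<in> borel_measurable borel" unfolding uB_def by measurable
    have uB2: "(uB z)\<^sup>2 = indicator (ball y R) z * (u z)\<^sup>2" for z
      by (auto simp: uB_def indicator_def)
    have suB: "square_integrable uB"
      unfolding square_integrable_def
    proof
      have "integrable lborel (\<lambda>z. (norm (u z))\<^sup>2)" using u by (simp add: square_integrable_def)
      then show "integrable lborel (\<lambda>z. (norm (uB z))\<^sup>2)"
        by (rule Bochner_Integration.integrable_bound) (auto simp: uB_def indicator_def)
    qed measurable
    have "\<phi> (\<sigma> *\<^sub>R (z - y)) * u z = \<phi> (\<sigma> *\<^sub>R (z - y)) * uB z" for z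
    proof (cases "\<phi> (\<sigma> *\<^sub>R (z - y)) = 0")
      case False
      then have "\<sigma> *\<^sub>R (z - y) \<in> ball 0 \<rho>" using out by blast
      then have "\<sigma> * norm (z - y) < \<rho>" using \<sigma> by simp
      then have "z \<in> ball y R" using \<rho> R by (simp add: \<sigma>_def dist_norm norm_minus_commute field_simps)
      then show ?thesis by (simp add: uB_def)
    qed simp
    then have "F \<sigma> = (LINT z|lborel. \<sigma> ^ 3 * (\<phi> (\<sigma> *\<^sub>R (z - y)) * uB z))"
      by (simp only: F_def mult.assoc)
    then have "F \<sigma> = \<sigma> ^ 3 * (LINT z|lborel. \<phi> (\<sigma> *\<^sub>R (z - y)) * uB z)" by simp
    then have "\<bar>F \<sigma>\<bar> = \<sigma> ^ 3 * \<bar>LINT z|lborel. \<phi> (\<sigma> *\<^sub>R (z - y)) * uB z\<bar>"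
      using \<sigma> by (simp add: abs_mult)
    also have "\<dots> \<le> \<sigma> ^ 3 * (N / sqrt (\<sigma> ^ 3) * U)"
      using integral_mult_le[OF sq\<phi>[OF \<sigma>(1)] suB] \<sigma>
      by (intro mult_left_mono) (simp_all only: norm\<phi>[OF \<sigma>(1)] uB2 U_def zero_le_power less_imp_le)
    also have "\<dots> = (\<sigma> ^ 3 / sqrt (\<sigma> ^ 3)) * N * U" by simp
    also have "\<sigma> ^ 3 / sqrt (\<sigma> ^ 3) = sqrt (\<sigma> ^ 3)"
      using \<sigma> by (intro real_div_sqrt) simp
    finally show ?thesis .
  qed
  finally have "\<bar>F 1\<bar> \<le> N * (sqrt (\<sigma> ^ 3) * U + 2 * \<rho> * G)"
    by (simp add: algebra_simps)
  then show ?thesis by (simp add: F_def N_def U_def G_def \<sigma>_def)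
qed

section \<open>Cutoffs and energies\<close>

lemma integrable_indicator_mult:
  fixes f :: "real^3 \<Rightarrow> real"
  assumes "integrable lborel f" "A \<in> sets borel"
  shows "integrable lborel (\<lambda>x. indicator A x * f x)"
  using integrable_mult_indicator[OF _ assms(1), of A] assms(2) by simp

text \<open>Duality converts \<open>dilation_estimate\<close> into an L2 bound, and the square of
  the two-term bound is split by (a + b)^2 \<le> 2 a^2 + 2 b^2.\<close>

proposition local_hardy:
  assumes u: "square_integrable u" and g: "is_weak_gradient u g" and \<rho>: "0 < \<rho>" "\<rho> \<le> R"
  shows "(LINT z|lborel. indicator (ball y \<rho>) z * (u z)\<^sup>2)
    \<le> 2 * (\<rho> / R) ^ 3 * (LINT z|lborel. indicator (ball y R) z * (u z)\<^sup>2)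
      + 8 * \<rho>\<^sup>2 * (LINT z|lborel. indicator (ball y R) z * (norm (g z))\<^sup>2)"
proof -
  define U G where "U = (LINT z|lborel. indicator (ball y R) z * (u z)\<^sup>2)"
    and "G = (LINT z|lborel. indicator (ball y R) z * (norm (g z))\<^sup>2)"
  define K where "K = sqrt ((\<rho> / R) ^ 3) * sqrt U + 2 * \<rho> * sqrt G"
  have U0: "0 \<le> U" "0 \<le> G" by (auto simp: U_def G_def)
  have R0: "0 \<le> (\<rho> / R) ^ 3" using \<rho> by simp
  have K0: "0 \<le> K" using \<rho> U0 R0 by (simp add: K_def)
  have "(LINT z|lborel. indicator (ball y \<rho>) z * (u z)\<^sup>2) \<le> K\<^sup>2"
  proof (rule L2_ball_bound_by_duality[OF u K0])
    fix \<phi> assume \<phi>: "test_function \<phi>" and out: "\<And>x. x \<notin> ball y \<rho> \<Longrightarrow> \<phi> x = 0"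
    \<comment> \<open>\<open>dilation_estimate\<close> expects profiles centred at the origin, hence
      the translation by \<open>y\<close>.\<close>
    define \<phi>' where "\<phi>' x = \<phi> (1 *\<^sub>R (x - (- y)))" for x
    have \<phi>': "test_function \<phi>'" unfolding \<phi>'_def[abs_def] by (rule test_function_rescale[OF \<phi>]) simp
    have out': "\<phi>' x = 0" if "x \<notin> ball 0 \<rho>" for x
      unfolding \<phi>'_def by (rule out) (use that in \<open>simp add: dist_norm\<close>)
    note [measurable] = test_function_measurable[OF \<phi>]
    have "(LINT x|lborel. (\<phi>' x)\<^sup>2) = (LINT x|lborel. (\<phi> x)\<^sup>2)"
      unfolding \<phi>'_def by (subst integral_rescale[where h="\<lambda>x. (\<phi> x)\<^sup>2"]) auto
    moreover have "\<phi>' (z - y) = \<phi> z" for z by (simp add: \<phi>'_def)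
    ultimately show "\<bar>LINT x|lborel. \<phi> x * u x\<bar> \<le> K * sqrt (LINT x|lborel. (\<phi> x)\<^sup>2)"
      using dilation_estimate[OF \<phi>' _ u g \<rho>, of y] out' by (simp add: K_def U_def G_def mult.commute)
  qed (use \<rho> in auto)
  also have "K\<^sup>2 \<le> 2 * (sqrt ((\<rho> / R) ^ 3) * sqrt U)\<^sup>2 + 2 * (2 * \<rho> * sqrt G)\<^sup>2"
    unfolding K_def using sum_squares_bound[of "sqrt ((\<rho> / R) ^ 3) * sqrt U" "2 * \<rho> * sqrt G"]
    by (simp add: power2_sum)
  also have "\<dots> = 2 * (\<rho> / R) ^ 3 * U + 8 * \<rho>\<^sup>2 * G"
    using U0 R0 by (simp add: power_mult_distrib)
  finally show ?thesis by (simp add: U_def G_def)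
qed

text \<open>The cutoff is the quotient A / (A + B), where A is positive exactly inside radius c and
  B exactly outside radius 1; these regions cover the space because c exceeds 1.\<close>

lemma ball_cutoff:
  assumes \<kappa>: "1 < \<kappa>"
  obtains \<eta> M where "test_function \<eta>" "\<And>x. 0 \<le> \<eta> x" "\<And>x. \<eta> x \<le> 1" "\<And>x. norm x \<le> 1 \<Longrightarrow> \<eta> x = 1"
    "\<And>x. \<kappa> \<le> norm x \<Longrightarrow> \<eta> x = 0" "\<And>x. \<kappa> \<le> norm x \<Longrightarrow> gradient \<eta> x = 0"
    "0 \<le> M" "\<And>x. norm (gradient \<eta> x) \<le> M"
proof -
  \<comment> \<open>Stopping strictly before \<kappa> makes the gradient vanish on the sphere of
    radius \<kappa> as well.\<close>
  define c where "c = (1 + \<kappa>) / 2"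
  have c: "1 < c" "c < \<kappa>" using \<kappa> by (auto simp: c_def)
  define A B where "A x = flat 0 (c\<^sup>2 + (-1) * (norm x)\<^sup>2)" and "B x = flat 0 ((norm x)\<^sup>2 + (-1))" for x :: "real^3"
  have pos: "0 < A x + B x" for x
  proof (cases "norm x < c")
    case True
    then have "(norm x)\<^sup>2 < c\<^sup>2" by (intro power_strict_mono) auto
    then have "0 < A x" by (simp add: A_def flat_def)
    then show ?thesis using flat_0_bounds(1)[of "(norm x)\<^sup>2 + (-1)"] by (simp add: B_def)
  next
    case False
    then have "1 < (norm x)\<^sup>2" using c by (simp add: one_less_power)
    then have "0 < B x" by (simp add: B_def flat_def)
    then show ?thesis using flat_0_bounds(1)[of "c\<^sup>2 + (-1) * (norm x)\<^sup>2"] by (simp add: A_def)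
  qed
  define \<eta> where "\<eta> x = A x * inverse (A x + B x)" for x
  have out: "\<eta> x = 0" if "x \<notin> cball 0 c" for x
  proof -
    have "c\<^sup>2 \<le> (norm x)\<^sup>2" using that c by (intro power_mono) auto
    then show ?thesis by (simp add: \<eta>_def A_def flat_def)
  qed
  have "Ck k A" "Ck k B" for k
    unfolding A_def[abs_def] B_def[abs_def]
    by (intro Ck_flat_comp Ck_add Ck_mult Ck_const Ck_power2_norm)+
  moreover have "A x + B x \<noteq> 0" for x using pos[of x] by simp
  ultimately have "Ck k \<eta>" for k
    unfolding \<eta>_def[abs_def] by (intro Ck_mult Ck_inverse Ck_add) auto
  then have t: "test_function \<eta>" by (rule test_functionI[OF _ bounded_cball out])
  obtain M where M: "0 \<le> M" "\<And>x. norm (gradient \<eta> x) \<le> M" using gradient_bounded[OF t] by blast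
  have nn: "0 \<le> A x" "0 \<le> B x" for x by (simp_all add: A_def B_def flat_0_bounds)
  show ?thesis
  proof (rule that[OF t _ _ _ _ _ M])
    show "0 \<le> \<eta> x" "\<eta> x \<le> 1" for x
      using pos[of x] nn[of x] by (simp_all add: \<eta>_def divide_inverse[symmetric] divide_le_eq)
    show "\<eta> x = 1" if "norm x \<le> 1" for x
    proof -
      have "(norm x)\<^sup>2 \<le> 1" using that by (simp add: power_le_one)
      then have "B x = 0" by (simp add: B_def flat_def)
      then show ?thesis using pos[of x] by (simp add: \<eta>_def)
    qed
    show "\<eta> x = 0" if "\<kappa> \<le> norm x" for x
      using out[of x] that c by simp
    show "gradient \<eta> x = 0" if "\<kappa> \<le> norm x" for x
    proof -
      have "{x. \<eta> x \<noteq> 0} \<subseteq> cball 0 c" using out by blast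
      then have "closure {x. \<eta> x \<noteq> 0} \<subseteq> cball 0 c" by (rule closure_minimal) simp
      then have "x \<notin> closure {x. \<eta> x \<noteq> 0}" using that c by auto
      then show ?thesis by (simp add: gradient_def partial_zero_outside vec_eq_iff)
    qed
  qed
qed

section \<open>Energies, global and localised, and their behaviour under cutoffs\<close>

definition energy :: "real \<Rightarrow> h1 \<Rightarrow> h1 \<Rightarrow> real" where
  "energy \<xi> u v = (LINT x|lborel. grad u x \<bullet> grad v x) + (LINT x|lborel. rep_h1 u x * rep_h1 v x) / \<xi>\<^sup>2"

definition energy_on :: "real \<Rightarrow> (real^3) set \<Rightarrow> h1 \<Rightarrow> real" where
  "energy_on \<xi> A u = (LINT x|lborel. indicator A x * ((norm (grad u x))\<^sup>2 + (rep_h1 u x)\<^sup>2 / \<xi>\<^sup>2))"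

lemma integrable_rep_sq: "integrable lborel (\<lambda>x. (rep_h1 u x)\<^sup>2)"
  using square_integrable_rep[of u] by (simp add: square_integrable_def)

lemma integrable_grad_sq: "integrable lborel (\<lambda>x. (norm (grad u x))\<^sup>2)"
  using square_integrable_grad[of u] by (simp add: square_integrable_def)

lemma integrable_energy_density: "integrable lborel (\<lambda>x. (norm (grad u x))\<^sup>2 + (rep_h1 u x)\<^sup>2 / \<xi>\<^sup>2)"
  using integrable_grad_sq integrable_rep_sq by simp

lemma energy_self: "energy \<xi> u u = (LINT x|lborel. (norm (grad u x))\<^sup>2 + (rep_h1 u x)\<^sup>2 / \<xi>\<^sup>2)"
  unfolding energy_def using integrable_grad_sq[of u] integrable_rep_sq[of u]
  by (simp add: power2_norm_eq_inner) (simp add: power2_eq_square)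

lemma energy_on_split:
  assumes "A \<in> sets borel"
  shows "energy_on \<xi> A u = (LINT x|lborel. indicator A x * (norm (grad u x))\<^sup>2)
    + (LINT x|lborel. indicator A x * (rep_h1 u x)\<^sup>2) / \<xi>\<^sup>2"
  unfolding energy_on_def
  using integrable_indicator_mult[OF integrable_grad_sq assms, of u]
    integrable_indicator_mult[OF integrable_rep_sq assms, of u]
  by (simp add: distrib_left)

lemma sum_energy_on_le:
  assumes "finite F" "disjoint_family_on A F" "\<And>i. i \<in> F \<Longrightarrow> A i \<in> sets borel"
  shows "(\<Sum>i\<in>F. energy_on \<xi> (A i) u) \<le> energy \<xi> u u"
proof -
  let ?e = "\<lambda>x. (norm (grad u x))\<^sup>2 + (rep_h1 u x)\<^sup>2 / \<xi>\<^sup>2"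
  have m: "(\<Union>i\<in>F. A i) \<in> sets borel" using assms by auto
  have "(\<Sum>i\<in>F. energy_on \<xi> (A i) u) = (LINT x|lborel. (\<Sum>i\<in>F. indicator (A i) x * ?e x))"
    unfolding energy_on_def
    by (subst Bochner_Integration.integral_sum)
       (auto intro!: integrable_indicator_mult[OF integrable_energy_density] assms)
  also have "\<dots> = (LINT x|lborel. indicator (\<Union>i\<in>F. A i) x * ?e x)"
    by (simp add: indicator_UN_disjoint[OF assms(1,2)] sum_distrib_right)
  also have "\<dots> \<le> (LINT x|lborel. ?e x)"
    by (rule integral_mono[OF integrable_indicator_mult[OF integrable_energy_density m] integrable_energy_density])
       (auto simp: indicator_def)
  also have "\<dots> = energy \<xi> u u" by (simp add: energy_self)
  finally show ?thesis .
qed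

text \<open>A single profile is rescaled to every ball, so the gradient of the cutoff costs exactly
  a factor 1/s and all constants are shared by the particles.\<close>

definition cut :: "(real^3 \<Rightarrow> real) \<Rightarrow> real^3 \<Rightarrow> real \<Rightarrow> h1 \<Rightarrow> h1" where
  "cut \<eta> y s u = abs_h1 (\<lambda>x. \<eta> ((1 / s) *\<^sub>R (x - y)) * rep_h1 u x)"

lemma
  assumes \<eta>: "test_function \<eta>" and s: "0 < s"
  shows rep_cut: "AE x in lborel. rep_h1 (cut \<eta> y s u) x = \<eta> ((1 / s) *\<^sub>R (x - y)) * rep_h1 u x"
    and grad_cut: "AE x in lborel. grad (cut \<eta> y s u) x = \<eta> ((1 / s) *\<^sub>R (x - y)) *\<^sub>R grad u x
      + (rep_h1 u x / s) *\<^sub>R gradient \<eta> ((1 / s) *\<^sub>R (x - y))"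
proof -
  let ?\<zeta> = "\<lambda>x. \<eta> ((1 / s) *\<^sub>R (x - y))"
  have \<zeta>: "test_function ?\<zeta>" by (rule test_function_rescale[OF \<eta>]) (use s in simp)
  have gr: "gradient ?\<zeta> x = (1 / s) *\<^sub>R gradient \<eta> ((1 / s) *\<^sub>R (x - y))" for x
    unfolding gradient_def by (subst partial_rescale[OF test_function_differentiable[OF \<eta>]]) (simp add: vec_eq_iff)
  note w = is_weak_gradient_mult[OF \<zeta> square_integrable_rep is_weak_gradient_grad, of u]
  show "AE x in lborel. rep_h1 (cut \<eta> y s u) x = ?\<zeta> x * rep_h1 u x"
    unfolding cut_def by (rule grad_abs_h1(1)[OF w])
  have "AE x in lborel. grad (cut \<eta> y s u) x = ?\<zeta> x *\<^sub>R grad u x + rep_h1 u x *\<^sub>R gradient ?\<zeta> x"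
    unfolding cut_def by (rule grad_abs_h1(2)[OF w])
  then show "AE x in lborel. grad (cut \<eta> y s u) x = ?\<zeta> x *\<^sub>R grad u x
      + (rep_h1 u x / s) *\<^sub>R gradient \<eta> ((1 / s) *\<^sub>R (x - y))"
    unfolding gr by simp
qed

text \<open>The only dangerous term is (M/s)^2 times the integral of u^2 over the ball of radius
  \<kappa> s. \<open>local_hardy\<close> trades it for the gradient on the larger ball and a
  multiple of u^2, which the screening term of the energy absorbs by \<open>cap\<close>.\<close>

lemma energy_cut_le:
  assumes \<eta>: "test_function \<eta>" "\<And>x. 0 \<le> \<eta> x" "\<And>x. \<eta> x \<le> 1"
    "\<And>x. \<kappa> \<le> norm x \<Longrightarrow> \<eta> x = 0" "\<And>x. \<kappa> \<le> norm x \<Longrightarrow> gradient \<eta> x = 0"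
    "\<And>x. norm (gradient \<eta> x) \<le> M" and M: "0 \<le> M" and \<kappa>: "0 < \<kappa>"
    and s: "0 < s" "\<kappa> * s \<le> R" and cap: "s / R ^ 3 \<le> C / \<xi>\<^sup>2" and \<xi>: "0 < \<xi>" and C: "0 \<le> C"
  shows "energy \<xi> (cut \<eta> y s u) (cut \<eta> y s u) \<le> (2 + 16 * M\<^sup>2 * \<kappa>\<^sup>2 + 4 * M\<^sup>2 * \<kappa> ^ 3 * C) * energy_on \<xi> (ball y R) u"
proof -
  let ?b = "ball y (\<kappa> * s)" and ?B = "ball y R"
  have [measurable]: "ball y c \<in> sets borel" for c by simp
  have R: "0 < R" using s \<kappa> mult_pos_pos[of \<kappa> s] by linarith
  define ib iB where "ib x = (indicator ?b x :: real)" and "iB x = (indicator ?B x :: real)" for x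
  have ibB: "ib x \<le> iB x" for x using s(2) by (auto simp: ib_def iB_def indicator_def)
  define U G U' where "U = (LINT x|lborel. iB x * (rep_h1 u x)\<^sup>2)" and "G = (LINT x|lborel. iB x * (norm (grad u x))\<^sup>2)"
    and "U' = (LINT x|lborel. ib x * (rep_h1 u x)\<^sup>2)"
  have U0: "0 \<le> U" "0 \<le> G" by (auto simp: U_def G_def iB_def)
  have iU: "integrable lborel (\<lambda>x. iB x * (rep_h1 u x)\<^sup>2)" and iG: "integrable lborel (\<lambda>x. iB x * (norm (grad u x))\<^sup>2)"
    and iU': "integrable lborel (\<lambda>x. ib x * (rep_h1 u x)\<^sup>2)"
    unfolding ib_def iB_def
    by (intro integrable_indicator_mult integrable_rep_sq integrable_grad_sq; simp)+
  have "energy \<xi> (cut \<eta> y s u) (cut \<eta> y s u)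
      \<le> (LINT x|lborel. 2 * (iB x * (norm (grad u x))\<^sup>2) + 2 * M\<^sup>2 / s\<^sup>2 * (ib x * (rep_h1 u x)\<^sup>2) + iB x * (rep_h1 u x)\<^sup>2 / \<xi>\<^sup>2)"
    unfolding energy_self
  proof (rule integral_mono_AE[OF integrable_energy_density])
    show "integrable lborel (\<lambda>x. 2 * (iB x * (norm (grad u x))\<^sup>2) + 2 * M\<^sup>2 / s\<^sup>2 * (ib x * (rep_h1 u x)\<^sup>2) + iB x * (rep_h1 u x)\<^sup>2 / \<xi>\<^sup>2)"
      using iU iG iU' by (intro Bochner_Integration.integrable_add integrable_mult_right integrable_divide)
    show "AE x in lborel. (norm (grad (cut \<eta> y s u) x))\<^sup>2 + (rep_h1 (cut \<eta> y s u) x)\<^sup>2 / \<xi>\<^sup>2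
        \<le> 2 * (iB x * (norm (grad u x))\<^sup>2) + 2 * M\<^sup>2 / s\<^sup>2 * (ib x * (rep_h1 u x)\<^sup>2) + iB x * (rep_h1 u x)\<^sup>2 / \<xi>\<^sup>2"
      using rep_cut[OF \<eta>(1) s(1), of y u] grad_cut[OF \<eta>(1) s(1), of y u]
    proof eventually_elim
      case (elim x)
      define z where "z = (1 / s) *\<^sub>R (x - y)"
      have nz: "norm z = norm (x - y) / s" using s by (simp add: z_def)
      show ?case
      proof (cases "x \<in> ?b")
        case False
        then have "\<kappa> \<le> norm z" using s by (simp add: nz pos_le_divide_eq dist_norm norm_minus_commute)
        then have "rep_h1 (cut \<eta> y s u) x = 0" "grad (cut \<eta> y s u) x = 0"
          unfolding elim z_def[symmetric] by (simp_all add: \<eta>)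
        then show ?thesis by (simp add: iB_def ib_def)
      next
        case True
        then have 1: "ib x = 1" "iB x = 1" using s(2) by (auto simp: ib_def iB_def)
        have e2: "(\<eta> z)\<^sup>2 \<le> 1" using \<eta>(2,3)[of z] by (simp add: power_le_one)
        have a: "(norm (\<eta> z *\<^sub>R grad u x))\<^sup>2 \<le> (norm (grad u x))\<^sup>2"
          using mult_right_mono[OF e2, of "(norm (grad u x))\<^sup>2"] by (simp add: power_mult_distrib)
        have "(norm (gradient \<eta> z))\<^sup>2 \<le> M\<^sup>2" by (intro power_mono \<eta>) simp
        from mult_left_mono[OF this, of "(rep_h1 u x / s)\<^sup>2"]
        have b: "(norm ((rep_h1 u x / s) *\<^sub>R gradient \<eta> z))\<^sup>2 \<le> M\<^sup>2 / s\<^sup>2 * (rep_h1 u x)\<^sup>2"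
          by (simp add: power_mult_distrib power_divide mult.commute)
        have c: "(rep_h1 (cut \<eta> y s u) x)\<^sup>2 / \<xi>\<^sup>2 \<le> (rep_h1 u x)\<^sup>2 / \<xi>\<^sup>2"
          unfolding elim z_def[symmetric] using mult_right_mono[OF e2, of "(rep_h1 u x)\<^sup>2"]
          by (intro divide_right_mono) (auto simp: power_mult_distrib)
        have "(norm (v + w))\<^sup>2 \<le> 2 * (norm v)\<^sup>2 + 2 * (norm w)\<^sup>2" for v w :: "real^3"
          using zero_le_power2[of "norm (v - w)"]
          by (simp add: power2_norm_eq_inner inner_simps inner_commute)
        then have "(norm (grad (cut \<eta> y s u) x))\<^sup>2 \<le> 2 * (norm (grad u x))\<^sup>2 + 2 * (M\<^sup>2 / s\<^sup>2 * (rep_h1 u x)\<^sup>2)"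
          unfolding elim z_def[symmetric] using a b by (smt (verit, best))
        then show ?thesis using c by (simp add: 1)
      qed
    qed
  qed
  also have "\<dots> = 2 * G + 2 * M\<^sup>2 / s\<^sup>2 * U' + U / \<xi>\<^sup>2"
    using iU iG iU' by (simp add: U_def G_def U'_def)
  also have "\<dots> \<le> 2 * G + 2 * M\<^sup>2 / s\<^sup>2 * (2 * (\<kappa> * s / R) ^ 3 * U + 8 * (\<kappa> * s)\<^sup>2 * G) + U / \<xi>\<^sup>2"
    using local_hardy[OF square_integrable_rep is_weak_gradient_grad mult_pos_pos[OF \<kappa> s(1)] s(2), of y u]
    by (intro add_mono mult_left_mono) (simp_all add: U_def U'_def G_def ib_def iB_def)
  \<comment> \<open>Dividing (\<kappa> s)^2 and (\<kappa> s / R)^3 by s^2 leaves \<kappa>^2 and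
    \<kappa>^3 s / R^3, the second being the capacity density in \<open>cap\<close>.\<close>
  also have "\<dots> = (2 + 16 * M\<^sup>2 * \<kappa>\<^sup>2) * G + 4 * M\<^sup>2 * \<kappa> ^ 3 * (s / R ^ 3) * U + U / \<xi>\<^sup>2"
    using s R by (simp add: field_simps power2_eq_square power3_eq_cube)
  also have "\<dots> \<le> (2 + 16 * M\<^sup>2 * \<kappa>\<^sup>2) * G + 4 * M\<^sup>2 * \<kappa> ^ 3 * (C / \<xi>\<^sup>2) * U + U / \<xi>\<^sup>2"
    using cap U0 \<kappa> by (intro add_mono mult_right_mono mult_left_mono order_refl) auto
  also have "\<dots> \<le> (2 + 16 * M\<^sup>2 * \<kappa>\<^sup>2 + 4 * M\<^sup>2 * \<kappa> ^ 3 * C) * (G + U / \<xi>\<^sup>2)"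
  proof -
    define P Q V where "P = 16 * M\<^sup>2 * \<kappa>\<^sup>2" and "Q = 4 * M\<^sup>2 * \<kappa> ^ 3 * C" and "V = U / \<xi>\<^sup>2"
    have "0 \<le> P * V" "0 \<le> Q * G" "0 \<le> V" using U0 C \<kappa> by (auto simp: P_def Q_def V_def)
    then have "(2 + P) * G + Q * V + V \<le> (2 + P + Q) * (G + V)" by (simp add: algebra_simps)
    then show ?thesis by (simp add: P_def Q_def V_def)
  qed
  also have "G + U / \<xi>\<^sup>2 = energy_on \<xi> ?B u"
    unfolding G_def U_def iB_def by (simp add: energy_on_split)
  finally show ?thesis .
qed

section \<open>The family of particles\<close>

lemma energy_sym: "energy \<xi> u v = energy \<xi> v u"
  by (simp add: energy_def inner_commute mult.commute)

lemma energy_add_left: "energy \<xi> (u + v) w = energy \<xi> u w + energy \<xi> v w"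
proof -
  have "(LINT x|lborel. rep_h1 (u + v) x * rep_h1 w x)
      = (LINT x|lborel. rep_h1 u x * rep_h1 w x + rep_h1 v x * rep_h1 w x)"
    by (rule integral_cong_AE) (use rep_add[of u v] in \<open>auto simp: distrib_right\<close>)
  moreover have "(LINT x|lborel. grad (u + v) x \<bullet> grad w x)
      = (LINT x|lborel. grad u x \<bullet> grad w x + grad v x \<bullet> grad w x)"
    by (rule integral_cong_AE) (use grad_add[of u v] in \<open>auto simp: inner_add_left\<close>)
  ultimately show ?thesis
    by (simp add: energy_def integrable_rep_mult integrable_grad_inner add_divide_distrib)
qed

lemma energy_scaleR_left: "energy \<xi> (c *\<^sub>R u) v = c * energy \<xi> u v"
proof -
  have "(LINT x|lborel. rep_h1 (c *\<^sub>R u) x * rep_h1 v x) = (LINT x|lborel. c * (rep_h1 u x * rep_h1 v x))"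
    by (rule integral_cong_AE) (use rep_scaleR[of c u] in auto)
  moreover have "(LINT x|lborel. grad (c *\<^sub>R u) x \<bullet> grad v x) = (LINT x|lborel. c * (grad u x \<bullet> grad v x))"
    by (rule integral_cong_AE) (use grad_scaleR[of c u] in auto)
  ultimately show ?thesis by (simp add: energy_def distrib_left)
qed

lemma abs_energy_le: "\<bar>energy \<xi> u v\<bar> \<le> norm u * norm v * (1 + 1 / \<xi>\<^sup>2)"
proof -
  have n: "0 \<le> (LINT x|lborel. (rep_h1 u x)\<^sup>2)" "0 \<le> (LINT x|lborel. (norm (grad u x))\<^sup>2)" for u by auto
  have "\<bar>LINT x|lborel. grad u x \<bullet> grad v x\<bar> \<le> norm u * norm v"
  proof -
    have "(LINT x|lborel. grad u x \<bullet> grad v x)\<^sup>2 \<le> (norm u)\<^sup>2 * (norm v)\<^sup>2"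
      by (rule order_trans[OF square_integrable_Cauchy_Schwarz[OF square_integrable_grad square_integrable_grad]])
         (use n in \<open>auto simp: norm_h1_sq intro!: mult_mono\<close>)
    then show ?thesis by (simp add: power_mult_distrib[symmetric] power2_le_iff_abs_le)
  qed
  moreover have "\<bar>LINT x|lborel. rep_h1 u x * rep_h1 v x\<bar> \<le> norm u * norm v"
  proof -
    have "(LINT x|lborel. rep_h1 u x * rep_h1 v x)\<^sup>2 \<le> (norm u)\<^sup>2 * (norm v)\<^sup>2"
    proof -
      have "(LINT x|lborel. rep_h1 u x * rep_h1 v x)\<^sup>2 \<le> (LINT x|lborel. (rep_h1 u x)\<^sup>2) * (LINT x|lborel. (rep_h1 v x)\<^sup>2)"
        using square_integrable_Cauchy_Schwarz[OF square_integrable_rep square_integrable_rep, of u v] by simp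
      also have "\<dots> \<le> (norm u)\<^sup>2 * (norm v)\<^sup>2"
        using n by (intro mult_mono) (auto simp: norm_h1_sq)
      finally show ?thesis .
    qed
    then show ?thesis by (simp add: power_mult_distrib[symmetric] power2_le_iff_abs_le)
  qed
  then have "\<bar>(LINT x|lborel. rep_h1 u x * rep_h1 v x) / \<xi>\<^sup>2\<bar> \<le> norm u * norm v / \<xi>\<^sup>2"
    by (simp add: abs_divide divide_right_mono)
  ultimately have "\<bar>energy \<xi> u v\<bar> \<le> norm u * norm v + norm u * norm v / \<xi>\<^sup>2"
    unfolding energy_def by linarith
  then show ?thesis by (simp add: algebra_simps)
qed

lemma energy_coercive: "min 1 (1 / \<xi>\<^sup>2) * (norm u)\<^sup>2 \<le> energy \<xi> u u"
proof -
  let ?c = "min 1 (1 / \<xi>\<^sup>2)"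
  have n: "0 \<le> (LINT x|lborel. (rep_h1 u x)\<^sup>2)" "0 \<le> (LINT x|lborel. (norm (grad u x))\<^sup>2)" by auto
  have "?c * (LINT x|lborel. (norm (grad u x))\<^sup>2) \<le> 1 * (LINT x|lborel. (norm (grad u x))\<^sup>2)"
    "?c * (LINT x|lborel. (rep_h1 u x)\<^sup>2) \<le> 1 / \<xi>\<^sup>2 * (LINT x|lborel. (rep_h1 u x)\<^sup>2)"
    using n by (intro mult_right_mono; simp)+
  then show ?thesis
    unfolding energy_self norm_h1_sq distrib_left using integrable_grad_sq[of u] integrable_rep_sq[of u] by simp
qed

lemma energy_form_energy:
  assumes "0 < \<xi>"
  shows "energy_form (energy \<xi>) (min 1 (1 / \<xi>\<^sup>2))"
proof unfold_locales
  fix u v w :: h1 and c :: real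
  show "energy \<xi> (u + v) w = energy \<xi> u w + energy \<xi> v w" by (rule energy_add_left)
  show "energy \<xi> u (v + w) = energy \<xi> u v + energy \<xi> u w"
    by (simp add: energy_sym[of \<xi> u] energy_add_left)
  show "energy \<xi> (c *\<^sub>R u) v = c *\<^sub>R energy \<xi> u v" by (simp add: energy_scaleR_left)
  show "energy \<xi> u (c *\<^sub>R v) = c *\<^sub>R energy \<xi> u v"
    by (simp add: energy_sym[of \<xi> u] energy_scaleR_left)
  show "\<exists>K. \<forall>u v. norm (energy \<xi> u v) \<le> norm u * norm v * K"
    using abs_energy_le by auto
  show "energy \<xi> u v = energy \<xi> v u" by (rule energy_sym)
  show "0 < min 1 (1 / \<xi>\<^sup>2)" using assms by simp
  show "min 1 (1 / \<xi>\<^sup>2) * (norm u)\<^sup>2 \<le> energy \<xi> u u" by (rule energy_coercive)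
qed

section \<open>Subspaces of functions vanishing on a set\<close>

definition vanishing :: "(real^3) set \<Rightarrow> h1 set" where
  "vanishing A = {v. eq_on A v 0}"

lemma vanishing_iff: "v \<in> vanishing A \<longleftrightarrow> (AE x in lborel. x \<in> A \<longrightarrow> rep_h1 v x = 0)"
proof -
  have "eq_on A v 0 \<longleftrightarrow> (AE x in lborel. x \<in> A \<longrightarrow> rep_h1 v x = 0)"
    unfolding eq_on_def
    by (rule eventually_subst) (use rep_0 in eventually_elim, simp)
  then show ?thesis by (simp add: vanishing_def)
qed

lemma eq_on_iff_diff: "eq_on A u v \<longleftrightarrow> u - v \<in> vanishing A"
  unfolding vanishing_iff eq_on_def
  by (rule eventually_subst) (use rep_diff[of u v] in eventually_elim, simp)

lemma subspace_vanishing: "subspace (vanishing A)"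
proof (rule subspaceI)
  show "0 \<in> vanishing A" unfolding vanishing_iff using rep_0 by eventually_elim simp
  fix u v c assume u: "u \<in> vanishing A"
  show "c *\<^sub>R u \<in> vanishing A"
    using u rep_scaleR[of c u] unfolding vanishing_iff by eventually_elim simp
  assume v: "v \<in> vanishing A"
  show "u + v \<in> vanishing A"
    using u v rep_add[of u v] unfolding vanishing_iff by eventually_elim simp
qed

text \<open>The squared L2 mass of the limit on \<open>A\<close> is at most its squared distance to
  each member of the sequence.\<close>

lemma closed_vanishing:
  assumes A: "A \<in> sets borel"
  shows "closed (vanishing A)"
  unfolding closed_sequential_limits
proof (intro allI impI, elim conjE)
  fix v u assume v: "\<forall>n. v n \<in> vanishing A" and lim: "v \<longlonglongrightarrow> u"
  note [measurable] = A
  have i: "integrable lborel (\<lambda>x. indicator A x * (rep_h1 u x)\<^sup>2)"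
    by (rule integrable_indicator_mult[OF integrable_rep_sq A])
  have "(LINT x|lborel. indicator A x * (rep_h1 u x)\<^sup>2) \<le> (norm (u - v n))\<^sup>2" for n
  proof -
    have "(LINT x|lborel. indicator A x * (rep_h1 u x)\<^sup>2) \<le> (LINT x|lborel. (rep_h1 (u - v n) x)\<^sup>2)"
    proof (rule integral_mono_AE[OF i integrable_rep_sq])
      have "AE x in lborel. x \<in> A \<longrightarrow> rep_h1 (v n) x = 0" using v by (simp add: vanishing_iff)
      then show "AE x in lborel. indicator A x * (rep_h1 u x)\<^sup>2 \<le> (rep_h1 (u - v n) x)\<^sup>2"
        using rep_diff[of u "v n"] by eventually_elim (auto simp: indicator_def)
    qed
    also have "\<dots> \<le> (norm (u - v n))\<^sup>2" by (simp add: norm_h1_sq)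
    finally show ?thesis .
  qed
  moreover have "(\<lambda>n. (norm (u - v n))\<^sup>2) \<longlonglongrightarrow> (norm (u - u))\<^sup>2"
    by (intro tendsto_intros lim)
  ultimately have "(LINT x|lborel. indicator A x * (rep_h1 u x)\<^sup>2) \<le> 0"
    by (intro LIMSEQ_le_const[of "\<lambda>n. (norm (u - v n))\<^sup>2"]) auto
  moreover have "0 \<le> (LINT x|lborel. indicator A x * (rep_h1 u x)\<^sup>2)" by simp
  ultimately have "AE x in lborel. indicator A x * (rep_h1 u x)\<^sup>2 = 0"
    using integral_nonneg_eq_0_iff_AE[OF i] by simp
  then show "u \<in> vanishing A"
    unfolding vanishing_iff by eventually_elim (auto simp: indicator_def split: if_splits)
qed

lemma solves_outside_iff: "solves_outside \<xi> A f w \<longleftrightarrow> (\<forall>v\<in>vanishing A. energy \<xi> w v = blinfun_apply f v)"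
  by (auto simp: solves_outside_def vanishing_def energy_def)

text \<open>Both are definite descriptions of the same predicate: agreement on the ball is
  membership of the difference in \<open>vanishing\<close>, and the homogeneous equation outside is
  orthogonality to it.\<close>

lemma Q_proj_eq:
  assumes "0 < \<xi>"
  shows "Q_proj \<xi> y s w = energy_form.outer_proj (energy \<xi>) (vanishing (cball y s)) w"
  unfolding Q_proj_def energy_form.outer_proj_def[OF energy_form_energy[OF assms]]
  by (simp add: eq_on_iff_diff solves_outside_iff)

lemma cut_diff_vanishing:
  assumes \<eta>: "test_function \<eta>" "\<And>x. norm x \<le> 1 \<Longrightarrow> \<eta> x = 1" and s: "0 < s"
  shows "cut \<eta> y s u - u \<in> vanishing (cball y s)"
  unfolding vanishing_iff using rep_cut[OF \<eta>(1) s, of y u] rep_diff[of "cut \<eta> y s u" u]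
proof eventually_elim
  case (elim x)
  show ?case
  proof
    assume "x \<in> cball y s"
    then have "norm ((1 / s) *\<^sub>R (x - y)) \<le> 1" using s by (simp add: dist_norm norm_minus_commute)
    then show "rep_h1 (cut \<eta> y s u - u) x = 0" using elim \<eta>(2) by simp
  qed
qed

lemma cut_support:
  assumes \<eta>: "test_function \<eta>" "\<And>x. \<kappa> \<le> norm x \<Longrightarrow> \<eta> x = 0" "\<And>x. \<kappa> \<le> norm x \<Longrightarrow> gradient \<eta> x = 0"
    and s: "0 < s" "\<kappa> * s \<le> R"
  shows "AE x in lborel. x \<notin> ball y R \<longrightarrow> rep_h1 (cut \<eta> y s u) x = 0 \<and> grad (cut \<eta> y s u) x = 0"
  using rep_cut[OF \<eta>(1) s(1), of y u] grad_cut[OF \<eta>(1) s(1), of y u]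
proof eventually_elim
  case (elim x)
  show ?case
  proof
    assume "x \<notin> ball y R"
    then have "\<kappa> * s \<le> norm (x - y)" using s by (simp add: dist_norm norm_minus_commute)
    then have "\<kappa> \<le> norm ((1 / s) *\<^sub>R (x - y))" using s by (simp add: pos_le_divide_eq)
    then show "rep_h1 (cut \<eta> y s u) x = 0 \<and> grad (cut \<eta> y s u) x = 0"
      unfolding elim by (simp only: \<eta>(2,3)) simp
  qed
qed

lemma energy_disjoint_supports:
  assumes "AE x in lborel. x \<notin> A \<longrightarrow> rep_h1 u x = 0 \<and> grad u x = 0"
    and "AE x in lborel. x \<notin> B \<longrightarrow> rep_h1 v x = 0 \<and> grad v x = 0" and "A \<inter> B = {}"
  shows "energy \<xi> u v = 0"
proof -
  have "AE x in lborel. rep_h1 u x * rep_h1 v x = 0" "AE x in lborel. grad u x \<bullet> grad v x = 0"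
    using assms(1,2) by (eventually_elim, use assms(3) in auto)+
  then show ?thesis by (simp add: energy_def integral_eq_zero_AE)
qed

lemma (in energy_form) form_sum_orthogonal:
  assumes "finite F" "\<And>i j. i \<in> F \<Longrightarrow> j \<in> F \<Longrightarrow> i \<noteq> j \<Longrightarrow> form (g i) (g j) = 0"
  shows "form (sum g F) (sum g F) = (\<Sum>i\<in>F. form (g i) (g i))"
proof -
  have "form (sum g F) (sum g F) = (\<Sum>i\<in>F. \<Sum>j\<in>F. form (g i) (g j))"
    by (subst form.sum_left, subst form.sum_right) (rule refl)
  also have "\<dots> = (\<Sum>i\<in>F. \<Sum>j\<in>F. if j = i then form (g i) (g i) else 0)"
    using assms(2) by (intro sum.cong refl) auto
  also have "\<dots> = (\<Sum>i\<in>F. form (g i) (g i))" using assms(1) by simp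
  finally show ?thesis .
qed

text \<open>\<open>M\<close> is fixed from \<kappa> and \<open>C\<close> before \<xi> and the
  configuration appear, which is the required uniformity. For the upper bound \<open>Z i u\<close>
  competes with the projection of \<open>u\<close>; the lifting for the lower bound is a sum of
  cutoffs.\<close>

proposition subspace_family_vanishing:
  assumes \<kappa>: "1 < \<kappa>" and C: "0 \<le> C"
  obtains M where "1 \<le> M" "\<And>(\<xi>::real) (I::'i set) x r R. 0 < \<xi> \<Longrightarrow>
    (\<And>i. i \<in> I \<Longrightarrow> 0 < r i \<and> \<kappa> * r i \<le> R i \<and> r i / R i ^ 3 \<le> C / \<xi>\<^sup>2) \<Longrightarrow>
    disjoint_family_on (\<lambda>i. ball (x i) (R i)) I \<Longrightarrow>
    subspace_family (energy \<xi>) (min 1 (1 / \<xi>\<^sup>2)) I (\<lambda>i. vanishing (cball (x i) (r i))) M"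
proof -
  obtain \<eta> m where \<eta>: "test_function \<eta>" "\<And>x. 0 \<le> \<eta> x" "\<And>x. \<eta> x \<le> 1" "\<And>x. norm x \<le> 1 \<Longrightarrow> \<eta> x = 1"
    "\<And>x. \<kappa> \<le> norm x \<Longrightarrow> \<eta> x = 0" "\<And>x. \<kappa> \<le> norm x \<Longrightarrow> gradient \<eta> x = 0"
    and m: "0 \<le> m" "\<And>x. norm (gradient \<eta> x) \<le> m"
    using ball_cutoff[OF \<kappa>] by blast
  define M where "M = 2 + 16 * m\<^sup>2 * \<kappa>\<^sup>2 + 4 * m\<^sup>2 * \<kappa> ^ 3 * C"
  have "0 \<le> 16 * m\<^sup>2 * \<kappa>\<^sup>2" "0 \<le> 4 * m\<^sup>2 * \<kappa> ^ 3 * C" using \<kappa> C by auto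
  then have M: "1 \<le> M" unfolding M_def by linarith
  show ?thesis
  proof (rule that[OF M])
    fix \<xi> :: real and I :: "'i set" and x :: "'i \<Rightarrow> real^3" and r R :: "'i \<Rightarrow> real"
    assume \<xi>: "0 < \<xi>" and rR: "\<And>i. i \<in> I \<Longrightarrow> 0 < r i \<and> \<kappa> * r i \<le> R i \<and> r i / R i ^ 3 \<le> C / \<xi>\<^sup>2"
      and disj: "disjoint_family_on (\<lambda>i. ball (x i) (R i)) I"
    interpret E: energy_form "energy \<xi>" "min 1 (1 / \<xi>\<^sup>2)" by (rule energy_form_energy[OF \<xi>])
    let ?W = "\<lambda>i. vanishing (cball (x i) (r i))" and ?B = "\<lambda>i. ball (x i) (R i)"
    have W: "subspace (?W i)" "closed (?W i)" for i
      by (simp_all add: subspace_vanishing closed_vanishing)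
    define Z where "Z i = cut \<eta> (x i) (r i)" for i
    have Z_W: "Z i u - u \<in> ?W i" if "i \<in> I" for i u
      unfolding Z_def using rR[OF that] by (intro cut_diff_vanishing \<eta>) auto
    have Z_le: "energy \<xi> (Z i u) (Z i u) \<le> M * energy_on \<xi> (?B i) u" if "i \<in> I" for i u
      unfolding Z_def M_def
      by (rule energy_cut_le[OF \<eta>(1,2,3,5,6) m(2,1)]) (use rR[OF that] \<kappa> C \<xi> in auto)
    have supp: "AE z in lborel. z \<notin> ?B i \<longrightarrow> rep_h1 (Z i u) z = 0 \<and> grad (Z i u) z = 0" if "i \<in> I" for i u
      unfolding Z_def by (rule cut_support[OF \<eta>(1,5,6)]) (use rR[OF that] in auto)
    have B_disj: "?B i \<inter> ?B j = {}" if "i \<in> I" "j \<in> I" "i \<noteq> j" for i j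
      using disj that by (simp add: disjoint_family_on_def)
    have Z_orth: "energy \<xi> (Z i u) (Z j v) = 0" if "i \<in> I" "j \<in> I" "i \<noteq> j" for i j u v
      by (rule energy_disjoint_supports[OF supp supp B_disj]) (use that in auto)
    \<comment> \<open>As \<kappa> exceeds 1, the closed particle lies in its own open ball of radius
      \<open>R i\<close>, which misses the supports of all other cutoffs.\<close>
    have Z_other: "Z j u \<in> ?W i" if "i \<in> I" "j \<in> I" "i \<noteq> j" for i j u
      unfolding vanishing_iff using supp[OF that(2), of u]
    proof eventually_elim
      case (elim z)
      have "r i < \<kappa> * r i" using rR[OF that(1)] \<kappa> by simp
      then have "r i < R i" using rR[OF that(1)] by linarith
      then have "cball (x i) (r i) \<subseteq> ?B i" by auto
      then show ?case using B_disj[OF that] elim by blast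
    qed
    let ?q = "\<lambda>i u. energy \<xi> (E.outer_proj (?W i) u) (E.outer_proj (?W i) u)"
    have upper: "(\<Sum>i\<in>F. ?q i u) \<le> M * energy \<xi> u u" if F: "finite F" "F \<subseteq> I" for F u
    proof -
      have "(\<Sum>i\<in>F. ?q i u) \<le> (\<Sum>i\<in>F. M * energy_on \<xi> (?B i) u)"
      proof (rule sum_mono)
        fix i assume "i \<in> F"
        then have i: "i \<in> I" using F by blast
        show "?q i u \<le> M * energy_on \<xi> (?B i) u"
          by (rule order_trans[OF E.outer_proj_minimal[OF W Z_W[OF i]] Z_le[OF i]])
      qed
      also have "\<dots> = M * (\<Sum>i\<in>F. energy_on \<xi> (?B i) u)" by (simp add: sum_distrib_left)
      also have "\<dots> \<le> M * energy \<xi> u u"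
        using M F disj by (intro mult_left_mono sum_energy_on_le) (auto simp: disjoint_family_on_def)
      finally show ?thesis .
    qed
    have lower: "\<exists>w. (\<forall>i\<in>I. w - u \<in> ?W i) \<and> energy \<xi> w w \<le> M * (\<Sum>\<^sub>\<infinity>i\<in>I. ?q i u)" for u
    proof -
      \<comment> \<open>Cutting off the projection instead of \<open>u\<close> keeps the values of
        \<open>u\<close> on particle \<open>i\<close>, while the cost is now the energy of the
        projection, as \<open>lower\<close> demands.\<close>
      define g where "g i = Z i (E.outer_proj (?W i) u)" for i
      have q_summable: "(\<lambda>i. ?q i u) summable_on I"
        by (rule nonneg_bdd_above_summable_on) (auto simp: E.nonneg intro!: bdd_aboveI[of _ "M * energy \<xi> u u"] upper)
      have g_le: "energy \<xi> (sum g F) (sum g F) \<le> M * (\<Sum>i\<in>F. ?q i u)" if F: "finite F" "F \<subseteq> I" for F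
      proof -
        have "energy \<xi> (sum g F) (sum g F) = (\<Sum>i\<in>F. energy \<xi> (g i) (g i))"
          by (rule E.form_sum_orthogonal) (use F in \<open>auto simp: g_def intro!: Z_orth\<close>)
        also have "\<dots> \<le> (\<Sum>i\<in>F. M * ?q i u)"
        proof (rule sum_mono)
          fix i assume "i \<in> F"
          then have i: "i \<in> I" using F by blast
          have "energy_on \<xi> (?B i) v \<le> energy \<xi> v v" for v
            using sum_energy_on_le[of "{i}" ?B \<xi> v] by (simp add: disjoint_family_on_def)
          then show "energy \<xi> (g i) (g i) \<le> M * ?q i u"
            unfolding g_def using M by (intro order_trans[OF Z_le[OF i]] mult_left_mono) auto
        qed
        finally show ?thesis by (simp add: sum_distrib_left)
      qed
      note s = E.summable_on_of_form_bound[OF q_summable E.nonneg _ g_le]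
      have gs: "g summable_on I" and w_le: "energy \<xi> (infsum g I) (infsum g I) \<le> M * (\<Sum>\<^sub>\<infinity>i\<in>I. ?q i u)"
        using s M by auto
      \<comment> \<open>On particle \<open>i\<close> only the \<open>i\<close>-th summand survives,
        so all finite sums containing \<open>i\<close> agree there with \<open>u\<close>; closedness
        carries this to the limit.\<close>
      have "infsum g I - u \<in> ?W i" if i: "i \<in> I" for i
      proof (rule Lim_in_closed_set[OF W(2) _ finite_subsets_at_top_neq_bot])
        show "((\<lambda>F. sum g F - u) \<longlongrightarrow> infsum g I - u) (finite_subsets_at_top I)"
          by (intro tendsto_diff tendsto_const infsum_tendsto gs)
        have "sum g F - u \<in> ?W i" if F: "finite F" "{i} \<subseteq> F" "F \<subseteq> I" for F
        proof -
          have "sum g F = g i + sum g (F - {i})" using F by (simp add: sum.remove[of F i])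
          then have eq: "sum g F - u = (g i - E.outer_proj (?W i) u) + (E.outer_proj (?W i) u - u) + sum g (F - {i})"
            by simp
          have "sum g (F - {i}) \<in> ?W i"
            by (rule subspace_sum[OF W(1)]) (use F i in \<open>auto simp: g_def intro!: Z_other\<close>)
          moreover have "g i - E.outer_proj (?W i) u \<in> ?W i" unfolding g_def by (rule Z_W[OF i])
          moreover have "E.outer_proj (?W i) u - u \<in> ?W i" by (rule E.outer_proj_diff[OF W])
          ultimately show ?thesis unfolding eq by (intro subspace_add[OF W(1)])
        qed
        then show "\<forall>\<^sub>F F in finite_subsets_at_top I. sum g F - u \<in> ?W i"
          unfolding eventually_finite_subsets_at_top using i by (intro exI[of _ "{i}"]) auto
      qed
      with w_le show ?thesis by blast
    qed
    show "subspace_family (energy \<xi>) (min 1 (1 / \<xi>\<^sup>2)) I ?W M"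
      by unfold_locales (use W M upper lower in auto)
  qed
qed

text \<open>Half the nearest distance serves as radius: twice each of two radii is at most the
  distance of the centres, hence so is their sum. Halving costs the factor 8 in the
  capacity.\<close>

lemma separated_balls:
  fixes I :: "'i set" and x :: "'i \<Rightarrow> real^3"
  assumes \<xi>: "0 < \<xi>" and \<kappa>: "0 < \<kappa>"
    and sep: "\<forall>i\<in>I. 0 < r i \<and> ereal (\<kappa> * r i) < nearest_dist I x i / 2"
    and cap: "max_capacity I x r \<le> ereal (Cs / \<xi>\<^sup>2)"
  obtains R where
    "\<And>i. i \<in> I \<Longrightarrow> 0 < r i \<and> \<kappa> * r i \<le> R i \<and> r i / R i ^ 3 \<le> (8 * max Cs 0 + 1) / \<xi>\<^sup>2"
    "disjoint_family_on (\<lambda>i. ball (x i) (R i)) I"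
proof -
  define d where "d i = nearest_dist I x i" for i
  \<comment> \<open>At least 1 whatever the sign of \<open>Cs\<close>, which the case of a single
    particle exploits.\<close>
  define C where "C = 8 * max Cs 0 + 1"
  have d_le: "d i \<le> ereal (dist (x i) (x j))" if "j \<in> I" "j \<noteq> i" for i j
    unfolding d_def nearest_dist_def by (rule INF_lower) (use that in auto)
  have "\<exists>\<rho>. \<kappa> * r i \<le> \<rho> \<and> r i / \<rho> ^ 3 \<le> C / \<xi>\<^sup>2 \<and> (\<forall>j\<in>I. j \<noteq> i \<longrightarrow> 2 * \<rho> \<le> dist (x i) (x j))" if i: "i \<in> I" for i
  proof -
    have ri: "0 < r i" "ereal (\<kappa> * r i) < d i / 2" using sep i by (auto simp: d_def)
    show ?thesis
    proof (cases "d i")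
      case (real \<delta>)
      have \<delta>: "\<kappa> * r i < \<delta> / 2" using ri(2) by (simp add: real)
      then have \<delta>0: "0 < \<delta>" using ri(1) \<kappa> by (smt (verit) mult_pos_pos divide_le_0_iff)
      have "ereal (r i) / d i ^ 3 \<le> max_capacity I x r"
        unfolding max_capacity_def d_def by (rule SUP_upper[OF i])
      with cap have "ereal (r i) / d i ^ 3 \<le> ereal (Cs / \<xi>\<^sup>2)" by (rule order_trans[rotated])
      then have "r i / \<delta> ^ 3 \<le> Cs / \<xi>\<^sup>2" using \<delta>0 by (simp add: real)
      moreover have "8 * (Cs / \<xi>\<^sup>2) \<le> C / \<xi>\<^sup>2" by (simp add: C_def divide_right_mono)
      moreover have "r i / (\<delta> / 2) ^ 3 = 8 * (r i / \<delta> ^ 3)" by (simp add: power_divide)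
      ultimately have "r i / (\<delta> / 2) ^ 3 \<le> C / \<xi>\<^sup>2" by linarith
      moreover have "2 * (\<delta> / 2) \<le> dist (x i) (x j)" if "j \<in> I" "j \<noteq> i" for j
        using d_le[OF that] by (simp add: real)
      ultimately show ?thesis using \<delta> by (intro exI[of _ "\<delta> / 2"]) auto
    next
      case PInf
      \<comment> \<open>Infinite nearest distance means a single particle, so any large radius will
        do: \<rho> \<ge> 1 and \<rho> \<ge> r \<xi>^2 give r / \<rho>^3 \<le> 1 / \<xi>^2.\<close>
      define \<rho> where "\<rho> = max (\<kappa> * r i) (max 1 (r i * \<xi>\<^sup>2))"
      have \<rho>: "\<kappa> * r i \<le> \<rho>" "1 \<le> \<rho>" "r i * \<xi>\<^sup>2 \<le> \<rho>" by (auto simp: \<rho>_def)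
      have "\<rho> \<le> \<rho> ^ 3" using \<rho>(2) by (simp add: self_le_power)
      moreover have "1 * \<rho> ^ 3 \<le> C * \<rho> ^ 3"
        using \<rho>(2) by (intro mult_right_mono) (auto simp: C_def)
      ultimately have "r i * \<xi>\<^sup>2 \<le> C * \<rho> ^ 3" using \<rho>(3) by linarith
      then have "r i / \<rho> ^ 3 \<le> C / \<xi>\<^sup>2" using \<rho>(2) \<xi> by (simp add: field_simps)
      moreover have "j = i" if "j \<in> I" for j
        using d_le[OF that, of i] by (auto simp: PInf)
      ultimately show ?thesis using \<rho>(1) by (intro exI[of _ \<rho>]) auto
    next
      case MInf
      then show ?thesis using ri by simp
    qed
  qed
  then obtain R where R: "\<And>i. i \<in> I \<Longrightarrow> \<kappa> * r i \<le> R i \<and> r i / R i ^ 3 \<le> C / \<xi>\<^sup>2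
      \<and> (\<forall>j\<in>I. j \<noteq> i \<longrightarrow> 2 * R i \<le> dist (x i) (x j))" by metis
  show ?thesis
  proof (rule that[of R])
    show "\<And>i. i \<in> I \<Longrightarrow> 0 < r i \<and> \<kappa> * r i \<le> R i \<and> r i / R i ^ 3 \<le> (8 * max Cs 0 + 1) / \<xi>\<^sup>2"
      using R sep by (simp add: C_def)
    show "disjoint_family_on (\<lambda>i. ball (x i) (R i)) I"
      unfolding disjoint_family_on_def
    proof (intro ballI impI)
      fix i j assume ij: "i \<in> I" "j \<in> I" "i \<noteq> j"
      then have "R i + R j \<le> dist (x i) (x j)"
        using R[OF ij(1)] R[OF ij(2)] by (fastforce simp: dist_commute)
      then show "ball (x i) (R i) \<inter> ball (x j) (R j) = {}" by (rule disjoint_ballI)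
    qed
  qed
qed

section \<open>Application to the union of the particles\<close>

lemma particles_measurable [measurable]:
  fixes I :: "nat set"
  shows "particles I x r \<in> sets borel"
  unfolding particles_def by (intro sets.countable_UN') auto

text \<open>Countability of the index set allows the quantifier over particles to be exchanged with
  "almost everywhere".\<close>

lemma vanishing_particles:
  fixes I :: "nat set"
  shows "vanishing (particles I x r) = (\<Inter>i\<in>I. vanishing (cball (x i) (r i)))"
proof -
  have "(AE z in lborel. z \<in> particles I x r \<longrightarrow> rep_h1 v z = 0)
      \<longleftrightarrow> (\<forall>i\<in>I. AE z in lborel. z \<in> cball (x i) (r i) \<longrightarrow> rep_h1 v z = 0)" for v
    by (subst AE_ball_countable[symmetric]) (auto simp: particles_def)
  then show ?thesis by (auto simp: vanishing_iff)
qed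

lemma h1_norm_on_nonneg: "0 \<le> h1_norm_on S w"
  unfolding h1_norm_on_def set_lebesgue_integral_def by (intro real_sqrt_ge_zero add_nonneg_nonneg) auto

lemma h1_norm_on_le:
  assumes S: "S \<in> sets borel"
  shows "h1_norm_on S w \<le> norm w"
proof -
  have "(LINT x:S|lborel. (rep_h1 w x)\<^sup>2) \<le> (LINT x|lborel. (rep_h1 w x)\<^sup>2)"
    unfolding set_lebesgue_integral_def
    using integral_mono[OF integrable_indicator_mult[OF integrable_rep_sq S] integrable_rep_sq, of w w]
    by (auto simp: indicator_def)
  moreover have "(LINT x:S|lborel. (norm (grad w x))\<^sup>2) \<le> (LINT x|lborel. (norm (grad w x))\<^sup>2)"
    unfolding set_lebesgue_integral_def
    using integral_mono[OF integrable_indicator_mult[OF integrable_grad_sq S] integrable_grad_sq, of w w]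
    by (auto simp: indicator_def)
  ultimately have "h1_norm_on S w \<le> sqrt ((norm w)\<^sup>2)"
    unfolding h1_norm_on_def norm_h1_sq by (intro real_sqrt_le_mono add_mono)
  then show ?thesis by simp
qed

lemma norm_sq_le_energy:
  assumes "0 < \<xi>"
  shows "(norm u)\<^sup>2 \<le> max 1 (\<xi>\<^sup>2) * energy \<xi> u u"
proof -
  have "min 1 (1 / \<xi>\<^sup>2) = 1 / max 1 (\<xi>\<^sup>2)"
    using assms by (auto simp: min_def max_def field_simps)
  from energy_coercive[of \<xi> u, unfolded this] have "(norm u)\<^sup>2 / max 1 (\<xi>\<^sup>2) \<le> energy \<xi> u u"
    by simp
  moreover have "0 < max 1 (\<xi>\<^sup>2)" by linarith
  ultimately show ?thesis by (simp only: pos_divide_le_eq mult.commute)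
qed

text \<open>The constant \<open>max 1 (\<xi>^2)\<close> is the reciprocal of the coercivity
  constant. It enters the squared estimate once from f to \<open>Phi0\<close> and once from energy
  to norm, so the root returns it to the first power. Summability is asserted because
  \<open>infsum\<close> has the default value 0 otherwise.\<close>

theorem theorem1p2:
  shows "\<exists>C :: real \<Rightarrow> real. \<forall>\<alpha> \<kappa> Cs :: real. 0 < \<alpha> \<and> 1 < \<kappa> \<longrightarrow>
    (\<exists>(q :: nat \<Rightarrow> nat \<Rightarrow> real) (\<epsilon> :: real).
      0 < \<epsilon> \<and> \<epsilon> < 1 \<and> (\<forall>k. (\<lambda>N. q k N) \<longlonglongrightarrow> 1) \<and>
      (\<forall>(\<xi> :: real) (I :: nat set) (x :: nat \<Rightarrow> real^3) (r :: nat \<Rightarrow> real).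
        0 < \<xi> \<longrightarrow>
        (\<forall>i\<in>I. 0 < r i \<and> ereal (\<kappa> * r i) < nearest_dist I x i / 2 \<and> r i \<le> \<alpha> * \<xi>) \<longrightarrow>
        max_capacity I x r \<le> ereal (Cs / \<xi>\<^sup>2) \<longrightarrow>
        (\<forall>f :: h1_dual.
          (\<forall>k. reflection \<xi> I x r f k summable_on I) \<and>
          (\<exists>!u. dirichlet_solution \<xi> (particles I x r) f u) \<and>
          (\<forall>u. dirichlet_solution \<xi> (particles I x r) f u \<longrightarrow>
            (let \<Psi> = (\<lambda>N. \<Sum>k\<le>N. q k N *\<^sub>R Phi \<xi> I x r f k);
                 e = (\<lambda>N. h1_norm_on (- particles I x r) (\<Psi> N - u))
             in e \<longlonglongrightarrow> 0 \<and> (\<forall>N. e N \<le> C \<xi> * \<epsilon> ^ N * norm f))))))"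
proof (intro exI[of _ "\<lambda>\<xi>. max 1 (\<xi>\<^sup>2)"] allI impI, elim conjE, goal_cases)
  case (1 \<alpha> \<kappa> Cs)
  have "0 \<le> 8 * max Cs 0 + 1" by simp
  from subspace_family_vanishing[OF \<open>1 < \<kappa>\<close> this, where 'i=nat]
  obtain M where M: "1 \<le> M" and family: "\<And>\<xi> (I::nat set) x r R. 0 < \<xi> \<Longrightarrow>
      (\<And>i. i \<in> I \<Longrightarrow> 0 < r i \<and> \<kappa> * r i \<le> R i \<and> r i / R i ^ 3 \<le> (8 * max Cs 0 + 1) / \<xi>\<^sup>2) \<Longrightarrow>
      disjoint_family_on (\<lambda>i. ball (x i) (R i)) I \<Longrightarrow>
      subspace_family (energy \<xi>) (min 1 (1 / \<xi>\<^sup>2)) I (\<lambda>i. vanishing (cball (x i) (r i))) M" by blast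
  \<comment> \<open>The energy contracts by \<open>1 - g / M\<close> per step; the square root
    passes from energies to norms.\<close>
  define g \<epsilon> where "g = 1 / (2 * M)" and "\<epsilon> = sqrt (1 - g / M)"
  have "1 * 1 \<le> M * M" using M by (intro mult_mono) auto
  then have g: "0 < g" "g < 1" "0 < g / M" "g / M < 1" using M by (simp_all add: g_def divide_less_eq)
  then have \<epsilon>: "0 < \<epsilon>" "\<epsilon> < 1" "\<epsilon>\<^sup>2 = 1 - g / M" by (simp_all add: \<epsilon>_def)
  let ?q = "averaging_weight g"
  show ?case
  proof (intro exI[of _ ?q] exI[of _ \<epsilon>] conjI[OF \<epsilon>(1)] conjI[OF \<epsilon>(2)]
      conjI[OF allI[OF averaging_weight_tendsto[OF g(1,2)]]] allI impI, goal_cases)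
    case (1 \<xi> I x r f)
    then have \<xi>: "0 < \<xi>"
      and sep: "\<forall>i\<in>I. 0 < r i \<and> ereal (\<kappa> * r i) < nearest_dist I x i / 2 \<and> r i \<le> \<alpha> * \<xi>"
      and cap: "max_capacity I x r \<le> ereal (Cs / \<xi>\<^sup>2)" by blast+
    let ?K = "particles I x r" and ?W = "\<lambda>i. vanishing (cball (x i) (r i))"
    let ?c = "max 1 (\<xi>\<^sup>2)"
    obtain R where R: "\<And>i. i \<in> I \<Longrightarrow> 0 < r i \<and> \<kappa> * r i \<le> R i \<and> r i / R i ^ 3 \<le> (8 * max Cs 0 + 1) / \<xi>\<^sup>2"
      "disjoint_family_on (\<lambda>i. ball (x i) (R i)) I"
      using separated_balls[OF \<xi> _ _ cap, of \<kappa>] sep \<open>1 < \<kappa>\<close> by auto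
    interpret S: subspace_family "energy \<xi>" "min 1 (1 / \<xi>\<^sup>2)" I ?W M
      by (rule family[OF \<xi> R])
    have V: "S.V = vanishing ?K" by (simp add: S.V_def vanishing_particles)
    have dirichlet: "dirichlet_solution \<xi> ?K f u \<longleftrightarrow> u \<in> S.V \<and> (\<forall>v\<in>S.V. energy \<xi> u v = blinfun_apply f v)" for u
      by (simp add: dirichlet_solution_def solves_outside_iff V) (simp add: vanishing_def)
    define p where "p = Phi0 \<xi> f"
    \<comment> \<open>Every function vanishes on the empty set, so \<open>Phi0\<close> represents f
      on the whole space.\<close>
    have p: "energy \<xi> p v = blinfun_apply f v" for v
    proof -
      have U: "vanishing {} = UNIV" by (auto simp: vanishing_iff)
      have "solves_outside \<xi> {} f p"
        unfolding p_def Phi0_def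
      proof (rule theI')
        obtain w where w: "\<And>v. energy \<xi> w v = blinfun_apply f v"
          using S.lax_milgram[OF subspace_UNIV closed_UNIV blinfun.bounded_linear_right, of f] by auto
        show "\<exists>!w. solves_outside \<xi> {} f w"
          unfolding solves_outside_iff U
          using w S.orthogonal_unique[OF subspace_UNIV, of _ w] by (intro ex1I[of _ w]) auto
      qed
      then show ?thesis by (simp add: solves_outside_iff U)
    qed
    \<comment> \<open>\<open>E = f p\<close> is at most \<open>norm f * norm p\<close>, and the
      square of \<open>norm p\<close> is at most \<open>?c * E\<close>; squaring and cancelling
      \<open>E\<close> gives the bound.\<close>
    have energy_p: "energy \<xi> p p \<le> ?c * (norm f)\<^sup>2"
    proof -
      define E where "E = energy \<xi> p p"
      have E0: "0 \<le> E" unfolding E_def by (rule S.nonneg)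
      have "E\<^sup>2 \<le> (norm f * norm p)\<^sup>2"
        using norm_blinfun[of f p] E0 by (intro power_mono) (auto simp: E_def p)
      also have "\<dots> \<le> (norm f)\<^sup>2 * (?c * E)"
        unfolding power_mult_distrib E_def by (intro mult_left_mono norm_sq_le_energy \<xi>) simp
      finally have "E * E \<le> (?c * (norm f)\<^sup>2) * E" by (simp add: power2_eq_square mult_ac)
      then show ?thesis
        using E0 by (cases "E = 0") (simp_all add: E_def[symmetric])
    qed
    let ?P = "Phi \<xi> I x r f" and ?R = "reflection \<xi> I x r f"
    have P: "?P 0 = p" "?P (Suc k) = (\<Sum>\<^sub>\<infinity>i\<in>I. ?R k i)" for k by (simp_all add: p_def)
    have R0: "?R 0 i = - S.Q i p" and R_Suc: "?R (Suc k) i = - S.Q i (\<Sum>\<^sub>\<infinity>j\<in>I - {i}. ?R k j)" for i k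
      by (simp_all add: Q_proj_eq[OF \<xi>] p_def)
    have summable: "\<forall>k. ?R k summable_on I"
      using S.R_summable[of ?P p ?R, OF P R0 R_Suc] by blast
    obtain u0 where u0: "u0 \<in> S.V" "\<And>v. v \<in> S.V \<Longrightarrow> energy \<xi> u0 v = blinfun_apply f v"
      using S.lax_milgram[OF S.V_subspace S.V_closed blinfun.bounded_linear_right, of f] by auto
    have unique: "\<exists>!u. dirichlet_solution \<xi> ?K f u"
      unfolding dirichlet
    proof (rule ex1I[of _ u0])
      fix u assume u: "u \<in> S.V \<and> (\<forall>v\<in>S.V. energy \<xi> u v = blinfun_apply f v)"
      show "u = u0"
        by (rule S.orthogonal_unique[OF S.V_subspace]) (simp_all add: u u0)
    qed (simp add: u0)
    have square: "c * ((e\<^sup>2) ^ N * (c * h\<^sup>2)) = (c * e ^ N * h)\<^sup>2" for c e h :: real and N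
    proof -
      have "(e\<^sup>2) ^ N = e ^ N * e ^ N" by (simp add: power2_eq_square power_mult_distrib)
      then show ?thesis by (simp add: power2_eq_square)
    qed
    have main: "let \<Psi> = (\<lambda>N. \<Sum>k\<le>N. ?q k N *\<^sub>R ?P k); e = (\<lambda>N. h1_norm_on (- ?K) (\<Psi> N - u))
        in e \<longlonglongrightarrow> 0 \<and> (\<forall>N. e N \<le> ?c * \<epsilon> ^ N * norm f)"
      if u: "dirichlet_solution \<xi> ?K f u" for u
    proof -
      define e where "e N = h1_norm_on (- ?K) ((\<Sum>k\<le>N. ?q k N *\<^sub>R ?P k) - u)" for N
      \<comment> \<open>Both \<open>p\<close> and \<open>u\<close> represent f on
        \<open>S.V\<close>, so \<open>u\<close> is the projection of \<open>p\<close> onto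
        it.\<close>
      have orth: "energy \<xi> (p - u) v = 0" if "v \<in> S.V" for v
        using u that by (auto simp: dirichlet S.form.diff_left p)
      have e_le: "e N \<le> ?c * \<epsilon> ^ N * norm f" for N
      proof -
        let ?d = "(\<Sum>k\<le>N. ?q k N *\<^sub>R ?P k) - u"
        have "energy \<xi> ?d ?d \<le> (\<epsilon>\<^sup>2) ^ N * energy \<xi> p p"
          using S.averaged_reflections_converge[of ?P p ?R, OF P R0 R_Suc g_def _ orth, of N] u
          by (simp add: S.\<Psi>_def[OF P R0 R_Suc] \<epsilon>(3) dirichlet)
        also have "\<dots> \<le> (\<epsilon>\<^sup>2) ^ N * (?c * (norm f)\<^sup>2)"
          by (intro mult_left_mono energy_p) simp
        finally have d_le: "energy \<xi> ?d ?d \<le> (\<epsilon>\<^sup>2) ^ N * (?c * (norm f)\<^sup>2)" .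
        have "(norm ?d)\<^sup>2 \<le> ?c * energy \<xi> ?d ?d" by (rule norm_sq_le_energy[OF \<xi>])
        also have "\<dots> \<le> ?c * ((\<epsilon>\<^sup>2) ^ N * (?c * (norm f)\<^sup>2))"
          by (intro mult_left_mono d_le) simp
        also have "\<dots> = (?c * \<epsilon> ^ N * norm f)\<^sup>2" by (rule square)
        finally have "norm ?d \<le> ?c * \<epsilon> ^ N * norm f"
          by (rule power2_le_imp_le) (use \<epsilon>(1) in simp_all)
        moreover have "e N \<le> norm ?d"
          unfolding e_def by (rule h1_norm_on_le) (use particles_measurable[of I x r] in auto)
        ultimately show ?thesis by linarith
      qed
      have "(\<lambda>N. ?c * \<epsilon> ^ N * norm f) \<longlonglongrightarrow> ?c * 0 * norm f"
        by (intro tendsto_intros LIMSEQ_realpow_zero) (use \<epsilon> in auto)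
      then have "(\<lambda>N. ?c * \<epsilon> ^ N * norm f) \<longlonglongrightarrow> 0" by simp
      then have "e \<longlonglongrightarrow> 0"
        by (rule Lim_null_comparison[rotated])
           (use e_le h1_norm_on_nonneg in \<open>auto simp: e_def abs_of_nonneg\<close>)
      then show ?thesis using e_le unfolding Let_def e_def[abs_def] by blast
    qed
    show ?case
      using summable unique main by blast
  qed
qed

end
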